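(* Let $E\subset\mathbb R$ be an essentially closed compact set with gaps $(\alpha_j,\beta_j)$, $j\ge 0$, and suppose $d\rho$ is a reflectionless absolutely continuous probability measure on $E$. Then, for every $k\ge 1$, $$\int_E\frac{d\rho(t)}{|t-x|}\le C_k\sup_{d\mu\in\mathcal R_E}\left|\int_E\frac{d\mu(t)}{t-x}\right|,\qquad x\in(\alpha_k,\beta_k),$$ where $$C_k=9+2\min\left\{\log\frac{\beta_k-\beta_0}{\beta_k-\alpha_k},\ \log\frac{\alpha_0-\alpha_k}{\beta_k-\alpha_k}\right\}.$$ Equivalently, if for fixed $x\in(\alpha_k,\beta_k)$ one defines $\tilde\gamma_j\in\{\alpha_j,\beta_j\}$ such that $|x-\tilde\gamma_j|=\max\{|x-\alpha_j|,|x-\beta_j|\}$ for $j\ge 1$, then $$\int_E\frac{d\rho(t)}{|t-x|}\le\frac{C_k}{\sqrt{|x-\beta_0||x-\alpha_0|}}\prod_{j\ge1}\frac{|x-\tilde\gamma_j|}{\sqrt{|x-\alpha_j||x-\beta_j|}}.$$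
   Context: For a compact set $E\subset\mathbb R$ let $\beta_0=\inf E$, $\alpha_0=\sup E$, and write $[\beta_0,\alpha_0]\setminus E=\bigcup_{j\ge1}(\alpha_j,\beta_j)$ as a (finite or countable) disjoint union of open intervals; these are the inner gaps of $E$. The outer gap is $(\alpha_0,\beta_0):=(-\infty,\beta_0)\cup(\alpha_0,\infty)$. $E$ is essentially closed if $|E\cap(x-\varepsilon,x+\varepsilon)|>0$ for all $x\in E$ and $\varepsilon>0$ ($|\cdot|$ is Lebesgue measure). A probability measure $d\rho$ supported on $E$ is reflectionless (on $E$) if $m(z)=\int_E\frac{d\rho(t)}{t-z}$, $z\in\mathbb C\setminus E$, satisfies $\operatorname{Re}[m(x+i0)]=0$ for Lebesgue-a.e. $x\in E$. $\mathcal R_E$ denotes the set of all reflectionless probability measures supported on $E$. *)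

theory Defs
  imports "HOL-Probability.Probability"
begin

definition essentially_closed :: "real set \<Rightarrow> bool" where
  "essentially_closed E \<longleftrightarrow>
     (\<forall>x\<in>E. \<forall>\<epsilon>>0. emeasure lborel (E \<inter> {x - \<epsilon><..<x + \<epsilon>}) > 0)"

(* J is the index set of the inner gaps, an arbitrary finite or infinite set of positive
   integers.  Index 0 is the outer gap (-\<infinity>, \<beta> 0) \<union> (\<alpha> 0, \<infinity>), whence the reversed roles
   of \<alpha> 0 and \<beta> 0. *)
definition gap_enumeration :: "real set \<Rightarrow> nat set \<Rightarrow> (nat \<Rightarrow> real) \<Rightarrow> (nat \<Rightarrow> real) \<Rightarrow> bool" where
  "gap_enumeration E J \<alpha> \<beta> \<longleftrightarrow>
     J \<subseteq> {1..} \<and> \<beta> 0 = Inf E \<and> \<alpha> 0 = Sup E \<and>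
     (\<forall>j\<in>J. \<alpha> j < \<beta> j) \<and>
     disjoint_family_on (\<lambda>j. {\<alpha> j<..<\<beta> j}) J \<and>
     {\<beta> 0..\<alpha> 0} - E = (\<Union>j\<in>J. {\<alpha> j<..<\<beta> j})"

definition prob_measure_on :: "real set \<Rightarrow> real measure \<Rightarrow> bool" where
  "prob_measure_on E \<rho> \<longleftrightarrow> sets \<rho> = sets borel \<and> prob_space \<rho> \<and> (AE t in \<rho>. t \<in> E)"

definition stieltjes_transform :: "real set \<Rightarrow> real measure \<Rightarrow> complex \<Rightarrow> complex" where
  "stieltjes_transform E \<rho> z = (LINT t:E|\<rho>. 1 / (complex_of_real t - z))"

(* m(x + i0) is the finite limit of m(x + iy) as y decreases to 0; its existence is part of the
   condition. *)
definition reflectionless :: "real set \<Rightarrow> real measure \<Rightarrow> bool" where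
  "reflectionless E \<rho> \<longleftrightarrow>
     (AE x in lborel. x \<in> E \<longrightarrow>
        (\<exists>w. ((\<lambda>y. stieltjes_transform E \<rho> (Complex x y)) \<longlongrightarrow> w) (at_right 0) \<and> Re w = 0))"

definition reflectionless_measures :: "real set \<Rightarrow> real measure set" where
  "reflectionless_measures E = {\<rho>. prob_measure_on E \<rho> \<and> reflectionless E \<rho>}"

definition gap_const :: "(nat \<Rightarrow> real) \<Rightarrow> (nat \<Rightarrow> real) \<Rightarrow> nat \<Rightarrow> real" where
  "gap_const \<alpha> \<beta> k =
     9 + 2 * min (ln ((\<beta> k - \<beta> 0) / (\<beta> k - \<alpha> k))) (ln ((\<alpha> 0 - \<alpha> k) / (\<beta> k - \<alpha> k)))"

end

theory Submission imports Defs "HOL-Complex_Analysis.Complex_Analysis" "HOL-Real_Asymp.Real_Asymp" begin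

text \<open>
The proof works with operations on reflectionless measures that treat one gap at a time.

The Cauchy transform m of a probability measure on E is real and increasing in every gap, so it changes
sign there at most once.  Call the point where it does so the zero of m in the gap; if m keeps its sign,
the zero is the endpoint that is compatible with that sign.  Two operations lead to new reflectionless
measures.  Moving the zero g to an endpoint c multiplies m by (z - c)/(z - g)
(\<open>move_reflectionless\<close>).  Filling a gap (a, b) whose zero is the endpoint c multiplies m by
(d - z) A(z), where d is the other endpoint and A is the Cauchy transform of the arcsine distribution of
(a, b); this product is a branch of the square root of (z - d)/(z - c), and afterwards the measure is
reflectionless on the gap too (\<open>fill_reflectionless\<close>).  Both operations multiply the measure
on the old set by an explicit weight.

Once all gaps are filled there is only one candidate left.  If reflectionless measures live on sets that
exhaust an interval up to small measure, they converge to the arcsine distribution of the interval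
(\<open>reflectionless_limit\<close>): the quotient q of the two Cauchy transforms avoids the negative
half-line and has nonnegative boundary values off the small exceptional set, so a bounded holomorphic
function of q has small imaginary part by the Poisson formula.  Filling one last gap carries this
over to sets with a single open gap (\<open>one_gap_limit\<close>).

This is used twice.  First, moving the zeros of all gaps to the endpoints far from x can only increase
|m(x)|, and filling the gaps then shows that |m(x)| tends to the product in the theorem
(\<open>far_sequence\<close>).  Hence that product is the supremum of |m(x)| over all reflectionless
measures, and the two forms of the estimate agree.  Second, let I be the integral of 1/(t - x) over the
part of E to the right of x.  Moving the zeros of the gaps to the left of x, and of the gap around x, to
their left endpoints increases I, and filling the gaps to the left of x then costs at most their factors
in the product.  Now I equals m(x), which is under control, plus the corresponding integral to the left of
x, and for the latter the gaps to the right of x are treated in the mirrored way.  In the limit everything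
except the gap around x has been filled, and an explicit integral against the arcsine distribution
remains, which is responsible for the logarithm (\<open>arcsine_tail_bound\<close>).  So I is at most
4 + log times the product, and the integral of 1/|t - x| is 2 I - m(x), at most 9 + 2 log times it.
Reflection in the origin supplies the other logarithm.
\<close>

section \<open>Sums of measures and Cauchy transforms\<close>

definition measure_sum :: "'a measure \<Rightarrow> 'a measure \<Rightarrow> 'a measure" where
  "measure_sum M N = measure_of (space M) (sets M) (\<lambda>A. emeasure M A + emeasure N A)"

lemma sets_measure_sum [simp, measurable_cong]: "sets (measure_sum M N) = sets M"
  by (simp add: measure_sum_def)

lemma space_measure_sum [simp]: "space (measure_sum M N) = space M"
  by (simp add: measure_sum_def)

lemma emeasure_measure_sum:
  assumes "sets N = sets M" "A \<in> sets M"
  shows "emeasure (measure_sum M N) A = emeasure M A + emeasure N A"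
proof (rule emeasure_measure_of[OF measure_sum_def])
  show "countably_additive (sets (measure_sum M N)) (\<lambda>A. emeasure M A + emeasure N A)"
  proof (rule countably_additiveI)
    fix F :: "nat \<Rightarrow> 'a set"
    assume *: "range F \<subseteq> sets (measure_sum M N)" "disjoint_family F"
    have "range F \<subseteq> sets M" "range F \<subseteq> sets N"
      using *(1) assms(1) by auto
    with *(2) show "(\<Sum>i. emeasure M (F i) + emeasure N (F i))
        = emeasure M (\<Union> (range F)) + emeasure N (\<Union> (range F))"
      by (subst suminf_add[symmetric]) (auto simp: suminf_emeasure)
  qed
  show "sets M \<subseteq> Pow (space M)" by (rule sets.space_closed)
qed (use assms in \<open>auto simp: positive_def\<close>)

lemma nn_integral_measure_sum:
  assumes s: "sets N = sets M" and "f \<in> borel_measurable M"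
  shows "(\<integral>\<^sup>+ x. f x \<partial>measure_sum M N) = (\<integral>\<^sup>+ x. f x \<partial>M) + (\<integral>\<^sup>+ x. f x \<partial>N)"
  using assms(2)
proof (induction rule: borel_measurable_induct)
  case (cong f g)
  have "space N = space M" using s by (rule sets_eq_imp_space_eq)
  with cong show ?case
    by (simp cong: nn_integral_cong_simp)
next
  case (set A)
  then show ?case using s by (simp add: emeasure_measure_sum)
next
  case (mult u c)
  moreover have "u \<in> borel_measurable N" "u \<in> borel_measurable (measure_sum M N)"
    using mult measurable_cong_sets[OF s refl, of borel]
      measurable_cong_sets[OF sets_measure_sum refl, of M N borel] by auto
  ultimately show ?case by (simp add: nn_integral_cmult distrib_left)
next
  case (add u v)
  moreover have "u \<in> borel_measurable N" "u \<in> borel_measurable (measure_sum M N)"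
       "v \<in> borel_measurable N" "v \<in> borel_measurable (measure_sum M N)"
    using add measurable_cong_sets[OF s refl, of borel]
      measurable_cong_sets[OF sets_measure_sum refl, of M N borel] by auto
  ultimately show ?case by (simp add: nn_integral_add ac_simps)
next
  case (seq U)
  have "U i \<in> borel_measurable N" "U i \<in> borel_measurable (measure_sum M N)" for i
    using seq measurable_cong_sets[OF s refl, of borel]
      measurable_cong_sets[OF sets_measure_sum refl, of M N borel] by auto
  moreover have "Sup (range U) = (\<lambda>x. SUP i. U i x)" by (auto simp: fun_eq_iff image_comp)
  moreover have "incseq (\<lambda>i. integral\<^sup>N M (U i))" "incseq (\<lambda>i. integral\<^sup>N N (U i))"
    using seq(3) by (auto simp: incseq_def le_fun_def intro!: nn_integral_mono)
  ultimately show ?case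
    using seq by (simp add: nn_integral_monotone_convergence_SUP ennreal_SUP_add)
qed

lemma integral_measure_sum_real:
  fixes f :: "'a \<Rightarrow> real"
  assumes s: "sets N = sets M" and f: "integrable M f" "integrable N f"
  shows "integrable (measure_sum M N) f"
    and "(\<integral>x. f x \<partial>measure_sum M N) = (\<integral>x. f x \<partial>M) + (\<integral>x. f x \<partial>N)"
proof -
  have m: "f \<in> borel_measurable M" using f by simp
  show i: "integrable (measure_sum M N) f"
    using f m by (simp add: integrable_iff_bounded nn_integral_measure_sum[OF s]
        measurable_cong_sets[OF sets_measure_sum refl])
  have pos: "(\<integral>\<^sup>+ x. ennreal (g x) \<partial>measure_sum M N) = (\<integral>\<^sup>+ x. ennreal (g x) \<partial>M) + (\<integral>\<^sup>+ x. ennreal (g x) \<partial>N)"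
    if "g \<in> borel_measurable M" for g :: "'a \<Rightarrow> real"
    using that by (intro nn_integral_measure_sum[OF s]) auto
  have fin: "(\<integral>\<^sup>+ x. ennreal (f x) \<partial>M) < \<infinity>" "(\<integral>\<^sup>+ x. ennreal (f x) \<partial>N) < \<infinity>"
      "(\<integral>\<^sup>+ x. ennreal (- f x) \<partial>M) < \<infinity>" "(\<integral>\<^sup>+ x. ennreal (- f x) \<partial>N) < \<infinity>"
    using f by (auto simp: real_integrable_def less_top)
  show "(\<integral>x. f x \<partial>measure_sum M N) = (\<integral>x. f x \<partial>M) + (\<integral>x. f x \<partial>N)"
    using fin by (simp add: real_lebesgue_integral_def f i pos m enn2real_plus)
qed

lemma integral_measure_sum:
  fixes f :: "'a \<Rightarrow> complex"
  assumes s: "sets N = sets M" and f: "integrable M f" "integrable N f"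
  shows "integrable (measure_sum M N) f"
    and "(\<integral>x. f x \<partial>measure_sum M N) = (\<integral>x. f x \<partial>M) + (\<integral>x. f x \<partial>N)"
proof -
  note R = integral_measure_sum_real[OF s, of "\<lambda>x. Re (f x)"]
  note I = integral_measure_sum_real[OF s, of "\<lambda>x. Im (f x)"]
  have *: "integrable M (\<lambda>x. Re (f x))" "integrable N (\<lambda>x. Re (f x))"
     "integrable M (\<lambda>x. Im (f x))" "integrable N (\<lambda>x. Im (f x))"
    using f by auto
  show i: "integrable (measure_sum M N) f"
  proof -
    have "integrable (measure_sum M N) (\<lambda>x. of_real (Re (f x)) + \<i> * of_real (Im (f x)))"
      using R(1) I(1) * by (intro Bochner_Integration.integrable_add integrable_mult_right integrable_of_real) auto
    then show ?thesis by (simp flip: complex_eq)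
  qed
  show "(\<integral>x. f x \<partial>measure_sum M N) = (\<integral>x. f x \<partial>M) + (\<integral>x. f x \<partial>N)"
    using R(2) I(2) * f i by (intro complex_eqI) auto
qed

text \<open>The integrals run over the whole line, so the symbol stays the same while the set that carries the
measure changes; on the real line outside that set the transform is real.\<close>
definition cauchy :: "real measure \<Rightarrow> complex \<Rightarrow> complex" where
  "cauchy \<mu> z = (\<integral>t. 1 / (of_real t - z) \<partial>\<mu>)"

definition rcauchy :: "real measure \<Rightarrow> real \<Rightarrow> real" where
  "rcauchy \<mu> s = (\<integral>t. 1 / (t - s) \<partial>\<mu>)"

text \<open>Away from the set that carries the measure, at a positive distance from it, the kernel 1/(t - z) is
bounded and the Cauchy transform is holomorphic.\<close>
definition apart :: "real set \<Rightarrow> complex \<Rightarrow> bool" where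
  "apart K z \<longleftrightarrow> (\<exists>\<epsilon>>0. \<forall>t\<in>K. \<epsilon> \<le> cmod (of_real t - z))"

lemma prob_measure_onD:
  assumes "prob_measure_on K \<mu>"
  shows "sets \<mu> = sets borel" "prob_space \<mu>" "AE t in \<mu>. t \<in> K"
    "space \<mu> = UNIV" "finite_measure \<mu>" "sigma_finite_measure \<mu>" "measure \<mu> UNIV = 1" "emeasure \<mu> UNIV = 1"
proof -
  show *: "sets \<mu> = sets borel" "prob_space \<mu>" "AE t in \<mu>. t \<in> K"
    using assms by (auto simp: prob_measure_on_def)
  show **: "space \<mu> = UNIV" using sets_eq_imp_space_eq[OF *(1)] by simp
  interpret prob_space \<mu> by fact
  show "finite_measure \<mu>" "sigma_finite_measure \<mu>" by unfold_locales
  show "measure \<mu> UNIV = 1" "emeasure \<mu> UNIV = 1"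
    using prob_space emeasure_space_1 ** by auto
qed


lemma apart_mono: "apart K z \<Longrightarrow> L \<subseteq> K \<Longrightarrow> apart L z"
  unfolding apart_def by blast


lemma apart_Im: assumes "Im z \<noteq> 0" shows "apart K z"
  unfolding apart_def
proof (intro exI[of _ "\<bar>Im z\<bar>"] conjI ballI)
  fix t show "\<bar>Im z\<bar> \<le> cmod (of_real t - z)"
    using abs_Im_le_cmod[of "of_real t - z"] by simp
qed (use assms in simp)

lemma apart_gap:
  assumes "s \<in> {a<..<b}" "K \<inter> {a<..<b} = {}"
  shows "apart K (of_real s)"
  unfolding apart_def
proof (intro exI[of _ "min (s - a) (b - s)"] conjI ballI)
  fix t assume "t \<in> K"
  with assms have "t \<le> a \<or> b \<le> t" by force
  then have "min (s - a) (b - s) \<le> \<bar>t - s\<bar>" using assms by auto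
  then show "min (s - a) (b - s) \<le> cmod (of_real t - of_real s)"
    by (metis norm_of_real of_real_diff)
qed (use assms in auto)

lemma apart_notin: "apart K (of_real s) \<Longrightarrow> s \<notin> K"
  unfolding apart_def by force

lemma cauchy_AE_bound:
  assumes "prob_measure_on K \<mu>" "apart K z"
  obtains e where "e > 0" "AE t in \<mu>. e \<le> cmod (of_real t - z)"
  using assms prob_measure_onD(3)[OF assms(1)] unfolding apart_def
  by (metis (mono_tags, lifting) eventually_mono)

lemma integrable_cauchy:
  assumes "prob_measure_on K \<mu>" "apart K z"
  shows "integrable \<mu> (\<lambda>t. 1 / (of_real t - z) :: complex)"
proof -
  note [measurable_cong] = prob_measure_onD(1)[OF assms(1)]
  interpret finite_measure \<mu> using prob_measure_onD(5)[OF assms(1)] .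
  obtain e where e: "e > 0" "AE t in \<mu>. e \<le> cmod (of_real t - z)"
    using cauchy_AE_bound[OF assms] .
  show ?thesis
  proof (rule integrable_const_bound)
    show "AE t in \<mu>. norm (1 / (of_real t - z)) \<le> 1 / e"
      using e(2) by eventually_elim (use e(1) in \<open>auto simp: norm_divide intro!: divide_left_mono mult_pos_pos\<close>)
  qed measurable
qed

lemma integrable_rcauchy:
  assumes "prob_measure_on K \<mu>" "apart K (of_real s)"
  shows "integrable \<mu> (\<lambda>t. 1 / (t - s))"
proof -
  have "integrable \<mu> (\<lambda>t. complex_of_real (1 / (t - s)))"
    using integrable_cauchy[OF assms] by simp
  then show ?thesis
    by (simp only: complex_of_real_integrable_eq)
qed

lemma cauchy_of_real: "cauchy \<mu> (of_real s) = of_real (rcauchy \<mu> s)"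
  unfolding cauchy_def rcauchy_def
  by (simp flip: integral_complex_of_real)

lemma stieltjes_transform_eq_cauchy:
  assumes "prob_measure_on K \<mu>" "K \<in> sets borel"
  shows "stieltjes_transform K \<mu> z = cauchy \<mu> z"
proof -
  note [measurable_cong] = prob_measure_onD(1)[OF assms(1)]
  note [measurable] = assms(2)
  show ?thesis
    unfolding stieltjes_transform_def cauchy_def set_lebesgue_integral_def
    by (rule integral_cong_AE) (use prob_measure_onD(3)[OF assms(1)] in \<open>auto elim!: eventually_mono\<close>)
qed

text \<open>The difference quotient at z is itself an integral, of 1/((t - w)(t - z)), and this kernel is bounded
as w tends to z.\<close>
lemma cauchy_has_derivative:
  assumes "prob_measure_on K \<mu>" "apart K z"
  obtains D where "(cauchy \<mu> has_field_derivative D) (at z)"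
proof -
  note [measurable_cong] = prob_measure_onD(1)[OF assms(1)]
  interpret prob_space \<mu> using prob_measure_onD(2)[OF assms(1)] .
  obtain e where e: "e > 0" "\<forall>t\<in>K. e \<le> cmod (of_real t - z)"
    using assms(2) unfolding apart_def by auto
  define D where "D = (\<integral>t. 1 / (of_real t - z)\<^sup>2 \<partial>\<mu>)"
  have "((\<lambda>w. (cauchy \<mu> w - cauchy \<mu> z) / (w - z)) \<longlongrightarrow> D) (at z)"
    unfolding tendsto_at_iff_sequentially comp_def
  proof (intro allI impI)
    fix X :: "nat \<Rightarrow> complex" assume X: "\<forall>i. X i \<in> UNIV - {z}" "X \<longlonglongrightarrow> z"
    have "\<forall>\<^sub>F i in sequentially. dist (X i) z < e/2"
      using tendstoD[OF X(2), of "e/2"] e(1) by simp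
    then obtain N where N: "\<And>i. i \<ge> N \<Longrightarrow> cmod (X i - z) < e/2"
      by (auto simp: eventually_sequentially dist_norm)
    have far: "e/2 \<le> cmod (of_real t - X i)" if "t \<in> K" "i \<ge> N" for t i
      using e(2) N[OF that(2)] that(1) norm_triangle_ineq[of "of_real t - X i" "X i - z"] by fastforce
    have offX: "apart K (X i)" if "i \<ge> N" for i
      unfolding apart_def using far that e(1) by (intro exI[of _ "e/2"]) auto
    have "(\<lambda>i. \<integral>t. 1 / ((of_real t - X (i + N)) * (of_real t - z)) \<partial>\<mu>) \<longlonglongrightarrow> D"
      unfolding D_def
    proof (rule integral_dominated_convergence[where w = "\<lambda>_. 1 / (e/2 * e)"])
      show "AE t in \<mu>. (\<lambda>i. 1 / ((of_real t - X (i + N)) * (of_real t - z))) \<longlonglongrightarrow> 1 / (of_real t - z)\<^sup>2"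
        using prob_measure_onD(3)[OF assms(1)]
      proof eventually_elim
        case (elim t)
        have "(\<lambda>i. X (i + N)) \<longlonglongrightarrow> z" using X(2) by (rule LIMSEQ_ignore_initial_segment)
        moreover have "of_real t - z \<noteq> 0" using e elim by fastforce
        ultimately show ?case unfolding power2_eq_square
          by (intro tendsto_intros) auto
      qed
      fix i
      show "AE t in \<mu>. norm (1 / ((of_real t - X (i + N)) * (of_real t - z))) \<le> 1 / (e/2 * e)"
        using prob_measure_onD(3)[OF assms(1)]
      proof eventually_elim
        case (elim t)
        have "e/2 * e \<le> cmod (of_real t - X (i + N)) * cmod (of_real t - z)"
          using far[OF elim, of "i + N"] e elim by (intro mult_mono) auto
        moreover have "0 < e/2 * e" using e(1) by simp
        ultimately have "1 / (cmod (of_real t - X (i + N)) * cmod (of_real t - z)) \<le> 1 / (e/2 * e)"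
          by (intro divide_left_mono) (linarith | rule mult_pos_pos)+
        then show ?case by (simp only: norm_divide norm_mult norm_one)
      qed
    qed auto
    moreover have "(\<integral>t. 1 / ((of_real t - X (i + N)) * (of_real t - z)) \<partial>\<mu>)
        = (cauchy \<mu> (X (i + N)) - cauchy \<mu> z) / (X (i + N) - z)" for i
    proof -
      have int: "integrable \<mu> (\<lambda>t. 1 / (of_real t - X (i + N)))" "integrable \<mu> (\<lambda>t. 1 / (of_real t - z))"
        using integrable_cauchy[OF assms(1)] offX[of "i + N"] assms(2) by auto
      have "(\<integral>t. 1 / ((of_real t - X (i + N)) * (of_real t - z)) \<partial>\<mu>)
        = (\<integral>t. (1 / (of_real t - X (i + N)) - 1 / (of_real t - z)) / (X (i + N) - z) \<partial>\<mu>)"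
      proof (rule integral_cong_AE)
        show "AE t in \<mu>. 1 / ((of_real t - X (i + N)) * (of_real t - z))
          = (1 / (of_real t - X (i + N)) - 1 / (of_real t - z)) / (X (i + N) - z)"
          using prob_measure_onD(3)[OF assms(1)]
        proof eventually_elim
          case (elim t)
          have "of_real t - z \<noteq> 0" using e elim by fastforce
          moreover have "of_real t - X (i + N) \<noteq> 0" using far[OF elim, of "i+N"] e(1) by auto
          moreover have "X (i + N) - z \<noteq> 0" using X by auto
          moreover have aux: "1 / (u * v) = (1 / u - 1 / v) / (v - u)" if "u \<noteq> 0" "v \<noteq> 0" "v - u \<noteq> 0" for u v :: complex
            using that by (simp add: diff_frac_eq)
          ultimately show ?case
            using aux[of "of_real t - X (i + N)" "of_real t - z"] by simp
        qed
      qed auto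
      also have "\<dots> = (cauchy \<mu> (X (i + N)) - cauchy \<mu> z) / (X (i + N) - z)"
        using int unfolding cauchy_def by simp
      finally show ?thesis .
    qed
    ultimately have "(\<lambda>i. (cauchy \<mu> (X (i + N)) - cauchy \<mu> z) / (X (i + N) - z)) \<longlonglongrightarrow> D" by simp
    then show "(\<lambda>i. (cauchy \<mu> (X i) - cauchy \<mu> z) / (X i - z)) \<longlonglongrightarrow> D"
      by (rule LIMSEQ_offset)
  qed
  then show ?thesis using that by (auto simp: has_field_derivative_iff)
qed

lemma holomorphic_cauchy:
  assumes "prob_measure_on K \<mu>" "\<And>z. z \<in> S \<Longrightarrow> apart K z"
  shows "cauchy \<mu> holomorphic_on S"
  unfolding holomorphic_on_def
  by (metis assms cauchy_has_derivative field_differentiable_def field_differentiable_at_within)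

lemma isCont_cauchy:
  assumes "prob_measure_on K \<mu>" "apart K z"
  shows "isCont (cauchy \<mu>) z"
  by (metis assms cauchy_has_derivative DERIV_isCont)

lemma tendsto_Complex_at_right: "((\<lambda>y. Complex x y) \<longlongrightarrow> of_real x) (at_right 0)"
proof -
  have "((\<lambda>y. Complex x y) \<longlongrightarrow> Complex x 0) (at_right 0)"
    by (intro tendsto_Complex tendsto_intros)
  then show ?thesis by (simp add: complex_of_real_def)
qed

lemma cauchy_boundary_real:
  assumes "prob_measure_on K \<mu>" "apart K (of_real x)"
  shows "((\<lambda>y. cauchy \<mu> (Complex x y)) \<longlongrightarrow> of_real (rcauchy \<mu> x)) (at_right 0)"
  using isCont_tendsto_compose[OF isCont_cauchy[OF assms] tendsto_Complex_at_right]
  by (simp add: cauchy_of_real)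

lemma Im_cauchy_pos:
  assumes "prob_measure_on K \<mu>" "Im z > 0"
  shows "Im (cauchy \<mu> z) > 0"
proof -
  interpret prob_space \<mu> using prob_measure_onD(2)[OF assms(1)] .
  have int: "integrable \<mu> (\<lambda>t. 1 / (of_real t - z))"
    using integrable_cauchy[OF assms(1) apart_Im] assms(2) by auto
  have im: "Im (1 / (of_real t - z)) > 0" for t
    using assms(2) by (auto simp: Im_divide intro!: divide_pos_pos add_nonneg_pos)
  have "Im (cauchy \<mu> z) = (\<integral>t. Im (1 / (of_real t - z)) \<partial>\<mu>)"
    unfolding cauchy_def by (rule integral_Im[OF int, symmetric])
  also have "\<dots> > (\<integral>t. 0 \<partial>\<mu>)"
    by (rule integral_less_AE_space) (use int im emeasure_space_1 in auto)
  finally show ?thesis by simp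
qed

text \<open>The condition on the boundary values in the definition of a reflectionless measure, at a single point.\<close>
definition imaginary_boundary_value :: "real measure \<Rightarrow> real \<Rightarrow> bool" where
  "imaginary_boundary_value \<mu> x \<longleftrightarrow> (\<exists>w. ((\<lambda>y. cauchy \<mu> (Complex x y)) \<longlongrightarrow> w) (at_right 0) \<and> Re w = 0)"

lemma reflectionless_measures_iff:
  assumes "K \<in> sets borel"
  shows "\<mu> \<in> reflectionless_measures K \<longleftrightarrow>
    prob_measure_on K \<mu> \<and> (AE x in lborel. x \<in> K \<longrightarrow> imaginary_boundary_value \<mu> x)"
  unfolding reflectionless_measures_def reflectionless_def imaginary_boundary_value_def
  using stieltjes_transform_eq_cauchy[OF _ assms] by auto

section \<open>The arcsine distribution\<close>

text \<open>The fundamental theorem for nonnegative integrands that may be unbounded at both ends of the interval.\<close>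
lemma FTC_open_interval:
  fixes f F :: "real \<Rightarrow> real"
  assumes "p < r"
    and F: "\<And>s. s \<in> {p<..<r} \<Longrightarrow> (F has_real_derivative f s) (at s)"
    and f: "\<And>s. s \<in> {p<..<r} \<Longrightarrow> isCont f s" "\<And>s. s \<in> {p<..<r} \<Longrightarrow> 0 \<le> f s"
    and A: "(F \<longlongrightarrow> A) (at_right p)" and B: "(F \<longlongrightarrow> B) (at_left r)"
  shows "has_bochner_integral lborel (\<lambda>s. indicator {p<..<r} s * f s) (B - A)"
proof -
  have *: "((F \<circ> real_of_ereal) \<longlongrightarrow> A) (at_right (ereal p))" "((F \<circ> real_of_ereal) \<longlongrightarrow> B) (at_left (ereal r))"
    using A B by (simp_all add: ereal_tendsto_simps)
  have e: "einterval (ereal p) (ereal r) = {p<..<r}" by (auto simp: einterval_def)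
  have "set_integrable lborel (einterval p r) f" "(LBINT s=p..r. f s) = B - A"
    by (rule interval_integral_FTC_nonneg[OF _ _ _ _ *]; use assms in force)+
  then show ?thesis
    using assms(1) unfolding e set_integrable_def set_lebesgue_integral_def interval_lebesgue_integral_def
    by (simp add: has_bochner_integral_iff mult.commute)
qed

definition arcsine :: "real \<Rightarrow> real \<Rightarrow> real measure" where
  "arcsine p r = density lborel (\<lambda>s. ennreal (indicator {p<..<r} s * (1 / (pi * sqrt ((s - p) * (r - s))))))"

lemma sets_arcsine [simp, measurable_cong]: "sets (arcsine p r) = sets borel"
  by (simp add: arcsine_def)

lemma arcsine_density_nonneg: "0 \<le> indicator {p<..<r} s * (1 / (pi * sqrt ((s - p) * (r - s))))" for s :: real
  by (auto simp: indicator_def)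

lemma has_bochner_integral_arcsine:
  fixes g :: "real \<Rightarrow> real"
  assumes "g \<in> borel_measurable borel"
    "has_bochner_integral lborel (\<lambda>s. indicator {p<..<r} s * (g s / sqrt ((s - p) * (r - s)))) (pi * I)"
  shows "has_bochner_integral (arcsine p r) g I"
  unfolding arcsine_def
proof (rule has_bochner_integral_density)
  have "has_bochner_integral lborel (\<lambda>s. (1/pi) * (indicator {p<..<r} s * (g s / sqrt ((s - p) * (r - s))))) ((1/pi) * (pi * I))"
    by (rule has_bochner_integral_mult_right[OF assms(2)])
  then show "has_bochner_integral lborel (\<lambda>s. (indicator {p<..<r} s * (1 / (pi * sqrt ((s - p) * (r - s))))) *\<^sub>R g s) I"
    by (simp add: mult_ac)
qed (use assms arcsine_density_nonneg in auto)

lemma DERIV_arcsin_comp: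
  assumes "(g has_real_derivative g') (at s)" "(g s)\<^sup>2 < 1"
  shows "((\<lambda>s. arcsin (g s)) has_real_derivative g' / sqrt (1 - (g s)\<^sup>2)) (at s)"
proof -
  have "-1 < g s" "g s < 1" using assms(2) by (auto simp: power2_less_1_iff abs_less_iff abs_square_less_1)
  from DERIV_chain2[OF DERIV_arcsin[OF this] assms(1)] show ?thesis
    by (simp add: divide_inverse mult.commute)
qed

lemma one_minus_square_divide: "D \<noteq> 0 \<Longrightarrow> 1 - (N / D)\<^sup>2 = (D\<^sup>2 - N\<^sup>2) / D\<^sup>2" for N D :: real
  by (simp add: power_divide diff_divide_distrib)

text \<open>An antiderivative of 1/sqrt((s - p)(r - s)) is the arcsine of the affine map of (p, r) onto (-1, 1).\<close>
lemma arcsine_total: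
  assumes "p < r"
  shows "has_bochner_integral (arcsine p r) (\<lambda>s. 1) (1::real)"
proof (rule has_bochner_integral_arcsine)
  define G where "G s = (2 * s - p - r) / (r - p)" for s
  have Gsq: "1 - (G s)\<^sup>2 = 4 * ((s - p) * (r - s)) / (r - p)\<^sup>2" for s
  proof -
    have "1 - (G s)\<^sup>2 = ((r - p)\<^sup>2 - (2 * s - p - r)\<^sup>2) / (r - p)\<^sup>2"
      using assms unfolding G_def by (intro one_minus_square_divide) simp
    also have "(r - p)\<^sup>2 - (2 * s - p - r)\<^sup>2 = 4 * ((s - p) * (r - s))" by algebra
    finally show ?thesis .
  qed
  have "has_bochner_integral lborel (\<lambda>s. indicator {p<..<r} s * (1 / sqrt ((s - p) * (r - s)))) (arcsin (G r) - arcsin (G p))"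
  proof (rule FTC_open_interval[OF assms, where F = "\<lambda>s. arcsin (G s)"])
    fix s assume s: "s \<in> {p<..<r}"
    then have pos: "(s - p) * (r - s) > 0" by auto
    have "(G has_real_derivative 2 / (r - p)) (at s)"
      unfolding G_def by (rule DERIV_cdivide) (auto intro!: derivative_eq_intros)
    moreover have "(G s)\<^sup>2 < 1" using Gsq[of s] pos assms by (smt (verit) divide_pos_pos zero_less_power mult_pos_pos)
    ultimately have "((\<lambda>s. arcsin (G s)) has_real_derivative (2 / (r - p)) / sqrt (1 - (G s)\<^sup>2)) (at s)"
      by (rule DERIV_arcsin_comp)
    also have "(2 / (r - p)) / sqrt (1 - (G s)\<^sup>2) = 1 / sqrt ((s - p) * (r - s))"
    proof -
      define h where "h = sqrt ((s - p) * (r - s))"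
      have "sqrt (1 - (G s)\<^sup>2) = 2 * h / (r - p)"
        using assms unfolding Gsq h_def real_sqrt_divide real_sqrt_mult[of 4] real_sqrt_abs by simp
      moreover have "(2 / D) / (2 * h / D) = 1 / h" if "D > 0" for D :: real using that by simp
      ultimately show ?thesis using assms unfolding h_def[symmetric] by (simp only: diff_gt_0_iff_gt)
    qed
    finally show "((\<lambda>s. arcsin (G s)) has_real_derivative 1 / sqrt ((s - p) * (r - s))) (at s)" .
    show "isCont (\<lambda>s. 1 / sqrt ((s - p) * (r - s))) s" using pos by (intro continuous_intros) auto
    show "0 \<le> 1 / sqrt ((s - p) * (r - s))" using pos by simp
  next
    have cont: "continuous_on {p..r} (\<lambda>s. arcsin (G s))"
    proof (intro continuous_on_arcsin ballI)
      show "continuous_on {p..r} G" unfolding G_def using assms by (intro continuous_intros) auto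
      show "-1 \<le> G s \<and> G s \<le> 1" if "s \<in> {p..r}" for s
        using that assms unfolding G_def by (simp add: field_simps)
    qed
    show "((\<lambda>s. arcsin (G s)) \<longlongrightarrow> arcsin (G p)) (at_right p)" "((\<lambda>s. arcsin (G s)) \<longlongrightarrow> arcsin (G r)) (at_left r)"
      using continuous_on_Icc_at_rightD[OF cont assms] continuous_on_Icc_at_leftD[OF cont assms] by auto
  qed
  moreover have "G r = 1" "G p = -1" using assms by (auto simp: G_def field_simps)
  ultimately show "has_bochner_integral lborel (\<lambda>s. indicator {p<..<r} s * (1 / sqrt ((s - p) * (r - s)))) (pi * 1)"
    by simp
qed simp

lemma prob_measure_on_arcsine:
  assumes "p < r"
  shows "prob_measure_on {p<..<r} (arcsine p r)"
proof -
  have "emeasure (arcsine p r) UNIV = (\<integral>\<^sup>+ s. ennreal 1 \<partial>arcsine p r)" by (simp add: arcsine_def)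
  also have "\<dots> = 1"
    using arcsine_total[OF assms] by (subst nn_integral_eq_integral) (auto simp: has_bochner_integral_iff)
  finally have "prob_space (arcsine p r)" by (intro prob_spaceI) (simp add: arcsine_def)
  moreover have "AE t in arcsine p r. t \<in> {p<..<r}"
    unfolding arcsine_def by (subst AE_density) (auto intro!: AE_I2 simp: indicator_def)
  ultimately show ?thesis unfolding prob_measure_on_def by simp
qed

text \<open>The projective map of (p, r) onto (-1, 1) with pole at t turns the integrand into that of the
arcsine function.\<close>
lemma arcsine_inverse_distance:
  assumes "p < r" "t \<notin> {p..r}"
  shows "has_bochner_integral (arcsine p r) (\<lambda>s. 1 / \<bar>s - t\<bar>) (1 / sqrt ((p - t) * (r - t)))"
proof (rule has_bochner_integral_arcsine)
  define P R where "P = p - t" and "R = r - t"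
  have PR: "P * R > 0" "P < R" using assms by (auto simp: P_def R_def zero_less_mult_iff not_le)
  define G where "G s = (P + R - 2 * (P * R) / (s - t)) / (R - P)" for s
  have nz: "s - t \<noteq> 0" if "s \<in> {p..r}" for s using that assms by auto
  have Gsq: "1 - (G s)\<^sup>2 = 4 * (P * R) * ((s - p) * (r - s)) / (\<bar>s - t\<bar> * (R - P))\<^sup>2" if "s \<in> {p..r}" for s
  proof -
    define u where "u = s - t"
    have e: "s - p = u - P" "r - s = R - u" by (auto simp: P_def R_def u_def)
    have u: "u \<noteq> 0" "R - P \<noteq> 0" using nz[OF that] PR(2) by (auto simp: u_def)
    have "G s = ((P + R) * u - 2 * (P * R)) / (u * (R - P))"
      using u unfolding G_def u_def[symmetric] by (simp add: field_simps)
    then have "1 - (G s)\<^sup>2 = ((u * (R - P))\<^sup>2 - ((P + R) * u - 2 * (P * R))\<^sup>2) / (u * (R - P))\<^sup>2"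
      using u one_minus_square_divide[of "u * (R - P)"] by simp
    also have "(u * (R - P))\<^sup>2 - ((P + R) * u - 2 * (P * R))\<^sup>2 = 4 * (P * R) * ((u - P) * (R - u))" by algebra
    finally show ?thesis unfolding e u_def[symmetric] by (simp add: power_mult_distrib)
  qed
  have Gle: "(G s)\<^sup>2 \<le> 1" if "s \<in> {p..r}" for s
  proof -
    have "0 \<le> 4 * (P * R) * ((s - p) * (r - s)) / (\<bar>s - t\<bar> * (R - P))\<^sup>2"
    proof -
      have "0 \<le> (s - p) * (r - s)" using that by simp
      then have "0 \<le> 4 * (P * R) * ((s - p) * (r - s))" using PR(1) by (intro mult_nonneg_nonneg[of "4 * (P * R)"]) auto
      then show ?thesis by simp
    qed
    then show ?thesis using Gsq[OF that] by linarith
  qed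
  have "has_bochner_integral lborel (\<lambda>s. indicator {p<..<r} s * (1 / \<bar>s - t\<bar> / sqrt ((s - p) * (r - s))))
      (arcsin (G r) / sqrt (P * R) - arcsin (G p) / sqrt (P * R))"
  proof (rule FTC_open_interval[OF assms(1), where F = "\<lambda>s. arcsin (G s) / sqrt (P * R)"])
    fix s assume s: "s \<in> {p<..<r}"
    then have s': "s \<in> {p..r}" by auto
    have pos: "(s - p) * (r - s) > 0" using s by auto
    have "(G has_real_derivative (2 * (P * R) / (s - t)\<^sup>2) / (R - P)) (at s)"
      unfolding G_def using nz[OF s'] PR by (auto intro!: derivative_eq_intros simp: power2_eq_square)
    moreover have "(G s)\<^sup>2 < 1"
    proof -
      have "0 < 4 * (P * R) * ((s - p) * (r - s)) / (\<bar>s - t\<bar> * (R - P))\<^sup>2"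
        using mult_pos_pos[of "4 * (P * R)", OF _ pos] PR nz[OF s'] by (intro divide_pos_pos) auto
      then show ?thesis using Gsq[OF s'] by linarith
    qed
    ultimately have "((\<lambda>s. arcsin (G s)) has_real_derivative ((2 * (P * R) / (s - t)\<^sup>2) / (R - P)) / sqrt (1 - (G s)\<^sup>2)) (at s)"
      by (rule DERIV_arcsin_comp)
    then have "((\<lambda>s. arcsin (G s) / sqrt (P * R)) has_real_derivative (((2 * (P * R) / (s - t)\<^sup>2) / (R - P)) / sqrt (1 - (G s)\<^sup>2)) / sqrt (P * R)) (at s)"
      by (rule DERIV_cdivide)
    also have "(((2 * (P * R) / (s - t)\<^sup>2) / (R - P)) / sqrt (1 - (G s)\<^sup>2)) / sqrt (P * R)
       = 1 / \<bar>s - t\<bar> / sqrt ((s - p) * (r - s))"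
    proof -
      define q h u where "q = sqrt (P * R)" and "h = sqrt ((s - p) * (r - s))" and "u = \<bar>s - t\<bar>"
      have "sqrt (1 - (G s)\<^sup>2) = 2 * q * h / (u * (R - P))"
        unfolding Gsq[OF s'] real_sqrt_divide real_sqrt_mult[of "4 * (P*R)"] real_sqrt_mult[of 4] real_sqrt_abs q_def h_def u_def
        using PR nz[OF s'] by (simp add: abs_mult)
      moreover have "P * R = q * q" "(s - t)\<^sup>2 = u * u" using PR by (auto simp: q_def u_def power2_eq_square)
      moreover have "q > 0" "h > 0" "u > 0" "R - P > 0" using PR pos nz[OF s'] by (auto simp: q_def h_def u_def)
      moreover have "((2 * Q / T) / D) / S / q = 1 / u / h"
        if "S = 2 * q * h / (u * D)" "Q = q * q" "T = u * u" "q > 0" "h > 0" "u > 0" "D > 0" for Q T S D q h u :: real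
        using that by (simp add: field_simps)
      ultimately show ?thesis unfolding q_def[symmetric] h_def[symmetric] u_def[symmetric] by blast
    qed
    finally show "((\<lambda>s. arcsin (G s) / sqrt (P * R)) has_real_derivative 1 / \<bar>s - t\<bar> / sqrt ((s - p) * (r - s))) (at s)" .
    show "isCont (\<lambda>s. 1 / \<bar>s - t\<bar> / sqrt ((s - p) * (r - s))) s" using pos nz[OF s'] by (intro continuous_intros) auto
    show "0 \<le> 1 / \<bar>s - t\<bar> / sqrt ((s - p) * (r - s))" using pos by simp
  next
    have cont: "continuous_on {p..r} (\<lambda>s. arcsin (G s) / sqrt (P * R))"
    proof (intro continuous_on_divide continuous_on_arcsin ballI)
      show "continuous_on {p..r} G" unfolding G_def using nz PR by (intro continuous_intros) auto
      show "-1 \<le> G s \<and> G s \<le> 1" if "s \<in> {p..r}" for s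
        using Gle[OF that] by (auto simp: abs_square_le_1 abs_le_iff)
    qed (use PR in auto)
    show "((\<lambda>s. arcsin (G s) / sqrt (P * R)) \<longlongrightarrow> arcsin (G p) / sqrt (P * R)) (at_right p)"
      "((\<lambda>s. arcsin (G s) / sqrt (P * R)) \<longlongrightarrow> arcsin (G r) / sqrt (P * R)) (at_left r)"
      using continuous_on_Icc_at_rightD[OF cont assms(1)] continuous_on_Icc_at_leftD[OF cont assms(1)] by auto
  qed
  moreover have "G r = 1" "G p = -1" 
  proof -
    have "P \<noteq> 0" "R \<noteq> 0" using PR by auto
    then show "G r = 1" "G p = -1" using PR(2) unfolding G_def P_def[symmetric] R_def[symmetric]
      by (auto simp: field_simps)
  qed
  ultimately show "has_bochner_integral lborel (\<lambda>s. indicator {p<..<r} s * (1 / \<bar>s - t\<bar> / sqrt ((s - p) * (r - s))))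
      (pi * (1 / sqrt ((p - t) * (r - t))))"
    by (simp add: P_def R_def add_divide_distrib[symmetric])
qed simp

lemma rcauchy_arcsine:
  assumes "p < r" "t \<notin> {p..r}"
  shows "integrable (arcsine p r) (\<lambda>s. 1 / (s - t))"
    and "rcauchy (arcsine p r) t = (if t < p then 1 else -1) / sqrt ((p - t) * (r - t))"
proof -
  define e where "e = (if t < p then 1 else -1 :: real)"
  have "has_bochner_integral (arcsine p r) (\<lambda>s. e * (1 / \<bar>s - t\<bar>)) (e * (1 / sqrt ((p - t) * (r - t))))"
    by (rule has_bochner_integral_mult_right[OF arcsine_inverse_distance[OF assms]])
  also have "?this \<longleftrightarrow> has_bochner_integral (arcsine p r) (\<lambda>s. 1 / (s - t)) (e * (1 / sqrt ((p - t) * (r - t))))"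
  proof (rule has_bochner_integral_cong_AE)
    show "AE s in arcsine p r. e * (1 / \<bar>s - t\<bar>) = 1 / (s - t)"
      using prob_measure_onD(3)[OF prob_measure_on_arcsine[OF assms(1)]]
    proof eventually_elim
      case (elim s)
      show ?case
      proof (cases "t < p")
        case False
        then have "\<bar>s - t\<bar> = - (s - t)" "e = -1" using elim assms by (auto simp: e_def)
        then show ?thesis by (simp only: divide_minus_right mult_minus_left mult_minus_right)
      next
        case True
        then show ?thesis using elim by (simp add: e_def)
      qed
    qed
  qed auto
  finally show "integrable (arcsine p r) (\<lambda>s. 1 / (s - t))"
    "rcauchy (arcsine p r) t = (if t < p then 1 else -1) / sqrt ((p - t) * (r - t))"
    unfolding rcauchy_def e_def by (auto simp: has_bochner_integral_iff)
qed

lemma apart_closed: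
  assumes "closed K" "z \<notin> of_real ` K"
  shows "apart K z"
proof -
  have "closed (of_real ` K :: complex set)"
    using assms(1) by (rule closed_injective_linear_image[OF _ bounded_linear.linear[OF bounded_linear_of_real] inj_of_real])
  from separate_point_closed[OF this assms(2)] obtain d where "d > 0" "\<forall>x\<in>of_real ` K. d \<le> dist z x" by auto
  then show ?thesis unfolding apart_def by (auto simp: dist_norm norm_minus_commute)
qed

text \<open>On the real half-line to the right of r this is the explicit integral; both sides are holomorphic in the
plane slit along the half-line to the left of r.\<close>
lemma cauchy_arcsine_slit:
  assumes "p < r" "z - of_real r \<notin> \<real>\<^sub>\<le>\<^sub>0"
  shows "cauchy (arcsine p r) z * (csqrt (z - of_real p) * csqrt (z - of_real r)) = -1"
proof -
  define S where "S = {z. z - complex_of_real r \<notin> \<real>\<^sub>\<le>\<^sub>0}"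
  have S_eq: "S = (\<lambda>z. complex_of_real r + z) ` (- \<real>\<^sub>\<le>\<^sub>0)"
    unfolding S_def by (auto simp: image_iff intro!: bexI[of _ "z - of_real r" for z])
  have "open S" unfolding S_eq by (intro open_translation open_Compl closed_nonpos_Reals_complex)
  have "S = - (complex_of_real ` {..r})"
    unfolding S_def by (auto simp: complex_nonpos_Reals_iff image_iff complex_eq_iff)
  then have "connected S"
    using starlike_imp_connected[OF starlike_slotted_complex_plane_left] by simp
  have Sp: "z - of_real p \<notin> \<real>\<^sub>\<le>\<^sub>0" if "z \<in> S" for z
    using that assms(1) by (auto simp: S_def complex_nonpos_Reals_iff)
  have apart: "apart {p<..<r} z" if "z \<in> S" for z
  proof -
    have "apart {p..r} z" using that by (intro apart_closed) (auto simp: S_def complex_nonpos_Reals_iff)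
    then show ?thesis by (rule apart_mono) auto
  qed
  have hol: "(\<lambda>z. cauchy (arcsine p r) z * (csqrt (z - of_real p) * csqrt (z - of_real r)) + 1) holomorphic_on S"
    using Sp by (intro holomorphic_intros holomorphic_cauchy[OF prob_measure_on_arcsine[OF assms(1)] apart])
      (auto simp: S_def)
  have "cauchy (arcsine p r) z * (csqrt (z - of_real p) * csqrt (z - of_real r)) + 1 = 0"
  proof (rule analytic_continuation[OF hol \<open>open S\<close> \<open>connected S\<close>, where U = "of_real ` {r<..}" and \<xi> = "of_real (r + 1)"])
    show "of_real ` {r<..} \<subseteq> S" by (auto simp: S_def complex_nonpos_Reals_iff)
    show "complex_of_real (r + 1) \<in> S" by (auto simp: S_def complex_nonpos_Reals_iff)
    show "complex_of_real (r + 1) islimpt of_real ` {r<..}"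
      unfolding islimpt_approachable
    proof (intro allI impI)
      fix e :: real assume "e > 0"
      then show "\<exists>x'\<in>of_real ` {r<..}. x' \<noteq> complex_of_real (r + 1) \<and> dist x' (complex_of_real (r + 1)) < e"
        by (intro bexI[of _ "complex_of_real (r + 1 + e/2)"]) (auto simp: dist_of_real dist_real_def simp del: of_real_add)
    qed
    show "z \<in> S" using assms by (simp add: S_def)
    fix z :: complex assume "z \<in> of_real ` {r<..}"
    then obtain t where t: "z = of_real t" "t > r" by auto
    have "csqrt (z - of_real p) * csqrt (z - of_real r) = of_real (sqrt ((t - p) * (t - r)))"
      using t assms(1) by (simp flip: of_real_diff add: csqrt_of_real real_sqrt_mult)
    moreover have "(p - t) * (r - t) = (t - p) * (t - r)" by algebra
    moreover have "sqrt ((t - p) * (t - r)) \<noteq> 0" using t assms(1) by simp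
    ultimately show "cauchy (arcsine p r) z * (csqrt (z - of_real p) * csqrt (z - of_real r)) + 1 = 0"
      using t assms(1) rcauchy_arcsine(2)[OF assms(1), of t] unfolding t(1) cauchy_of_real
      by (simp flip: of_real_mult)
  qed
  then show ?thesis by (simp add: eq_neg_iff_add_eq_0)
qed

lemma cauchy_arcsine:
  assumes "p < r" "Im z > 0"
  shows "cauchy (arcsine p r) z = - 1 / (csqrt (z - of_real p) * csqrt (z - of_real r))"
proof -
  have "z - of_real r \<notin> \<real>\<^sub>\<le>\<^sub>0" using assms(2) by (auto simp: complex_nonpos_Reals_iff)
  from cauchy_arcsine_slit[OF assms(1) this]
  have "cauchy (arcsine p r) z * (csqrt (z - of_real p) * csqrt (z - of_real r)) = -1" .
  moreover from this have "csqrt (z - of_real p) * csqrt (z - of_real r) \<noteq> 0" by force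
  ultimately show ?thesis by (metis nonzero_eq_divide_eq)
qed

lemma csqrt_boundary: "((\<lambda>y. csqrt (Complex x y)) \<longlongrightarrow> csqrt (of_real x)) (at_right 0)"
proof -
  have "((\<lambda>y. Complex (sqrt ((cmod (Complex x y) + x) / 2)) (sqrt ((cmod (Complex x y) - x) / 2)))
      \<longlongrightarrow> Complex (sqrt ((cmod (of_real x) + x) / 2)) (sqrt ((cmod (of_real x) - x) / 2))) (at_right 0)"
    by (intro tendsto_Complex tendsto_intros tendsto_Complex_at_right) auto
  also have "Complex (sqrt ((cmod (of_real x) + x) / 2)) (sqrt ((cmod (of_real x) - x) / 2)) = csqrt (of_real x)"
    by (simp add: complex_eq_iff)
  finally show ?thesis
  proof (rule Lim_transform_eventually)
    show "\<forall>\<^sub>F y in at_right 0. Complex (sqrt ((cmod (Complex x y) + x) / 2)) (sqrt ((cmod (Complex x y) - x) / 2)) = csqrt (Complex x y)"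
      by (auto simp: eventually_at_filter complex_eq_iff)
  qed
qed

text \<open>The arcsine distribution is reflectionless on its interval: the square root of z - r turns by a
quarter when z approaches the real line to the left of r.\<close>
lemma cauchy_arcsine_boundary:
  assumes "p < r" "t \<in> {p<..<r}"
  shows "((\<lambda>y. cauchy (arcsine p r) (Complex t y)) \<longlongrightarrow> \<i> / of_real (sqrt ((t - p) * (r - t)))) (at_right 0)"
proof -
  have e: "Complex t y - of_real u = Complex (t - u) y" for y u by (simp add: complex_eq_iff)
  have "((\<lambda>y. - 1 / (csqrt (Complex (t - p) y) * csqrt (Complex (t - r) y)))
     \<longlongrightarrow> - 1 / (csqrt (of_real (t - p)) * csqrt (of_real (t - r)))) (at_right 0)"
    using assms by (intro tendsto_intros csqrt_boundary) auto
  also have "csqrt (of_real (t - p)) * csqrt (of_real (t - r)) = \<i> * of_real (sqrt ((t - p) * (r - t)))"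
    using assms(2) by (simp add: csqrt_of_real' real_sqrt_mult del: of_real_diff)
  also have "- 1 / (\<i> * complex_of_real (sqrt ((t - p) * (r - t)))) = \<i> / of_real (sqrt ((t - p) * (r - t)))"
  proof -
    have "- 1 / (\<i> * q) = \<i> / q" for q :: complex by (cases "q = 0") (simp_all add: field_simps)
    then show ?thesis .
  qed
  finally show ?thesis
  proof (rule Lim_transform_eventually)
    show "\<forall>\<^sub>F y in at_right 0. - 1 / (csqrt (Complex (t - p) y) * csqrt (Complex (t - r) y)) = cauchy (arcsine p r) (Complex t y)"
      by (auto simp: eventually_at_filter cauchy_arcsine[OF assms(1)] e)
  qed
qed

section \<open>The zero of a Cauchy transform in a gap\<close>

text \<open>The Cauchy transform increases in the gap (a, b) and has the sign of s - c at s.  For c inside the gap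
it vanishes at c; for an endpoint c it keeps one sign in the whole gap.\<close>
definition zero_at :: "real measure \<Rightarrow> real \<Rightarrow> real \<Rightarrow> real \<Rightarrow> bool" where
  "zero_at \<mu> a b c \<longleftrightarrow> (\<forall>s\<in>{a<..<b}. 0 \<le> rcauchy \<mu> s * (s - c))"

text \<open>If the sign changes at the endpoint c, then the part of the measure beyond c cannot pull the transform
to the wrong sign.  As the point s approaches c, the integral of 1/|t - s| over that part is therefore
bounded by the contribution of the other side, which stays bounded; Fatou's lemma gives integrability at c.
In the coordinate (t - c)/(d - c) the gap is (0, 1) and both choices of c look the same.\<close>
lemma endpoint_zero_integrable:
  assumes \<mu>: "prob_measure_on K \<mu>" and ab: "a < b" and gap: "K \<inter> {a<..<b} = {}"
    and cd: "(c = a \<and> d = b) \<or> (c = b \<and> d = a)" and z: "zero_at \<mu> a b c"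
  shows "AE t in \<mu>. t \<noteq> c" "integrable \<mu> (\<lambda>t. 1 / (t - c))" "0 \<le> (d - c) * rcauchy \<mu> c"
proof -
  note [measurable_cong] = prob_measure_onD(1)[OF \<mu>]
  interpret prob_space \<mu> using prob_measure_onD(2)[OF \<mu>] .
  define D where "D = d - c"
  have D: "D \<noteq> 0" using ab cd by (auto simp: D_def)
  \<comment> \<open>The offset 2 keeps the approaching points in the half of the gap next to c.\<close>
  define \<eta> where "\<eta> n = 1 / (real n + 2)" for n
  have \<eta>: "0 < \<eta> n" "\<eta> n \<le> 1/2" for n by (auto simp: \<eta>_def field_simps)
  have \<eta>_lim: "\<eta> \<longlonglongrightarrow> 0" unfolding \<eta>_def
    using LIMSEQ_ignore_initial_segment[OF lim_inverse_n', of 2] by (simp add: add.commute)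
  define s where "s n = c + D * \<eta> n" for n
  have s_gap: "s n \<in> {a<..<b}" for n
  proof -
    have "0 < (b - a) * \<eta> n" "(b - a) * \<eta> n < (b - a) * 1"
      using \<eta>[of n] ab by (auto intro!: mult_strict_left_mono)
    then show ?thesis using cd by (auto simp: s_def D_def algebra_simps)
  qed
  define k where "k n t = D / (t - s n)" for n t
  have k_int: "integrable \<mu> (k n)" for n
    unfolding k_def using integrable_mult_right[OF integrable_rcauchy[OF \<mu> apart_gap[OF s_gap gap]], of D] by simp
  have k_lb: "0 \<le> (\<integral>t. k n t \<partial>\<mu>)" for n
  proof -
    have "(\<integral>t. k n t \<partial>\<mu>) = D * rcauchy \<mu> (s n)"
      unfolding k_def rcauchy_def by (subst integral_mult_right_zero[symmetric]) simp
    moreover have "0 \<le> rcauchy \<mu> (s n) * (s n - c)"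
      using z s_gap[of n] unfolding zero_at_def by blast
    then have "0 \<le> rcauchy \<mu> (s n) * (D * \<eta> n)" by (simp add: s_def)
    then have "0 \<le> (D * rcauchy \<mu> (s n)) * \<eta> n" by (simp add: mult_ac)
    then have "0 \<le> D * rcauchy \<mu> (s n)" using \<eta>(1)[of n] zero_le_mult_iff[of "D * rcauchy \<mu> (s n)" "\<eta> n"] by linarith
    ultimately show ?thesis by simp
  qed
  have k_form: "k n t = 1 / ((t - c) / D - \<eta> n)" for n t
  proof -
    have "t - s n = D * ((t - c) / D - \<eta> n)" using D by (simp add: s_def field_simps)
    then show ?thesis using D by (simp add: k_def)
  qed
  have ratio: "(t - c) / D \<le> 0 \<or> 1 \<le> (t - c) / D" if "t \<in> K" for t
  proof -
    have "t \<le> a \<or> b \<le> t" using that gap by force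
    then show ?thesis using cd ab by (auto simp: D_def field_simps)
  qed
  have k_up: "k n t \<le> 2" if "t \<in> K" for n t
    using ratio[OF that]
  proof
    assume "(t - c) / D \<le> 0"
    then have "k n t \<le> 0" unfolding k_form using \<eta>[of n] by (intro divide_nonneg_neg) auto
    then show ?thesis by simp
  next
    assume "1 \<le> (t - c) / D"
    then have "1 / 2 \<le> (t - c) / D - \<eta> n" using \<eta>(2)[of n] by linarith
    moreover have "1 / x \<le> 2" if "1/2 \<le> x" for x :: real using that by (simp add: divide_le_eq)
    ultimately show ?thesis unfolding k_form by blast
  qed
  have k_abs: "(\<integral>t. \<bar>k n t\<bar> \<partial>\<mu>) \<le> 4" for n
  proof -
    have "(\<integral>t. \<bar>k n t\<bar> \<partial>\<mu>) \<le> (\<integral>t. 4 - k n t \<partial>\<mu>)"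
    proof (rule integral_mono_AE)
      show "AE t in \<mu>. \<bar>k n t\<bar> \<le> 4 - k n t"
        using prob_measure_onD(3)[OF \<mu>]
      proof eventually_elim
        case (elim t)
        show ?case using k_up[OF elim, of n] by (simp add: abs_le_iff)
      qed
    qed (use k_int in auto)
    also have "\<dots> = 4 - (\<integral>t. k n t \<partial>\<mu>)" using k_int by (simp add: prob_space)
    finally show ?thesis using k_lb[of n] by simp
  qed
  have "measure \<mu> {c} = 0"
  proof (rule ccontr)
    assume "measure \<mu> {c} \<noteq> 0"
    then have pos: "measure \<mu> {c} > 0" by (simp add: less_le)
    obtain n :: nat where n: "4 / measure \<mu> {c} < real n" using reals_Archimedean2 by blast
    have "(\<integral>t. (real n + 2) * indicator {c} t \<partial>\<mu>) \<le> (\<integral>t. \<bar>k n t\<bar> \<partial>\<mu>)"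
    proof (rule integral_mono)
      show "(real n + 2) * indicator {c} t \<le> \<bar>k n t\<bar>" for t
        by (auto simp: indicator_def k_form \<eta>_def)
      have "integrable \<mu> (indicat_real {c})"
        by (rule integrable_real_indicator) (auto simp: less_top[symmetric])
      then show "integrable \<mu> (\<lambda>t. (real n + 2) * indicat_real {c} t)" by simp
    qed (use k_int in auto)
    also have "\<dots> \<le> 4" by (rule k_abs)
    finally have "(real n + 2) * measure \<mu> {c} \<le> 4" by simp
    moreover have "4 < real n * measure \<mu> {c}" using n pos by (simp add: field_simps)
    ultimately show False using pos by (simp add: algebra_simps)
  qed
  then have "emeasure \<mu> {c} = 0" by (simp add: emeasure_eq_measure)
  then show ne: "AE t in \<mu>. t \<noteq> c" by (intro AE_I[of _ _ "{c}"]) auto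
  have k_lim: "(\<lambda>n. k n t) \<longlonglongrightarrow> D / (t - c)" if "t \<noteq> c" for t
  proof -
    have "(\<lambda>n. D / (t - (c + D * \<eta> n))) \<longlonglongrightarrow> D / (t - (c + D * 0))"
      using that by (intro tendsto_intros \<eta>_lim) auto
    then show ?thesis by (simp add: k_def s_def)
  qed
  have "(\<integral>\<^sup>+t. ennreal \<bar>D / (t - c)\<bar> \<partial>\<mu>) \<le> (\<integral>\<^sup>+t. liminf (\<lambda>n. ennreal \<bar>k n t\<bar>) \<partial>\<mu>)"
  proof (rule nn_integral_mono_AE)
    show "AE t in \<mu>. ennreal \<bar>D / (t - c)\<bar> \<le> liminf (\<lambda>n. ennreal \<bar>k n t\<bar>)"
      using ne
    proof eventually_elim
      case (elim t)
      have "(\<lambda>n. ennreal \<bar>k n t\<bar>) \<longlonglongrightarrow> ennreal \<bar>D / (t - c)\<bar>"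
        using k_lim[OF elim] by (intro tendsto_intros)
      from lim_imp_Liminf[OF sequentially_bot this] show ?case by (simp only: order_refl)
    qed
  qed
  also have "\<dots> \<le> liminf (\<lambda>n. \<integral>\<^sup>+t. ennreal \<bar>k n t\<bar> \<partial>\<mu>)"
    by (rule nn_integral_liminf) (simp add: k_def)
  also have "\<dots> \<le> ennreal 4"
  proof (rule Liminf_le)
    show "\<forall>\<^sub>F n in sequentially. (\<integral>\<^sup>+t. ennreal \<bar>k n t\<bar> \<partial>\<mu>) \<le> ennreal 4"
    proof (intro always_eventually allI)
      fix n
      have "(\<integral>\<^sup>+t. ennreal \<bar>k n t\<bar> \<partial>\<mu>) = ennreal (\<integral>t. \<bar>k n t\<bar> \<partial>\<mu>)"
        using k_int by (intro nn_integral_eq_integral) auto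
      also have "\<dots> \<le> ennreal 4" by (rule ennreal_leI[OF k_abs])
      finally show "(\<integral>\<^sup>+t. ennreal \<bar>k n t\<bar> \<partial>\<mu>) \<le> ennreal 4" .
    qed
  qed simp
  finally have "(\<integral>\<^sup>+t. ennreal \<bar>D / (t - c)\<bar> \<partial>\<mu>) < \<infinity>"
    by (rule le_less_trans) simp
  then have intD: "integrable \<mu> (\<lambda>t. D / (t - c))"
    by (intro integrableI_bounded) simp_all
  from integrable_mult_right[OF this, of "1 / D"] show int: "integrable \<mu> (\<lambda>t. 1 / (t - c))"
    using D by simp
  have "(\<lambda>n. \<integral>t. k n t \<partial>\<mu>) \<longlonglongrightarrow> (\<integral>t. D / (t - c) \<partial>\<mu>)"
  proof (rule integral_dominated_convergence[where w = "\<lambda>t. \<bar>D / (t - c)\<bar> + 2"])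
    show "AE t in \<mu>. (\<lambda>n. k n t) \<longlonglongrightarrow> D / (t - c)" using ne by eventually_elim (rule k_lim)
    show "AE t in \<mu>. norm (k n t) \<le> \<bar>D / (t - c)\<bar> + 2" for n
      using prob_measure_onD(3)[OF \<mu>] ne
    proof eventually_elim
      case (elim t)
      show ?case
      proof (cases "(t - c) / D \<le> 0")
        case True
        define u where "u = - ((t - c) / D)"
        have u: "u > 0" using True elim D unfolding u_def by (simp add: less_le)
        have "\<bar>k n t\<bar> = 1 / (u + \<eta> n)"
        proof -
          have "(t - c) / D - \<eta> n = - (u + \<eta> n)" by (simp add: u_def)
          then have "k n t = - (1 / (u + \<eta> n))" by (simp only: k_form divide_minus_right)
          then show ?thesis using u \<eta>(1)[of n] by simp
        qed
        also have "\<dots> \<le> 1 / u" using u \<eta>(1)[of n] by (intro divide_left_mono) auto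
        also have "1 / u = - (D / (t - c))" by (simp add: u_def)
        also have "\<dots> \<le> \<bar>D / (t - c)\<bar>" by (rule abs_ge_minus_self)
        finally show ?thesis by simp
      next
        case False
        with ratio[OF elim(1)] have "1 \<le> (t - c) / D" by simp
        then have "0 \<le> k n t" unfolding k_form using \<eta>[of n] by simp
        then have "\<bar>k n t\<bar> \<le> 2" using k_up[OF elim(1), of n] by simp
        then show ?thesis unfolding real_norm_def using abs_ge_zero[of "D / (t - c)"] by linarith
      qed
    qed
    show "integrable \<mu> (\<lambda>t. \<bar>D / (t - c)\<bar> + 2)"
      by (intro Bochner_Integration.integrable_add integrable_abs intD) simp
  qed (auto simp: k_def)
  then have "0 \<le> (\<integral>t. D / (t - c) \<partial>\<mu>)"
    by (rule LIMSEQ_le_const) (use k_lb in auto)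
  also have "\<dots> = D * rcauchy \<mu> c" unfolding rcauchy_def by (subst integral_mult_right_zero[symmetric]) simp
  finally show "0 \<le> (d - c) * rcauchy \<mu> c" by (simp add: D_def)
qed

lemma rcauchy_mono_on_gap:
  assumes \<mu>: "prob_measure_on K \<mu>" and gap: "K \<inter> {a<..<b} = {}"
    and s: "s \<in> {a<..<b}" "s' \<in> {a<..<b}" "s \<le> s'"
  shows "rcauchy \<mu> s \<le> rcauchy \<mu> s'"
  unfolding rcauchy_def
proof (rule integral_mono_AE)
  show "AE t in \<mu>. 1 / (t - s) \<le> 1 / (t - s')"
    using prob_measure_onD(3)[OF \<mu>]
  proof eventually_elim
    case (elim t)
    then have "t \<le> a \<or> b \<le> t" using gap by force
    then have "t - s' > 0 \<or> t - s < 0" using s by auto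
    then show ?case
    proof
      assume "t - s' > 0" then show ?thesis using s by (intro divide_left_mono) auto
    next
      assume "t - s < 0" then show ?thesis using s by (intro divide_left_mono) (auto intro: mult_neg_neg)
    qed
  qed
qed (use integrable_rcauchy[OF \<mu>] apart_gap[OF _ gap] s in auto)

lemma continuous_on_rcauchy:
  assumes \<mu>: "prob_measure_on K \<mu>" and S: "\<And>s. s \<in> S \<Longrightarrow> apart K (of_real s)"
  shows "continuous_on S (rcauchy \<mu>)"
proof -
  have "continuous_on S (\<lambda>s. Re (cauchy \<mu> (of_real s)))"
    unfolding continuous_on_def
    by (intro ballI tendsto_Re isCont_tendsto_compose[OF isCont_cauchy[OF \<mu> S]] tendsto_of_real tendsto_ident_at)
  then show ?thesis by (simp add: cauchy_of_real)
qed

text \<open>The last two properties say that the transform vanishes at an interior zero, and has at an endpoint the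
sign that it has in the gap.\<close>
lemma gap_zero:
  assumes \<mu>: "prob_measure_on K \<mu>" and ab: "a < b" and gap: "K \<inter> {a<..<b} = {}"
  obtains \<gamma> where "\<gamma> \<in> {a..b}" "AE t in \<mu>. t \<noteq> \<gamma>" "integrable \<mu> (\<lambda>t. 1 / (t - \<gamma>))" "zero_at \<mu> a b \<gamma>"
    "0 \<le> (a - \<gamma>) * rcauchy \<mu> \<gamma>" "0 \<le> (b - \<gamma>) * rcauchy \<mu> \<gamma>"
proof (cases "zero_at \<mu> a b a")
  case True
  from endpoint_zero_integrable[OF \<mu> ab gap, of a b, OF _ this] True ab show ?thesis
    by (intro that[of a]) auto
next
  case na: False
  show ?thesis
  proof (cases "zero_at \<mu> a b b")
    case True
    from endpoint_zero_integrable[OF \<mu> ab gap, of b a, OF _ this] True ab show ?thesis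
      by (intro that[of b]) auto
  next
    case False
    obtain s1 where s1: "s1 \<in> {a<..<b}" "rcauchy \<mu> s1 < 0"
    proof -
      obtain s where s: "s \<in> {a<..<b}" "rcauchy \<mu> s * (s - a) < 0"
        using na unfolding zero_at_def not_le[symmetric] by blast
      then have "0 < s - a" by simp
      with s(2) have "rcauchy \<mu> s < 0" by (metis mult_less_0_iff not_less_iff_gr_or_eq)
      with s(1) show ?thesis by (rule that)
    qed
    obtain s2 where s2: "s2 \<in> {a<..<b}" "rcauchy \<mu> s2 > 0"
    proof -
      obtain s where s: "s \<in> {a<..<b}" "rcauchy \<mu> s * (s - b) < 0"
        using False unfolding zero_at_def not_le[symmetric] by blast
      then have "s - b < 0" by simp
      with s(2) have "rcauchy \<mu> s > 0" by (metis mult_less_0_iff not_less_iff_gr_or_eq)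
      with s(1) show ?thesis by (rule that)
    qed
    have "s1 \<le> s2"
      using rcauchy_mono_on_gap[OF \<mu> gap s2(1) s1(1)] s1 s2 by linarith
    moreover have "continuous_on {s1..s2} (rcauchy \<mu>)"
      using s1 s2 by (intro continuous_on_rcauchy[OF \<mu>] apart_gap[OF _ gap]) auto
    ultimately obtain \<gamma> where \<gamma>: "s1 \<le> \<gamma>" "\<gamma> \<le> s2" "rcauchy \<mu> \<gamma> = 0"
      using IVT'[of "rcauchy \<mu>" s1 0 s2] s1 s2 by auto
    then have g: "\<gamma> \<in> {a<..<b}" using s1 s2 by auto
    show ?thesis
    proof (rule that[of \<gamma>])
      show "AE t in \<mu>. t \<noteq> \<gamma>" using prob_measure_onD(3)[OF \<mu>] by eventually_elim (use gap g in auto)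
      show "integrable \<mu> (\<lambda>t. 1 / (t - \<gamma>))" by (rule integrable_rcauchy[OF \<mu> apart_gap[OF g gap]])
      show "zero_at \<mu> a b \<gamma>" unfolding zero_at_def
      proof
        fix s assume s: "s \<in> {a<..<b}"
        then show "0 \<le> rcauchy \<mu> s * (s - \<gamma>)"
          using rcauchy_mono_on_gap[OF \<mu> gap s g] rcauchy_mono_on_gap[OF \<mu> gap g s] \<gamma>(3)
          by (cases "s \<le> \<gamma>") (auto simp: mult_nonpos_nonpos)
      qed
      show "\<gamma> \<in> {a..b}" using g by auto
    qed (simp_all add: \<gamma>(3))
  qed
qed

section \<open>Moving a zero to an endpoint\<close>

text \<open>The new measure is (t - c)/(t - g) times the old one, plus a point mass at the old zero g.  Partial
fractions turn the integral of (t - c)/((t - g)(t - z)) into values of the transform at g and z; the point mass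
(c - g) m(g) compensates the value at g, and is positive only if g is an endpoint.  On the side of d the
weight is at least 1, because g lies between c and d.\<close>
lemma move_zero:
  assumes \<mu>: "prob_measure_on K \<mu>" and ab: "a < b" and gap: "K \<inter> {a<..<b} = {}" and K: "a \<in> K" "b \<in> K"
    and cd: "(c = a \<and> d = b) \<or> (c = b \<and> d = a)"
  obtains \<mu>' \<gamma> where "\<gamma> \<in> {a..b}" "prob_measure_on K \<mu>'"
    "\<And>z. apart K z \<Longrightarrow> cauchy \<mu>' z * (z - of_real \<gamma>) = cauchy \<mu> z * (z - of_real c)"
    "zero_at \<mu>' a b c"
    "\<And>g. g \<in> borel_measurable borel \<Longrightarrow> (\<And>t. g t \<noteq> 0 \<Longrightarrow> 0 \<le> (t - d) * (d - c))
      \<Longrightarrow> (\<integral>\<^sup>+t. g t \<partial>\<mu>) \<le> (\<integral>\<^sup>+t. g t \<partial>\<mu>')"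
proof -
  note [measurable_cong] = prob_measure_onD(1)[OF \<mu>]
  interpret prob_space \<mu> using prob_measure_onD(2)[OF \<mu>] .
  obtain \<gamma> where \<gamma>: "\<gamma> \<in> {a..b}" "AE t in \<mu>. t \<noteq> \<gamma>" "integrable \<mu> (\<lambda>t. 1 / (t - \<gamma>))" "zero_at \<mu> a b \<gamma>"
    "0 \<le> (a - \<gamma>) * rcauchy \<mu> \<gamma>" "0 \<le> (b - \<gamma>) * rcauchy \<mu> \<gamma>"
    using gap_zero[OF \<mu> ab gap] .
  define A where "A = (c - \<gamma>) * rcauchy \<mu> \<gamma>"
  have A: "A \<ge> 0" using \<gamma>(5,6) cd by (auto simp: A_def)
  have A0: "A = 0" if "\<gamma> \<in> {a<..<b}"
  proof -
    have "rcauchy \<mu> \<gamma> = 0"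
      using \<gamma>(5,6) that by (auto simp: zero_le_mult_iff)
    then show ?thesis by (simp add: A_def)
  qed
  define w where "w t = (t - c) / (t - \<gamma>)" for t
  have [measurable]: "w \<in> borel_measurable borel" unfolding w_def by measurable
  have w: "0 \<le> w t" if "t \<in> K" for t
  proof -
    have "t \<le> a \<or> b \<le> t" using that gap by force
    then show ?thesis using \<gamma>(1) cd ab unfolding w_def by (auto intro: divide_nonneg_nonneg divide_nonpos_nonpos)
  qed
  have wAE: "AE t in \<mu>. 0 \<le> w t"
    using prob_measure_onD(3)[OF \<mu>] by eventually_elim (rule w)
  define \<mu>' where "\<mu>' = measure_sum (density \<mu> (\<lambda>t. ennreal (w t))) (density (return borel \<gamma>) (\<lambda>t. ennreal A))"
  have sets_eq: "sets (density (return borel \<gamma>) (\<lambda>t. ennreal A)) = sets (density \<mu> (\<lambda>t. ennreal (w t)))"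
    using prob_measure_onD(1)[OF \<mu>] by simp
  have sets': "sets \<mu>' = sets borel" using prob_measure_onD(1)[OF \<mu>] by (simp add: \<mu>'_def)
  have nn: "(\<integral>\<^sup>+t. g t \<partial>\<mu>') = (\<integral>\<^sup>+t. ennreal (w t) * g t \<partial>\<mu>) + ennreal A * g \<gamma>"
    if [measurable]: "g \<in> borel_measurable borel" for g
    unfolding \<mu>'_def by (subst nn_integral_measure_sum[OF sets_eq])
      (simp_all add: nn_integral_density nn_integral_return)
  have wint: "has_bochner_integral \<mu> w (1 - A)"
  proof -
    have "has_bochner_integral \<mu> (\<lambda>t. 1 + (\<gamma> - c) * (1 / (t - \<gamma>))) (1 + (\<gamma> - c) * rcauchy \<mu> \<gamma>)"
      unfolding rcauchy_def
      by (intro has_bochner_integral_add has_bochner_integral_mult_right has_bochner_integral_integrable[OF \<gamma>(3)])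
        (simp add: has_bochner_integral_iff prob_space)
    also have "?this \<longleftrightarrow> has_bochner_integral \<mu> w (1 + (\<gamma> - c) * rcauchy \<mu> \<gamma>)"
    proof (rule has_bochner_integral_cong_AE)
      show "AE t in \<mu>. 1 + (\<gamma> - c) * (1 / (t - \<gamma>)) = w t" using \<gamma>(2)
        by eventually_elim (simp add: w_def field_simps)
    qed auto
    finally show ?thesis by (simp add: A_def algebra_simps)
  qed
  have one: "emeasure \<mu>' UNIV = 1"
  proof -
    have "emeasure \<mu>' UNIV = (\<integral>\<^sup>+t. 1 \<partial>\<mu>')" using sets_eq_imp_space_eq[OF sets'] by simp
    also have "\<dots> = ennreal (1 - A) + ennreal A"
      by (subst nn) (use wint wAE in \<open>auto simp: nn_integral_eq_integral has_bochner_integral_iff\<close>)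
    also have "\<dots> = ennreal (1 - A + A)"
    proof (rule ennreal_plus[symmetric])
      show "0 \<le> 1 - A" using wint integral_nonneg_AE[OF wAE] by (auto simp: has_bochner_integral_iff)
    qed (rule A)
    finally show ?thesis by simp
  qed
  have prob': "prob_measure_on K \<mu>'"
    unfolding prob_measure_on_def
  proof (intro conjI)
    show "prob_space \<mu>'" using one sets_eq_imp_space_eq[OF sets'] by (intro prob_spaceI) simp
    obtain N where N: "N \<in> sets borel" "emeasure \<mu> N = 0" "{t. t \<notin> K} \<subseteq> N"
    proof -
      obtain N where "{t \<in> space \<mu>. \<not> t \<in> K} \<subseteq> N" "emeasure \<mu> N = 0" "N \<in> sets \<mu>"
        using prob_measure_onD(3)[OF \<mu>] by (rule AE_E)
      then show ?thesis using prob_measure_onD(1,4)[OF \<mu>] by (intro that[of N]) auto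
    qed
    define N' where "N' = (if \<gamma> \<in> K then N - {\<gamma>} else N)"
    have N': "N' \<in> sets borel" "{t. t \<notin> K} \<subseteq> N'" "\<gamma> \<in> K \<Longrightarrow> \<gamma> \<notin> N'"
      using N by (auto simp: N'_def)
    note [measurable] = N'(1)
    have z1: "AE t in \<mu>. t \<notin> N'"
    proof -
      have "AE t in \<mu>. t \<notin> N" using N(1,2) prob_measure_onD(1)[OF \<mu>] by (intro AE_not_in) (auto simp: null_sets_def)
      then show ?thesis by eventually_elim (auto simp: N'_def split: if_splits)
    qed
    have z2: "A = 0 \<or> \<gamma> \<in> K"
    proof -
      have "\<gamma> = a \<or> \<gamma> = b \<or> \<gamma> \<in> {a<..<b}" using \<gamma>(1) by auto
      then show ?thesis using A0 K by blast
    qed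
    have "emeasure \<mu>' N' = (\<integral>\<^sup>+t. indicator N' t \<partial>\<mu>')" using N'(1) sets' by simp
    also have "\<dots> = (\<integral>\<^sup>+t. ennreal (w t) * indicator N' t \<partial>\<mu>) + ennreal A * indicator N' \<gamma>"
      by (rule nn) simp
    also have "(\<integral>\<^sup>+t. ennreal (w t) * indicator N' t \<partial>\<mu>) = (\<integral>\<^sup>+t. 0 \<partial>\<mu>)"
      by (rule nn_integral_cong_AE) (use z1 in eventually_elim, simp)
    finally have "emeasure \<mu>' N' = 0" using z2 N'(3) by (auto simp: indicator_def)
    then show "AE t in \<mu>'. t \<in> K"
      using N' sets' by (intro AE_I[of _ _ N']) auto
  qed (rule sets')
  have c_move: "cauchy \<mu>' z * (z - of_real \<gamma>) = cauchy \<mu> z * (z - of_real c)" if z: "apart K z" for z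
  proof (cases "z = of_real \<gamma>")
    case True
    then have "\<gamma> \<notin> K" using z apart_notin[of K \<gamma>] by simp
    then have "\<gamma> \<noteq> a" "\<gamma> \<noteq> b" using K by auto
    then have "\<gamma> \<in> {a<..<b}" using \<gamma>(1) by auto
    then have "rcauchy \<mu> \<gamma> = 0" using \<gamma>(5,6) by (auto simp: zero_le_mult_iff)
    then show ?thesis using True by (simp add: cauchy_of_real)
  next
    case zg: False
    have int: "integrable \<mu> (\<lambda>t. 1 / (of_real t - z))" by (rule integrable_cauchy[OF \<mu> z])
    have intg: "integrable \<mu> (\<lambda>t. complex_of_real (1 / (t - \<gamma>)))" using \<gamma>(3) by (rule integrable_of_real)
    define \<Phi> where "\<Phi> t = 1 / (of_real \<gamma> - z) * (of_real (\<gamma> - c) * of_real (1 / (t - \<gamma>)) - (z - of_real c) * (1 / (of_real t - z)))" for t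
    have "has_bochner_integral \<mu> \<Phi> (1 / (of_real \<gamma> - z) * (of_real (\<gamma> - c) * of_real (rcauchy \<mu> \<gamma>) - (z - of_real c) * cauchy \<mu> z))"
      unfolding \<Phi>_def cauchy_def rcauchy_def integral_complex_of_real[symmetric]
      by (intro has_bochner_integral_mult_right has_bochner_integral_diff has_bochner_integral_integrable int intg)
    then have P1: "integrable \<mu> \<Phi>" and P2: "(\<integral>t. \<Phi> t \<partial>\<mu>) = 1 / (of_real \<gamma> - z) * (of_real (\<gamma> - c) * of_real (rcauchy \<mu> \<gamma>) - (z - of_real c) * cauchy \<mu> z)"
      by (auto simp: has_bochner_integral_iff)
    have AEe: "AE t in \<mu>. w t *\<^sub>R (1 / (of_real t - z)) = \<Phi> t"
      using \<gamma>(2) prob_measure_onD(3)[OF \<mu>]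
    proof eventually_elim
      case (elim t)
      have "of_real t - z \<noteq> 0" using z elim(2) unfolding apart_def by force
      moreover have "of_real t - of_real \<gamma> \<noteq> (0::complex)" using elim(1) by simp
      moreover have "of_real \<gamma> - z \<noteq> 0" using zg by auto
      moreover have "(T - C) / (T - G) * (1 / (T - z)) = 1 / (G - z) * ((G - C) * (1 / (T - G)) - (z - C) * (1 / (T - z)))"
        if "T - z \<noteq> 0" "T - G \<noteq> 0" "G - z \<noteq> 0" for T C G :: complex
      proof -
        have "(G - C) * (1 / (T - G)) - (z - C) * (1 / (T - z)) = ((G - C) * (T - z) - (z - C) * (T - G)) / ((T - G) * (T - z))"
          using that by (simp add: diff_frac_eq)
        also have "(G - C) * (T - z) - (z - C) * (T - G) = (G - z) * (T - C)" by algebra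
        finally show ?thesis using that by simp
      qed
      ultimately show ?case
        unfolding w_def \<Phi>_def by (simp add: scaleR_conv_of_real)
    qed
    have [measurable]: "\<Phi> \<in> borel_measurable \<mu>" using P1 by simp
    have "integrable \<mu> (\<lambda>t. w t *\<^sub>R (1 / (of_real t - z)))"
      by (subst integrable_cong_AE[OF _ _ AEe]) (measurable, rule P1)
    then have i1: "integrable (density \<mu> (\<lambda>t. ennreal (w t))) (\<lambda>t. 1 / (of_real t - z))"
      using wAE by (subst integrable_density) measurable
    have "(\<integral>t. 1 / (of_real t - z) \<partial>density \<mu> (\<lambda>t. ennreal (w t))) = (\<integral>t. w t *\<^sub>R (1 / (of_real t - z)) \<partial>\<mu>)"
      using wAE by (subst integral_density) measurable
    also have "\<dots> = (\<integral>t. \<Phi> t \<partial>\<mu>)" by (rule integral_cong_AE[OF _ _ AEe]) measurable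
    finally have e1: "(\<integral>t. 1 / (of_real t - z) \<partial>density \<mu> (\<lambda>t. ennreal (w t))) = (\<integral>t. \<Phi> t \<partial>\<mu>)" .
    have i2: "integrable (density (return borel \<gamma>) (\<lambda>t. ennreal A)) (\<lambda>t. 1 / (of_real t - z))"
      by (subst integrable_density) (use A in \<open>auto simp: integrable_iff_bounded nn_integral_return\<close>)
    have e2: "(\<integral>t. 1 / (of_real t - z) \<partial>density (return borel \<gamma>) (\<lambda>t. ennreal A)) = of_real A * (1 / (of_real \<gamma> - z))"
      by (subst integral_density) (use A in \<open>auto simp: integral_return scaleR_conv_of_real\<close>)
    have "cauchy \<mu>' z = (\<integral>t. \<Phi> t \<partial>\<mu>) + of_real A * (1 / (of_real \<gamma> - z))"
      unfolding cauchy_def \<mu>'_def integral_measure_sum(2)[OF sets_eq i1 i2] e1 e2 ..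
    also have "\<dots> = - (z - of_real c) * cauchy \<mu> z / (of_real \<gamma> - z)"
    proof -
      have "1 / k * ((G - C) * r - x) + ((C - G) * r) * (1 / k) = - x / k" for k G C r x :: complex
      proof -
        have "1 / k * ((G - C) * r - x) + ((C - G) * r) * (1 / k) = (((G - C) * r - x) + (C - G) * r) / k"
          by (simp add: add_divide_distrib)
        also have "((G - C) * r - x) + (C - G) * r = - x" by algebra
        finally show ?thesis .
      qed
      then show ?thesis unfolding P2 A_def of_real_mult of_real_diff by (simp only: mult_minus_left)
    qed
    also have "\<dots> * (z - of_real \<gamma>) = cauchy \<mu> z * (z - of_real c)"
    proof -
      have "- x * y / k * (- k) = y * x" if "k \<noteq> 0" for x y k :: complex using that by simp
      from this[of "of_real \<gamma> - z" "z - of_real c" "cauchy \<mu> z"] show ?thesis using zg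
        by (simp only: minus_diff_eq right_minus_eq not_False_eq_True simp_thms)
    qed
    finally show ?thesis .
  qed
  have r_move: "rcauchy \<mu>' s * (s - \<gamma>) = rcauchy \<mu> s * (s - c)" if "s \<in> {a<..<b}" for s
    using c_move[OF apart_gap[OF that gap]] unfolding cauchy_of_real by (simp flip: of_real_diff of_real_mult)
  show ?thesis
  proof (rule that[OF \<gamma>(1) prob' c_move])
    show "zero_at \<mu>' a b c" unfolding zero_at_def
    proof
      fix s assume s: "s \<in> {a<..<b}"
      have pos: "0 \<le> rcauchy \<mu>' s * (s - c)" if s: "s \<in> {a<..<b}" "s \<noteq> \<gamma>" for s
      proof -
        have "rcauchy \<mu>' s * (s - c) * (s - \<gamma>)\<^sup>2 = (rcauchy \<mu>' s * (s - \<gamma>)) * (s - c) * (s - \<gamma>)" by algebra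
        also have "\<dots> = (rcauchy \<mu> s * (s - \<gamma>)) * (s - c)\<^sup>2" unfolding r_move[OF s(1)] by algebra
        also have "\<dots> \<ge> 0" using \<gamma>(4) s by (auto simp: zero_at_def)
        finally show ?thesis using s by (simp add: zero_le_mult_iff)
      qed
      show "0 \<le> rcauchy \<mu>' s * (s - c)"
      proof (cases "s = \<gamma>")
        case True
        have "continuous_on {a<..<b} (\<lambda>s. rcauchy \<mu>' s * (s - c))"
          by (intro continuous_intros continuous_on_rcauchy[OF prob'] apart_gap[OF _ gap])
        then have "((\<lambda>s. rcauchy \<mu>' s * (s - c)) \<longlongrightarrow> rcauchy \<mu>' s * (s - c)) (at s)"
          using s by (simp only: continuous_on_eq_continuous_at[OF open_greaterThanLessThan] isCont_def)
        then show ?thesis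
        proof (rule tendsto_lowerbound)
          have "\<forall>\<^sub>F u in at s. u \<in> {a<..<b}" using s by (intro eventually_at_in_open') auto
          moreover have "\<forall>\<^sub>F u in at s. u \<noteq> s" by (simp add: eventually_at_filter)
          ultimately show "\<forall>\<^sub>F u in at s. 0 \<le> rcauchy \<mu>' u * (u - c)"
            by eventually_elim (use pos True in auto)
        qed simp
      qed (use pos s in auto)
    qed
    fix g :: "real \<Rightarrow> ennreal" assume [measurable]: "g \<in> borel_measurable borel"
      and g: "\<And>t. g t \<noteq> 0 \<Longrightarrow> 0 \<le> (t - d) * (d - c)"
    have "(\<integral>\<^sup>+t. g t \<partial>\<mu>) \<le> (\<integral>\<^sup>+t. ennreal (w t) * g t \<partial>\<mu>)"
    proof (rule nn_integral_mono_AE)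
      show "AE t in \<mu>. g t \<le> ennreal (w t) * g t" using \<gamma>(2)
      proof eventually_elim
        case (elim t)
        show ?case
        proof (cases "g t = 0")
          case False
          have "1 \<le> w t" using cd
          proof
            assume "c = a \<and> d = b"
            with g[OF False] ab \<gamma>(1) elim have "\<gamma> < t" "a \<le> \<gamma>" "c = a" by (auto simp: zero_le_mult_iff)
            then show ?thesis by (simp add: w_def)
          next
            assume "c = b \<and> d = a"
            with g[OF False] ab \<gamma>(1) elim have "t < \<gamma>" "\<gamma> \<le> b" "c = b" by (auto simp: zero_le_mult_iff)
            then show ?thesis by (simp add: w_def le_divide_eq)
          qed
          then have "ennreal 1 * g t \<le> ennreal (w t) * g t" by (intro mult_right_mono ennreal_leI) auto
          then show ?thesis by simp
        qed simp
      qed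
    qed
    also have "\<dots> \<le> (\<integral>\<^sup>+t. g t \<partial>\<mu>')" by (subst nn) auto
    finally show "(\<integral>\<^sup>+t. g t \<partial>\<mu>) \<le> (\<integral>\<^sup>+t. g t \<partial>\<mu>')" .
  qed
qed

section \<open>Filling a gap\<close>

text \<open>The modulus of the square root of (z - d)/(z - c) at a real point outside the gap with endpoints c and d.\<close>
definition fill_weight :: "real \<Rightarrow> real \<Rightarrow> real \<Rightarrow> real" where
  "fill_weight c d t = sqrt ((d - t) / (c - t))"

lemma fill_weight_nonneg:
  assumes "(c = a \<and> d = b) \<or> (c = b \<and> d = a)" "t \<notin> {a<..<b}" "a < b"
  shows "0 \<le> (d - t) / (c - t)" "0 \<le> fill_weight c d t"
proof -
  have "t \<le> a \<or> b \<le> t" using assms(2) by auto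
  then show *: "0 \<le> (d - t) / (c - t)"
    using assms(1,3) by (auto intro: divide_nonneg_nonneg divide_nonpos_nonpos)
  then show "0 \<le> fill_weight c d t" by (simp add: fill_weight_def)
qed

text \<open>The weight is the boundary value of the holomorphic factor (d - z) A(z) that multiplies the Cauchy transform
when the gap is filled.\<close>
lemma fill_weight_eq:
  assumes cd: "(c = a \<and> d = b) \<or> (c = b \<and> d = a)" and ab: "a < b" and t: "t \<notin> {a..b}"
  shows "fill_weight c d t = (d - t) * rcauchy (arcsine a b) t"
proof -
  have *: "sqrt (v / u) = v / sqrt (u * v)" if "u > 0" "v > 0" for u v :: real
    using that by (simp add: real_sqrt_divide real_sqrt_mult field_simps)
  have ab': "(a - t) * (b - t) = (c - t) * (d - t)" using cd by (auto simp: mult.commute)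
  show ?thesis
  proof (cases "t < a")
    case True
    then have "c - t > 0" "d - t > 0" using cd ab by auto
    then show ?thesis using rcauchy_arcsine(2)[OF ab t] True *[of "c - t" "d - t"]
      by (simp add: fill_weight_def ab')
  next
    case False
    then have "t - c > 0" "t - d > 0" using cd ab t by auto
    moreover have "(d - t) / (c - t) = (t - d) / (t - c)"
      by (metis minus_diff_eq minus_divide_divide)
    moreover have "(c - t) * (d - t) = (t - c) * (t - d)" by algebra
    moreover have "(d - t) * (-1 / h) = (t - d) / h" for h :: real
      by (cases "h = 0") (simp_all add: field_simps)
    moreover have "rcauchy (arcsine a b) t = -1 / sqrt ((c - t) * (d - t))"
      using rcauchy_arcsine(2)[OF ab t] False by (simp add: ab')
    ultimately show ?thesis using *[of "t - c" "t - d"] unfolding fill_weight_def by metis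
  qed
qed

text \<open>Since (d - s)/(t - s) = 1 + (t - d)/(s - t), the integral is a value of the Cauchy transform of the arcsine
distribution.  The integrand has constant sign in s, which gives the absolute bound needed for the theorem
of Fubini.\<close>
lemma arcsine_kernel:
  assumes cd: "(c = a \<and> d = b) \<or> (c = b \<and> d = a)" and ab: "a < b" and t: "t \<notin> {a<..<b}" "t \<noteq> c"
  shows "has_bochner_integral (arcsine a b) (\<lambda>s. (d - s) / (t - s)) (1 - fill_weight c d t)" (is ?A)
    and "(\<integral>s. \<bar>(d - s) / (t - s)\<bar> \<partial>arcsine a b) \<le> 1 + fill_weight c d t"
proof -
  have in_ab: "AE s in arcsine a b. s \<in> {a<..<b}"
    using prob_measure_onD(3)[OF prob_measure_on_arcsine[OF ab]] .
  have *: "has_bochner_integral (arcsine a b) (\<lambda>s. 1 + (t - d) * (1 / (s - t))) (1 - fill_weight c d t)"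
  proof (cases "t = d")
    case True
    then show ?thesis using arcsine_total[OF ab] by (simp add: fill_weight_def)
  next
    case False
    then have t': "t \<notin> {a..b}" using t cd by auto
    have "has_bochner_integral (arcsine a b) (\<lambda>s. 1 + (t - d) * (1 / (s - t))) (1 + (t - d) * rcauchy (arcsine a b) t)"
      unfolding rcauchy_def
      by (intro has_bochner_integral_add arcsine_total[OF ab] has_bochner_integral_mult_right
          has_bochner_integral_integrable rcauchy_arcsine(1)[OF ab t'])
    then show ?thesis by (simp add: fill_weight_eq[OF cd ab t'] algebra_simps)
  qed
  also have "?this \<longleftrightarrow> ?A"
  proof (rule has_bochner_integral_cong_AE)
    show "AE s in arcsine a b. 1 + (t - d) * (1 / (s - t)) = (d - s) / (t - s)" using in_ab
    proof eventually_elim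
      case (elim s)
      then have "s - t \<noteq> 0" "t - s \<noteq> 0" using t(1) by auto
      then show ?case by (simp add: divide_simps) (simp add: algebra_simps)
    qed
  qed auto
  finally show *: ?A .
  have sgn: "(\<forall>s\<in>{a<..<b}. 0 \<le> (d - s) / (t - s)) \<or> (\<forall>s\<in>{a<..<b}. (d - s) / (t - s) \<le> 0)"
  proof -
    consider "t \<le> a" "d = a" | "t \<le> a" "d = b" | "b \<le> t" "d = a" | "b \<le> t" "d = b" using t(1) cd by force
    then show ?thesis
      by cases (auto intro: divide_nonneg_nonneg divide_nonpos_nonpos divide_nonneg_nonpos divide_nonpos_nonneg)
  qed
  have "(\<integral>s. \<bar>(d - s) / (t - s)\<bar> \<partial>arcsine a b) = \<bar>\<integral>s. (d - s) / (t - s) \<partial>arcsine a b\<bar>"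
    using sgn
  proof
    assume *: "\<forall>s\<in>{a<..<b}. 0 \<le> (d - s) / (t - s)"
    have "AE s in arcsine a b. 0 \<le> (d - s) / (t - s)"
      using in_ab by eventually_elim (use * in blast)
    moreover from this have "AE s in arcsine a b. \<bar>(d - s) / (t - s)\<bar> = (d - s) / (t - s)"
      by eventually_elim (rule abs_of_nonneg)
    then have "(\<integral>s. \<bar>(d - s) / (t - s)\<bar> \<partial>arcsine a b) = (\<integral>s. (d - s) / (t - s) \<partial>arcsine a b)"
      by (intro integral_cong_AE) measurable
    moreover have "0 \<le> (\<integral>s. (d - s) / (t - s) \<partial>arcsine a b)"
      by (rule integral_nonneg_AE) fact
    ultimately show ?thesis by simp
  next
    assume *: "\<forall>s\<in>{a<..<b}. (d - s) / (t - s) \<le> 0"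
    have "AE s in arcsine a b. (d - s) / (t - s) \<le> 0"
      using in_ab by eventually_elim (use * in blast)
    then have "AE s in arcsine a b. \<bar>(d - s) / (t - s)\<bar> = - ((d - s) / (t - s))"
      by eventually_elim (rule abs_of_nonpos)
    then have "(\<integral>s. \<bar>(d - s) / (t - s)\<bar> \<partial>arcsine a b) = (\<integral>s. - ((d - s) / (t - s)) \<partial>arcsine a b)"
      by (intro integral_cong_AE) measurable
    moreover have "0 \<le> (\<integral>s. \<bar>(d - s) / (t - s)\<bar> \<partial>arcsine a b)" by simp
    ultimately show ?thesis by simp
  qed
  then show "(\<integral>s. \<bar>(d - s) / (t - s)\<bar> \<partial>arcsine a b) \<le> 1 + fill_weight c d t"
    using * fill_weight_nonneg(2)[OF cd t(1) ab] by (auto simp: has_bochner_integral_iff)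
qed

lemma arcsine_kernel_complex:
  assumes cd: "(c = a \<and> d = b) \<or> (c = b \<and> d = a)" and ab: "a < b" and t: "t \<notin> {a<..<b}" "t \<noteq> c"
    and z: "apart {a<..<b} z" "z \<noteq> of_real t"
  shows "(\<integral>s. of_real ((d - s) / (t - s)) * (1 / (of_real s - z)) \<partial>arcsine a b)
    = ((of_real d - z) * cauchy (arcsine a b) z - of_real (fill_weight c d t)) / (of_real t - z)"
proof -
  note A = prob_measure_on_arcsine[OF ab]
  have in_ab: "AE s in arcsine a b. s \<in> {a<..<b}" using prob_measure_onD(3)[OF A] .
  have k: "has_bochner_integral (arcsine a b) (\<lambda>s. complex_of_real ((d - s) / (t - s))) (of_real (1 - fill_weight c d t))"
    by (rule has_bochner_integral_of_real[OF arcsine_kernel(1)[OF cd ab t]])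
  have c: "has_bochner_integral (arcsine a b) (\<lambda>s. 1 / (of_real s - z)) (cauchy (arcsine a b) z)"
    unfolding cauchy_def by (rule has_bochner_integral_integrable[OF integrable_cauchy[OF A z(1)]])
  have one: "has_bochner_integral (arcsine a b) (\<lambda>s. 1) (1::complex)"
    using has_bochner_integral_of_real[OF arcsine_total[OF ab], where 'a = complex] by simp
  have "has_bochner_integral (arcsine a b)
      (\<lambda>s. (of_real ((d - s) / (t - s)) + ((of_real d - z) * (1 / (of_real s - z)) - 1)) / (of_real t - z))
      ((of_real (1 - fill_weight c d t) + ((of_real d - z) * cauchy (arcsine a b) z - 1)) / (of_real t - z))"
    by (intro has_bochner_integral_divide_zero has_bochner_integral_add has_bochner_integral_diff has_bochner_integral_mult_right k c one)
  moreover have "(\<integral>s. of_real ((d - s) / (t - s)) * (1 / (of_real s - z)) \<partial>arcsine a b)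
     = (\<integral>s. (of_real ((d - s) / (t - s)) + ((of_real d - z) * (1 / (of_real s - z)) - 1)) / (of_real t - z) \<partial>arcsine a b)"
  proof (rule integral_cong_AE)
    show "AE s in arcsine a b. of_real ((d - s) / (t - s)) * (1 / (of_real s - z))
        = (of_real ((d - s) / (t - s)) + ((of_real d - z) * (1 / (of_real s - z)) - 1)) / (of_real t - z)"
      using in_ab
    proof eventually_elim
      case (elim s)
      have n1: "of_real t - of_real s \<noteq> (0::complex)" using elim t(1) by auto
      have n2: "of_real s - z \<noteq> 0" using elim z(1) unfolding apart_def by force
      have n3: "of_real t - z \<noteq> 0" using z(2) by auto
      have "(D - S) / (T - S) * (1 / (S - z)) = ((D - S) / (T - S) + ((D - z) * (1 / (S - z)) - 1)) / (T - z)"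
        if "T - S \<noteq> 0" "S - z \<noteq> 0" "T - z \<noteq> 0" for D S T :: complex
      proof -
        have "(D - z) * (1 / (S - z)) - 1 = (D - S) / (S - z)" using that by (simp add: divide_simps)
        then have "(D - S) / (T - S) + ((D - z) * (1 / (S - z)) - 1) = (D - S) * (S - z) / ((T - S) * (S - z)) + (D - S) * (T - S) / ((T - S) * (S - z))"
          using that by simp
        also have "\<dots> = ((D - S) * (T - z)) / ((T - S) * (S - z))" by (simp add: add_divide_distrib[symmetric] algebra_simps)
        finally show ?thesis using that by simp
      qed
      from this[OF n1 n2 n3, of "of_real d"] show ?case by simp
    qed
  qed auto
  ultimately show ?thesis by (simp add: has_bochner_integral_iff)
qed

text \<open>The new measure is the old one with the weight, plus a measure on the gap that has the density
(d - s) m(s) with respect to the arcsine distribution; the density is nonnegative because m has its zero at c.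
Writing m(s) as an integral over the old measure and interchanging the integrals expresses the
transform of the second part by the kernel integrals above, and the terms with the weight cancel.\<close>
lemma fill_gap:
  assumes \<mu>: "prob_measure_on K \<mu>" and ab: "a < b" and gap: "K \<inter> {a<..<b} = {}"
    and cd: "(c = a \<and> d = b) \<or> (c = b \<and> d = a)" and z: "zero_at \<mu> a b c"
  obtains \<mu>' where "prob_measure_on (K \<union> {a<..<b}) \<mu>'"
    "\<And>z. apart (K \<union> {a<..<b}) z \<Longrightarrow> cauchy \<mu>' z = cauchy \<mu> z * ((of_real d - z) * cauchy (arcsine a b) z)"
    "\<And>g. g \<in> borel_measurable borel \<Longrightarrow> (\<And>t. t \<in> {a<..<b} \<Longrightarrow> g t = 0)
      \<Longrightarrow> (\<integral>\<^sup>+t. g t \<partial>\<mu>') = (\<integral>\<^sup>+t. g t * ennreal (fill_weight c d t) \<partial>\<mu>)"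
proof -
  note [measurable_cong] = prob_measure_onD(1)[OF \<mu>]
  note A = prob_measure_on_arcsine[OF ab]
  interpret M: prob_space \<mu> using prob_measure_onD(2)[OF \<mu>] .
  interpret A: prob_space "arcsine a b" using prob_measure_onD(2)[OF A] .
  interpret P: pair_prob_space \<mu> "arcsine a b" ..
  have in_ab: "AE s in arcsine a b. s \<in> {a<..<b}" using prob_measure_onD(3)[OF A] .
  note ez = endpoint_zero_integrable[OF \<mu> ab gap cd z]
  have inK: "AE t in \<mu>. t \<in> K" using prob_measure_onD(3)[OF \<mu>] .
  have ngap: "t \<notin> {a<..<b}" if "t \<in> K" for t using that gap by auto
  define w where "w = fill_weight c d"
  have [measurable]: "w \<in> borel_measurable borel" unfolding w_def fill_weight_def by measurable
  have w0: "AE t in \<mu>. 0 \<le> w t" using inK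
    by eventually_elim (use fill_weight_nonneg(2)[OF cd _ ab] ngap in \<open>auto simp: w_def\<close>)
  have w_int: "integrable \<mu> w"
  proof (rule Bochner_Integration.integrable_bound)
    show "integrable \<mu> (\<lambda>t. 1 + \<bar>d - c\<bar> * \<bar>1 / (t - c)\<bar>)"
      by (intro Bochner_Integration.integrable_add integrable_mult_right integrable_abs ez(2)) simp
    show "AE t in \<mu>. norm (w t) \<le> norm (1 + \<bar>d - c\<bar> * \<bar>1 / (t - c)\<bar>)"
      using w0 ez(1)
    proof eventually_elim
      case (elim t)
      have "(d - t) / (c - t) = 1 + (d - c) / (c - t)" using elim(2) by (simp add: divide_simps)
      also have "\<dots> \<le> 1 + \<bar>(d - c) / (c - t)\<bar>" using abs_ge_self by (rule add_left_mono)
      also have "\<bar>(d - c) / (c - t)\<bar> = \<bar>d - c\<bar> * \<bar>1 / (t - c)\<bar>" by (simp add: abs_minus_commute)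
      finally have le: "(d - t) / (c - t) \<le> 1 + \<bar>d - c\<bar> * \<bar>1 / (t - c)\<bar>" .
      have "sqrt y \<le> 1 + x" if "y \<le> 1 + x" "0 \<le> x" for x y :: real
      proof (rule real_le_lsqrt)
        show "y \<le> (1 + x)\<^sup>2" using that zero_le_square[of x] unfolding power2_eq_square distrib_left distrib_right by linarith
      qed (use that in auto)
      from this[OF le] have "w t \<le> 1 + \<bar>d - c\<bar> * \<bar>1 / (t - c)\<bar>" unfolding w_def fill_weight_def by simp
      then show ?case using elim(1) by simp
    qed
  qed auto
  define h where "h t s = (d - s) / (t - s)" for t s
  have h_meas [measurable]: "case_prod h \<in> borel_measurable (borel \<Otimes>\<^sub>M borel)" unfolding h_def by measurable
  have h_int: "integrable (\<mu> \<Otimes>\<^sub>M arcsine a b) (case_prod h)"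
  proof (rule P.Fubini_integrable)
    show "integrable \<mu> (\<lambda>t. \<integral>s. norm (case (t, s) of (t, s) \<Rightarrow> h t s) \<partial>arcsine a b)"
    proof (rule Bochner_Integration.integrable_bound)
      show "integrable \<mu> (\<lambda>t. 1 + w t)" using w_int by auto
      show "AE t in \<mu>. norm (\<integral>s. norm (case (t, s) of (t, s) \<Rightarrow> h t s) \<partial>arcsine a b) \<le> norm (1 + w t)"
        using inK ez(1) w0
      proof eventually_elim
        case (elim t)
        have "(\<integral>s. \<bar>h t s\<bar> \<partial>arcsine a b) \<le> 1 + w t"
          using arcsine_kernel(2)[OF cd ab ngap[OF elim(1)] elim(2)] unfolding h_def w_def .
        moreover have "0 \<le> (\<integral>s. \<bar>h t s\<bar> \<partial>arcsine a b)" by simp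
        ultimately show ?case by simp
      qed
    qed measurable
    show "AE t in \<mu>. integrable (arcsine a b) (\<lambda>s. case (t, s) of (t, s) \<Rightarrow> h t s)"
      using inK ez(1)
    proof eventually_elim
      case (elim t)
      show ?case using arcsine_kernel(1)[OF cd ab ngap[OF elim(1)] elim(2)] unfolding h_def
        by (simp add: has_bochner_integral_iff)
    qed
  qed measurable
  define v where "v s = (\<integral>t. h t s \<partial>\<mu>)" for s
  have v_eq: "v s = (d - s) * rcauchy \<mu> s" for s
    unfolding v_def h_def rcauchy_def by (subst integral_mult_right_zero[symmetric]) simp
  have [measurable]: "v \<in> borel_measurable borel" unfolding v_def by measurable
  have v0: "AE s in arcsine a b. 0 \<le> v s" using in_ab
  proof eventually_elim
    case (elim s)
    have "0 \<le> rcauchy \<mu> s * (s - c)" using z elim by (auto simp: zero_at_def)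
    moreover have "0 < (s - c) * (d - s)" using cd elim by (auto intro: mult_neg_neg)
    ultimately have "0 \<le> rcauchy \<mu> s * (s - c) * ((s - c) * (d - s))"
      by (rule mult_nonneg_nonneg[OF _ less_imp_le])
    then have "0 \<le> (s - c)\<^sup>2 * v s" unfolding v_eq by (simp add: power2_eq_square mult_ac)
    moreover have "s \<noteq> c" using cd elim by auto
    ultimately show ?case by (simp add: zero_le_mult_iff)
  qed
  define \<mu>' where "\<mu>' = measure_sum (density \<mu> (\<lambda>t. ennreal (w t))) (density (arcsine a b) (\<lambda>s. ennreal (v s)))"
  have sets_eq: "sets (density (arcsine a b) (\<lambda>s. ennreal (v s))) = sets (density \<mu> (\<lambda>t. ennreal (w t)))"
    using prob_measure_onD(1)[OF \<mu>] by simp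
  have sets': "sets \<mu>' = sets borel" using prob_measure_onD(1)[OF \<mu>] by (simp add: \<mu>'_def)
  have nn: "(\<integral>\<^sup>+t. g t \<partial>\<mu>') = (\<integral>\<^sup>+t. ennreal (w t) * g t \<partial>\<mu>) + (\<integral>\<^sup>+s. ennreal (v s) * g s \<partial>arcsine a b)"
    if [measurable]: "g \<in> borel_measurable borel" for g
    unfolding \<mu>'_def by (subst nn_integral_measure_sum[OF sets_eq])
      (simp_all add: nn_integral_density)
  have v_int: "integrable (arcsine a b) v" "(\<integral>s. v s \<partial>arcsine a b) = (\<integral>t. 1 - w t \<partial>\<mu>)"
  proof -
    show "integrable (arcsine a b) v" unfolding v_def by (rule P.integrable_snd[OF h_int])
    have "(\<integral>s. v s \<partial>arcsine a b) = (\<integral>t. \<integral>s. h t s \<partial>arcsine a b \<partial>\<mu>)"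
      unfolding v_def by (rule P.Fubini_integral[OF h_int])
    also have "\<dots> = (\<integral>t. 1 - w t \<partial>\<mu>)"
    proof (rule integral_cong_AE)
      show "AE t in \<mu>. (\<integral>s. h t s \<partial>arcsine a b) = 1 - w t" using inK ez(1)
      proof eventually_elim
        case (elim t)
        show ?case using arcsine_kernel(1)[OF cd ab ngap[OF elim(1)] elim(2)] unfolding h_def w_def
          by (simp add: has_bochner_integral_iff)
      qed
    qed measurable
    finally show "(\<integral>s. v s \<partial>arcsine a b) = (\<integral>t. 1 - w t \<partial>\<mu>)" .
  qed
  have one: "emeasure \<mu>' UNIV = 1"
  proof -
    have "emeasure \<mu>' UNIV = (\<integral>\<^sup>+t. 1 \<partial>\<mu>')" using sets_eq_imp_space_eq[OF sets'] by simp
    also have "\<dots> = (\<integral>\<^sup>+t. ennreal (w t) \<partial>\<mu>) + (\<integral>\<^sup>+s. ennreal (v s) \<partial>arcsine a b)"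
      by (subst nn) auto
    also have "\<dots> = ennreal (\<integral>t. w t \<partial>\<mu>) + ennreal (\<integral>s. v s \<partial>arcsine a b)"
      using w_int v_int w0 v0 by (simp add: nn_integral_eq_integral)
    also have "\<dots> = ennreal ((\<integral>t. w t \<partial>\<mu>) + (\<integral>s. v s \<partial>arcsine a b))"
      by (rule ennreal_plus[symmetric]) (use w0 v0 in \<open>auto intro: integral_nonneg_AE\<close>)
    also have "(\<integral>t. w t \<partial>\<mu>) + (\<integral>s. v s \<partial>arcsine a b) = 1"
      using w_int by (simp add: v_int(2) M.prob_space)
    finally show ?thesis by simp
  qed
  have supp: "AE t in \<mu>'. t \<in> K \<union> {a<..<b}"
  proof -
    obtain N where "{t \<in> space \<mu>. \<not> t \<in> K} \<subseteq> N" "emeasure \<mu> N = 0" "N \<in> sets \<mu>"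
      using inK by (rule AE_E)
    then have N: "{t. t \<notin> K} \<subseteq> N" "N \<in> sets borel" "AE t in \<mu>. t \<notin> N"
      using prob_measure_onD(1,4)[OF \<mu>] by (auto intro: AE_not_in simp: null_sets_def)
    define N' where "N' = N - {a<..<b}"
    have N' [measurable]: "N' \<in> sets borel" using N(2) by (simp add: N'_def)
    have "emeasure \<mu>' N' = (\<integral>\<^sup>+t. indicator N' t \<partial>\<mu>')" using N' sets' by simp
    also have "\<dots> = (\<integral>\<^sup>+t. ennreal (w t) * indicator N' t \<partial>\<mu>) + (\<integral>\<^sup>+s. ennreal (v s) * indicator N' s \<partial>arcsine a b)"
      by (rule nn) simp
    also have "(\<integral>\<^sup>+t. ennreal (w t) * indicator N' t \<partial>\<mu>) = (\<integral>\<^sup>+t. 0 \<partial>\<mu>)"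
      by (rule nn_integral_cong_AE) (use N(3) in eventually_elim, auto simp: N'_def)
    also have "(\<integral>\<^sup>+s. ennreal (v s) * indicator N' s \<partial>arcsine a b) = (\<integral>\<^sup>+s. 0 \<partial>arcsine a b)"
      by (rule nn_integral_cong_AE) (use in_ab in eventually_elim, auto simp: N'_def)
    finally have "emeasure \<mu>' N' = 0" by simp
    moreover have "{t \<in> space \<mu>'. t \<notin> K \<union> {a<..<b}} \<subseteq> N'" using N(1) by (auto simp: N'_def)
    ultimately show ?thesis using N' sets' by (intro AE_I[of _ _ N']) auto
  qed
  have prob': "prob_measure_on (K \<union> {a<..<b}) \<mu>'"
    unfolding prob_measure_on_def
    using one sets' supp sets_eq_imp_space_eq[OF sets'] by (auto intro: prob_spaceI)
  show ?thesis
  proof (rule that[OF prob'])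
    fix z assume z: "apart (K \<union> {a<..<b}) z"
    have zK: "apart K z" and zab: "apart {a<..<b} z" using z by (auto elim: apart_mono)
    have int: "integrable \<mu> (\<lambda>t. 1 / (of_real t - z))" by (rule integrable_cauchy[OF \<mu> zK])
    obtain e where e: "e > 0" "\<And>t. t \<in> K \<union> {a<..<b} \<Longrightarrow> e \<le> cmod (of_real t - z)"
      using z unfolding apart_def by auto
    have bd: "cmod (1 / (of_real t - z)) \<le> 1 / e" if "t \<in> K \<union> {a<..<b}" for t
      using e(1) e(2)[OF that] by (auto simp: norm_divide intro!: divide_left_mono mult_pos_pos)
    have w_int_c: "integrable \<mu> (\<lambda>t. w t *\<^sub>R (1 / (of_real t - z)))"
    proof (rule Bochner_Integration.integrable_bound)
      show "integrable \<mu> (\<lambda>t. w t * (1 / e))" using w_int by auto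
      show "AE t in \<mu>. norm (w t *\<^sub>R (1 / (of_real t - z))) \<le> norm (w t * (1 / e))"
        using inK
      proof eventually_elim
        case (elim t)
        show ?case unfolding norm_scaleR real_norm_def abs_mult
          using bd[of t] elim e(1) by (intro mult_left_mono) auto
      qed
    qed measurable
    have v_int_c: "integrable (arcsine a b) (\<lambda>t. v t *\<^sub>R (1 / (of_real t - z)))"
    proof (rule Bochner_Integration.integrable_bound)
      show "integrable (arcsine a b) (\<lambda>t. v t * (1 / e))" using v_int by auto
      show "AE t in arcsine a b. norm (v t *\<^sub>R (1 / (of_real t - z))) \<le> norm (v t * (1 / e))"
        using in_ab
      proof eventually_elim
        case (elim t)
        show ?case unfolding norm_scaleR real_norm_def abs_mult
          using bd[of t] elim e(1) by (intro mult_left_mono) auto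
      qed
    qed measurable
    have i1: "integrable (density \<mu> (\<lambda>t. ennreal (w t))) (\<lambda>t. 1 / (of_real t - z))"
      using w_int_c w0 by (subst integrable_density) measurable
    have e1: "(\<integral>t. 1 / (of_real t - z) \<partial>density \<mu> (\<lambda>t. ennreal (w t))) = (\<integral>t. w t *\<^sub>R (1 / (of_real t - z)) \<partial>\<mu>)"
      using w0 by (subst integral_density) measurable
    have i2: "integrable (density (arcsine a b) (\<lambda>t. ennreal (v t))) (\<lambda>t. 1 / (of_real t - z))"
      using v_int_c v0 by (subst integrable_density) measurable
    have e2: "(\<integral>t. 1 / (of_real t - z) \<partial>density (arcsine a b) (\<lambda>t. ennreal (v t))) = (\<integral>s. v s *\<^sub>R (1 / (of_real s - z)) \<partial>arcsine a b)"
      using v0 by (subst integral_density) measurable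
    define \<Psi> where "\<Psi> t s = complex_of_real (h t s) * (1 / (of_real s - z))" for t s
    have [measurable]: "case_prod \<Psi> \<in> borel_measurable (borel \<Otimes>\<^sub>M borel)" unfolding \<Psi>_def by measurable
    have \<Psi>_int: "integrable (\<mu> \<Otimes>\<^sub>M arcsine a b) (case_prod \<Psi>)"
    proof (rule Bochner_Integration.integrable_bound)
      show "integrable (\<mu> \<Otimes>\<^sub>M arcsine a b) (\<lambda>x. (1 / e) * case_prod h x)" using h_int by auto
      have "{x \<in> space (\<mu> \<Otimes>\<^sub>M arcsine a b). snd x \<in> {a<..<b}} \<in> sets (\<mu> \<Otimes>\<^sub>M arcsine a b)" by measurable
      then have "AE x in \<mu> \<Otimes>\<^sub>M arcsine a b. snd x \<in> {a<..<b}"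
        by (subst P.AE_pair_iff[symmetric]) (use in_ab in simp_all)
      then show "AE x in \<mu> \<Otimes>\<^sub>M arcsine a b. norm (case_prod \<Psi> x) \<le> norm ((1 / e) * case_prod h x)"
      proof eventually_elim
        case (elim x)
        have "norm (case_prod \<Psi> x) = \<bar>case_prod h x\<bar> * cmod (1 / (of_real (snd x) - z))"
          by (simp only: \<Psi>_def case_prod_unfold norm_mult norm_of_real)
        also have "\<dots> \<le> \<bar>case_prod h x\<bar> * (1 / e)" using bd[of "snd x"] elim by (intro mult_left_mono) auto
        finally show ?case using e(1) by (simp add: abs_mult mult.commute)
      qed
    qed measurable
    have "(\<integral>s. v s *\<^sub>R (1 / (of_real s - z)) \<partial>arcsine a b) = (\<integral>s. \<integral>t. \<Psi> t s \<partial>\<mu> \<partial>arcsine a b)"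
    proof (rule Bochner_Integration.integral_cong[OF refl])
      fix s
      show "v s *\<^sub>R (1 / (of_real s - z)) = (\<integral>t. \<Psi> t s \<partial>\<mu>)"
        unfolding \<Psi>_def v_def integral_mult_left_zero scaleR_conv_of_real
        by (simp only: integral_complex_of_real)
    qed
    also have "\<dots> = (\<integral>t. \<integral>s. \<Psi> t s \<partial>arcsine a b \<partial>\<mu>)" by (rule P.Fubini_integral[OF \<Psi>_int])
    also have "\<dots> = (\<integral>t. (of_real d - z) * cauchy (arcsine a b) z * (1 / (of_real t - z)) - w t *\<^sub>R (1 / (of_real t - z)) \<partial>\<mu>)"
    proof (rule integral_cong_AE)
      show "AE t in \<mu>. (\<integral>s. \<Psi> t s \<partial>arcsine a b) = (of_real d - z) * cauchy (arcsine a b) z * (1 / (of_real t - z)) - w t *\<^sub>R (1 / (of_real t - z))"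
        using inK ez(1)
      proof eventually_elim
        case (elim t)
        have "z \<noteq> of_real t" using e(1) e(2)[of t] elim by auto
        from arcsine_kernel_complex[OF cd ab ngap[OF elim(1)] elim(2) zab this]
        show ?case unfolding \<Psi>_def h_def w_def scaleR_conv_of_real diff_divide_distrib by simp
      qed
    qed measurable
    also have "\<dots> = (of_real d - z) * cauchy (arcsine a b) z * cauchy \<mu> z - (\<integral>t. w t *\<^sub>R (1 / (of_real t - z)) \<partial>\<mu>)"
      unfolding cauchy_def[of \<mu>] using int w_int_c
      by (subst Bochner_Integration.integral_diff) (auto simp only: integral_mult_right_zero intro!: integrable_mult_right)
    finally have "(\<integral>s. v s *\<^sub>R (1 / (of_real s - z)) \<partial>arcsine a b)
      = (of_real d - z) * cauchy (arcsine a b) z * cauchy \<mu> z - (\<integral>t. w t *\<^sub>R (1 / (of_real t - z)) \<partial>\<mu>)" .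
    moreover have "cauchy \<mu>' z = (\<integral>t. w t *\<^sub>R (1 / (of_real t - z)) \<partial>\<mu>) + (\<integral>s. v s *\<^sub>R (1 / (of_real s - z)) \<partial>arcsine a b)"
      unfolding cauchy_def \<mu>'_def integral_measure_sum(2)[OF sets_eq i1 i2] e1 e2 ..
    ultimately show "cauchy \<mu>' z = cauchy \<mu> z * ((of_real d - z) * cauchy (arcsine a b) z)"
      by simp
  next
    fix g :: "real \<Rightarrow> ennreal" assume [measurable]: "g \<in> borel_measurable borel" and g: "\<And>t. t \<in> {a<..<b} \<Longrightarrow> g t = 0"
    have "(\<integral>\<^sup>+s. ennreal (v s) * g s \<partial>arcsine a b) = (\<integral>\<^sup>+s. 0 \<partial>arcsine a b)"
      by (rule nn_integral_cong_AE) (use in_ab in eventually_elim, simp add: g)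
    then show "(\<integral>\<^sup>+t. g t \<partial>\<mu>') = (\<integral>\<^sup>+t. g t * ennreal (fill_weight c d t) \<partial>\<mu>)"
      by (subst nn) (auto simp: w_def mult.commute)
  qed
qed

section \<open>The Poisson formula in the half-plane\<close>

lemma has_bochner_integral_poisson_kernel:
  assumes "Y > 0"
  shows "has_bochner_integral lborel (\<lambda>t. Y / ((t - a)\<^sup>2 + Y\<^sup>2)) pi"
proof -
  have pos: "(t - a)\<^sup>2 + Y\<^sup>2 > 0" for t using assms by (intro add_nonneg_pos) auto
  have *: "(((\<lambda>t. arctan ((t - a) / Y)) \<circ> real_of_ereal) \<longlongrightarrow> - (pi/2)) (at_right (-\<infinity>))"
    "(((\<lambda>t. arctan ((t - a) / Y)) \<circ> real_of_ereal) \<longlongrightarrow> pi/2) (at_left \<infinity>)"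
  proof -
    have "filterlim (\<lambda>t. (t - a) / Y) at_bot at_bot" "filterlim (\<lambda>t. (t - a) / Y) at_top at_top"
      using assms by real_asymp+
    then show "(((\<lambda>t. arctan ((t - a) / Y)) \<circ> real_of_ereal) \<longlongrightarrow> - (pi/2)) (at_right (-\<infinity>))"
      "(((\<lambda>t. arctan ((t - a) / Y)) \<circ> real_of_ereal) \<longlongrightarrow> pi/2) (at_left \<infinity>)"
      by (simp_all add: ereal_tendsto_simps filterlim_compose[OF tendsto_arctan_at_bot] filterlim_compose[OF tendsto_arctan_at_top])
  qed
  have d: "((\<lambda>t. arctan ((t - a) / Y)) has_real_derivative Y / ((t - a)\<^sup>2 + Y\<^sup>2)) (at t)" for t
  proof -
    have "((\<lambda>t. arctan ((t - a) / Y)) has_real_derivative inverse (1 + ((t - a) / Y)\<^sup>2) * (1 / Y)) (at t)"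
      using assms by (auto intro!: derivative_eq_intros)
    also have "inverse (1 + ((t - a) / Y)\<^sup>2) * (1 / Y) = Y / ((t - a)\<^sup>2 + Y\<^sup>2)"
    proof -
      have "1 + ((t - a) / Y)\<^sup>2 = ((t - a)\<^sup>2 + Y\<^sup>2) / Y\<^sup>2"
        using assms by (simp add: power_divide add_divide_distrib)
      then show ?thesis using assms by (simp add: power2_eq_square)
    qed
    finally show ?thesis .
  qed
  have c: "isCont (\<lambda>t. Y / ((t - a)\<^sup>2 + Y\<^sup>2)) t" for t
    using pos[of t] by (intro continuous_intros) auto
  have n: "0 \<le> Y / ((t - a)\<^sup>2 + Y\<^sup>2)" for t using assms pos[of t] by simp
  note F = interval_integral_FTC_nonneg[OF _ d c _ *]
  have "set_integrable lborel (einterval (-\<infinity>) \<infinity>) (\<lambda>t. Y / ((t - a)\<^sup>2 + Y\<^sup>2))"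
    "(LBINT t=-\<infinity>..\<infinity>. Y / ((t - a)\<^sup>2 + Y\<^sup>2)) = pi/2 - - (pi/2)"
    using n by (intro F; simp)+
  moreover have "einterval (-\<infinity>) \<infinity> = UNIV" by (auto simp: einterval_def)
  ultimately show ?thesis
    by (simp add: set_integrable_def set_lebesgue_integral_def interval_lebesgue_integral_def has_bochner_integral_iff)
qed

lemma half_plane_convex: "convex {z. Im z > c}" "open {z. Im z > c}"
  by (rule convex_halfspace_Im_gt) (rule open_halfspace_Im_gt)

text \<open>Cauchy's formula for w = a + i Y minus Cauchy's theorem for the mirror image of w, on large rectangles
that stand on the real axis.  The difference of the two Cauchy kernels decays quadratically, so the other three
sides contribute nothing in the limit.\<close>
lemma poisson_formula:
  assumes hol: "f holomorphic_on {z. Im z > - \<delta>}" and \<delta>: "\<delta> > 0" and Y: "Y > 0"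
    and bd: "\<And>z. Im z \<ge> 0 \<Longrightarrow> cmod (f z) \<le> 1"
  shows "integrable lborel (\<lambda>t. of_real (Y / ((t - a)\<^sup>2 + Y\<^sup>2)) * f (of_real t))"
    and "(\<integral>t. of_real (Y / ((t - a)\<^sup>2 + Y\<^sup>2)) * f (of_real t) \<partial>lborel) = of_real pi * f (Complex a Y)"
proof -
  define w where "w = Complex a Y"
  define w' where "w' = Complex a (- Y)"
  \<comment> \<open>This convex domain contains w but not its mirror image w'.\<close>
  define S where "S = {z. Im z > - min \<delta> Y}"
  have S: "convex S" "open S" unfolding S_def by (rule half_plane_convex)+
  have holS: "f holomorphic_on S" by (rule holomorphic_on_subset[OF hol]) (auto simp: S_def)
  have wS: "w \<in> S" using Y \<delta> by (auto simp: S_def w_def)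
  have w'S: "z - w' \<noteq> 0" if "z \<in> S" for z using that by (auto simp: S_def w'_def complex_eq_iff)
  define g where "g z = f z / (z - w) - f z / (z - w')" for z
  have g_eq: "g z = f z * (2 * \<i> * of_real Y) / ((z - w) * (z - w'))" if "z \<noteq> w" "z \<noteq> w'" for z
  proof -
    have "g z = (f z * (z - w') - f z * (z - w)) / ((z - w) * (z - w'))"
      using that by (simp add: g_def diff_frac_eq)
    also have "f z * (z - w') - f z * (z - w) = f z * (w - w')" by (simp add: algebra_simps)
    also have "w - w' = 2 * \<i> * of_real Y" by (simp add: w_def w'_def complex_eq_iff)
    finally show ?thesis .
  qed
  define K where "K t = Y / ((t - a)\<^sup>2 + Y\<^sup>2)" for t
  have Kpos: "(t - a)\<^sup>2 + Y\<^sup>2 > 0" for t using Y by (intro add_nonneg_pos) auto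
  have g_real: "g (of_real t) = 2 * \<i> * (of_real (K t) * f (of_real t))" for t
  proof -
    have ne: "of_real t \<noteq> w" "of_real t \<noteq> w'" using Y by (auto simp: w_def w'_def complex_eq_iff)
    have "(of_real t - w) * (of_real t - w') = of_real ((t - a)\<^sup>2 + Y\<^sup>2)"
      by (simp add: w_def w'_def complex_eq_iff power2_eq_square algebra_simps)
    then show ?thesis unfolding g_eq[OF ne] K_def by simp
  qed
  have f_cont: "continuous_on UNIV (\<lambda>t. f (of_real t))"
    by (rule continuous_on_compose2[OF holomorphic_on_imp_continuous_on[OF hol]]) (use \<delta> in \<open>auto intro!: continuous_intros\<close>)
  then have f_meas [measurable]: "(\<lambda>t. f (of_real t)) \<in> borel_measurable borel"
    by (rule borel_measurable_continuous_onI)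
  have K_int: "integrable lborel K" using has_bochner_integral_poisson_kernel[OF Y, of a] unfolding K_def
    by (simp add: has_bochner_integral_iff)
  have [measurable]: "K \<in> borel_measurable borel" unfolding K_def by measurable
  have K0: "0 \<le> K t" for t using Kpos[of t] Y by (simp add: K_def)
  have Kf_bd: "norm (of_real (K t) * f (of_real t)) \<le> K t" for t
    using bd[of "of_real t"] K0[of t] by (simp add: norm_mult mult_left_le)
  show Kf_int: "integrable lborel (\<lambda>t. of_real (Y / ((t - a)\<^sup>2 + Y\<^sup>2)) * f (of_real t))"
    unfolding K_def[symmetric]
  proof (rule Bochner_Integration.integrable_bound[OF K_int])
    show "AE t in lborel. norm (of_real (K t) * f (of_real t)) \<le> norm (K t)"
      using Kf_bd K0 by simp
  qed measurable
  have rect: "cmod (2 * of_real pi * \<i> * f w - integral {a - R..a + R} (\<lambda>t. 2 * \<i> * (of_real (K t) * f (of_real t)))) \<le> 32 * Y / R"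
    if R: "R \<ge> 2 * Y" for R
  proof -
    have R0: "R > 0" using R Y by simp
    define a1 a2 a3 a4 where "a1 = Complex (a - R) 0" and "a2 = Complex (a + R) 0"
      and "a3 = Complex (a + R) R" and "a4 = Complex (a - R) R"
    define \<gamma> where "\<gamma> = rectpath a1 a3"
    have \<gamma>_eq: "\<gamma> = linepath a1 a2 +++ linepath a2 a3 +++ linepath a3 a4 +++ linepath a4 a1"
      by (simp add: \<gamma>_def rectpath_def Let_def a1_def a2_def a3_def a4_def)
    have im: "path_image \<gamma> = {z. Re z \<in> {a - R, a + R} \<and> Im z \<in> {0..R}} \<union> {z. Im z \<in> {0, R} \<and> Re z \<in> {a - R..a + R}}"
      unfolding \<gamma>_def by (subst path_image_rectpath) (use R0 in \<open>auto simp: a1_def a3_def\<close>)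
    have imS: "path_image \<gamma> \<subseteq> S - {w}" using im R R0 Y \<delta> by (auto simp: S_def w_def)
    have wn: "winding_number \<gamma> w = 1" unfolding \<gamma>_def
      by (rule winding_number_rectpath) (use R R0 Y in \<open>auto simp: in_box_complex_iff a1_def a3_def w_def\<close>)
    have cl: "valid_path \<gamma>" "pathfinish \<gamma> = pathstart \<gamma>" by (auto simp: \<gamma>_def)
    have c1: "((\<lambda>z. f z / (z - w)) has_contour_integral (2 * of_real pi * \<i> * f w)) \<gamma>"
      using Cauchy_integral_formula_convex_simple[OF S(1) holS _ cl(1) imS cl(2)] wS S(2) wn
      by (simp add: interior_open)
    have c2: "((\<lambda>z. f z / (z - w')) has_contour_integral 0) \<gamma>"
      using S(1) cl imS w'S by (intro Cauchy_theorem_convex_simple[of _ S]) (auto intro!: holomorphic_intros holS)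
    have c: "(g has_contour_integral (2 * of_real pi * \<i> * f w)) \<gamma>"
      using has_contour_integral_diff[OF c1 c2] by (simp add: g_def[abs_def])
    have gcont: "continuous_on (S - {w}) g" unfolding g_def
      using w'S by (intro continuous_intros continuous_on_subset[OF holomorphic_on_imp_continuous_on[OF holS]]) auto
    have segS: "closed_segment a1 a2 \<subseteq> S - {w}" "closed_segment a2 a3 \<subseteq> S - {w}"
        "closed_segment a3 a4 \<subseteq> S - {w}" "closed_segment a4 a1 \<subseteq> S - {w}"
      using imS unfolding \<gamma>_eq by (auto simp: path_image_join)
    have gi: "g contour_integrable_on linepath a1 a2" "g contour_integrable_on linepath a2 a3"
      "g contour_integrable_on linepath a3 a4" "g contour_integrable_on linepath a4 a1"
      using segS by (auto intro!: contour_integrable_continuous_linepath continuous_on_subset[OF gcont])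
    have sum: "2 * of_real pi * \<i> * f w = contour_integral (linepath a1 a2) g + (contour_integral (linepath a2 a3) g +
       (contour_integral (linepath a3 a4) g + contour_integral (linepath a4 a1) g))"
      using contour_integral_unique[OF c] gi unfolding \<gamma>_eq
      by (subst (asm) contour_integral_join, simp_all)+
    have bottom: "contour_integral (linepath a1 a2) g = integral {a - R..a + R} (\<lambda>t. 2 * \<i> * (of_real (K t) * f (of_real t)))"
    proof -
      have "contour_integral (linepath a1 a2) g = integral {Re a1..Re a2} (\<lambda>t. g (of_real t))"
        by (rule contour_integral_linepath_Reals_eq) (use R0 in \<open>auto simp: a1_def a2_def complex_is_Real_iff\<close>)
      then show ?thesis by (simp add: a1_def a2_def g_real)
    qed
    have side: "cmod (contour_integral (linepath u v) g) \<le> (8 * Y / R\<^sup>2) * cmod (v - u)"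
      if gi: "g contour_integrable_on linepath u v"
        and sub: "\<And>z. z \<in> closed_segment u v \<Longrightarrow> Im z \<ge> 0 \<and> (Im z = R \<or> \<bar>Re z - a\<bar> = R)" for u v
    proof (rule has_contour_integral_bound_linepath[OF has_contour_integral_integral[OF gi]])
      show "0 \<le> 8 * Y / R\<^sup>2" using Y by simp
      fix z assume "z \<in> closed_segment u v"
      from sub[OF this] have z: "Im z \<ge> 0" "Im z = R \<or> \<bar>Re z - a\<bar> = R" by auto
      have big: "R / 2 \<le> cmod (z - w)" "R / 2 \<le> cmod (z - w')"
        using z(2) abs_Im_le_cmod[of "z - w"] abs_Re_le_cmod[of "z - w"] abs_Im_le_cmod[of "z - w'"] abs_Re_le_cmod[of "z - w'"] R R0 Y
        by (auto simp: w_def w'_def)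
      then have ne: "z \<noteq> w" "z \<noteq> w'" using R0 by auto
      have "cmod (g z) = cmod (f z) * (2 * Y) / (cmod (z - w) * cmod (z - w'))"
        unfolding g_eq[OF ne] using Y by (simp add: norm_divide norm_mult)
      also have "\<dots> \<le> 1 * (2 * Y) / (R / 2 * (R / 2))"
        using bd[OF z(1)] Y R0 big by (intro frac_le mult_right_mono mult_mono) auto
      also have "\<dots> = 8 * Y / R\<^sup>2" by (simp add: power2_eq_square)
      finally show "cmod (g z) \<le> 8 * Y / R\<^sup>2" .
    qed
    have s23: "cmod (contour_integral (linepath a2 a3) g) \<le> (8 * Y / R\<^sup>2) * cmod (a3 - a2)"
      by (rule side[OF gi(2)]) (use R0 in \<open>auto simp: a2_def a3_def closed_segment_same_Re closed_segment_eq_real_ivl\<close>)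
    have s34: "cmod (contour_integral (linepath a3 a4) g) \<le> (8 * Y / R\<^sup>2) * cmod (a4 - a3)"
      by (rule side[OF gi(3)]) (use R0 in \<open>auto simp: a4_def a3_def closed_segment_same_Im closed_segment_eq_real_ivl\<close>)
    have s41: "cmod (contour_integral (linepath a4 a1) g) \<le> (8 * Y / R\<^sup>2) * cmod (a1 - a4)"
      by (rule side[OF gi(4)]) (use R0 in \<open>auto simp: a1_def a4_def closed_segment_same_Re closed_segment_eq_real_ivl\<close>)
    have len: "cmod (a3 - a2) = R" "cmod (a4 - a3) = 2 * R" "cmod (a1 - a4) = R"
      using R0 by (auto simp: a1_def a2_def a3_def a4_def cmod_def real_sqrt_mult)
    have "cmod (2 * of_real pi * \<i> * f w - contour_integral (linepath a1 a2) g)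
      = cmod (contour_integral (linepath a2 a3) g + (contour_integral (linepath a3 a4) g + contour_integral (linepath a4 a1) g))"
      unfolding sum by simp
    also have "\<dots> \<le> cmod (contour_integral (linepath a2 a3) g) + (cmod (contour_integral (linepath a3 a4) g) + cmod (contour_integral (linepath a4 a1) g))"
      by (intro norm_triangle_le add_left_mono norm_triangle_ineq)
    also have "\<dots> \<le> (8 * Y / R\<^sup>2) * R + ((8 * Y / R\<^sup>2) * (2 * R) + (8 * Y / R\<^sup>2) * R)"
      using s23 s34 s41 unfolding len by linarith
    also have "\<dots> = 32 * Y / R" using R0 by (simp add: field_simps power2_eq_square)
    finally show ?thesis unfolding bottom .
  qed
  define X where "X n = 2 * Y + real n" for n
  have Xlim: "filterlim X at_top sequentially"
    unfolding X_def by (rule filterlim_tendsto_add_at_top[OF tendsto_const filterlim_real_sequentially])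
  have "(\<lambda>n. integral {a - X n..a + X n} (\<lambda>t. 2 * \<i> * (of_real (K t) * f (of_real t)))) \<longlonglongrightarrow> 2 * of_real pi * \<i> * f w"
  proof (rule LIM_zero_cancel, rule Lim_null_comparison)
    show "\<forall>\<^sub>F n in sequentially. norm (integral {a - X n..a + X n} (\<lambda>t. 2 * \<i> * (of_real (K t) * f (of_real t))) - 2 * of_real pi * \<i> * f w) \<le> 32 * Y / X n"
      using rect[of "X n" for n] by (intro always_eventually allI) (simp add: X_def norm_minus_commute)
    show "(\<lambda>n. 32 * Y / X n) \<longlonglongrightarrow> 0"
      by (rule real_tendsto_divide_at_top[OF tendsto_const Xlim])
  qed
  moreover have "(\<lambda>n. integral {a - X n..a + X n} (\<lambda>t. 2 * \<i> * (of_real (K t) * f (of_real t)))) \<longlonglongrightarrow> (\<integral>t. 2 * \<i> * (of_real (K t) * f (of_real t)) \<partial>lborel)"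
  proof -
    have int: "integrable lborel (\<lambda>t. 2 * \<i> * (of_real (K t) * f (of_real t)))"
      using Kf_int unfolding K_def[symmetric] by (rule integrable_mult_right)
    have eq: "integral {a - X n..a + X n} (\<lambda>t. 2 * \<i> * (of_real (K t) * f (of_real t)))
       = (\<integral>t. indicator {a - X n..a + X n} t *\<^sub>R (2 * \<i> * (of_real (K t) * f (of_real t))) \<partial>lborel)" for n
    proof -
      have "set_integrable lborel {a - X n..a + X n} (\<lambda>t. 2 * \<i> * (of_real (K t) * f (of_real t)))"
        unfolding set_integrable_def by (rule integrable_mult_indicator[OF _ int]) simp
      from set_borel_integral_eq_integral(2)[OF this] show ?thesis
        unfolding set_lebesgue_integral_def by (rule sym)
    qed
    show ?thesis unfolding eq
    proof (rule integral_dominated_convergence[where w = "\<lambda>t. 2 * K t"])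
      show "AE t in lborel. (\<lambda>n. indicator {a - X n..a + X n} t *\<^sub>R (2 * \<i> * (of_real (K t) * f (of_real t)))) \<longlonglongrightarrow> 2 * \<i> * (of_real (K t) * f (of_real t))"
      proof (rule AE_I2, rule tendsto_eventually)
        fix t
        have "\<forall>\<^sub>F n in sequentially. \<bar>t - a\<bar> \<le> X n" using Xlim unfolding filterlim_at_top by blast
        then show "\<forall>\<^sub>F n in sequentially. indicator {a - X n..a + X n} t *\<^sub>R (2 * \<i> * (of_real (K t) * f (of_real t))) = 2 * \<i> * (of_real (K t) * f (of_real t))"
          by eventually_elim (auto simp: indicator_def)
      qed
      show "integrable lborel (\<lambda>t. 2 * K t)" using K_int by simp
      show "AE t in lborel. norm (indicator {a - X n..a + X n} t *\<^sub>R (2 * \<i> * (of_real (K t) * f (of_real t)))) \<le> 2 * K t" for n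
        using Kf_bd K0 by (auto simp: indicator_def norm_mult)
    qed measurable
  qed
  ultimately have "2 * of_real pi * \<i> * f w = (\<integral>t. 2 * \<i> * (of_real (K t) * f (of_real t)) \<partial>lborel)"
    by (rule LIMSEQ_unique)
  also have "\<dots> = 2 * \<i> * (\<integral>t. of_real (K t) * f (of_real t) \<partial>lborel)" by (rule integral_mult_right_zero)
  finally show "(\<integral>t. of_real (Y / ((t - a)\<^sup>2 + Y\<^sup>2)) * f (of_real t) \<partial>lborel) = of_real pi * f (Complex a Y)"
    unfolding K_def[symmetric] w_def by simp
qed

text \<open>The Poisson formula on the lines Im z = y, with y tending to 0: where the boundary value is real the
contribution vanishes by dominated convergence, and on G the kernel is at most 1/Y.\<close>
lemma Im_bound_by_boundary:
  assumes hol: "f holomorphic_on {z. Im z > 0}" and bd: "\<And>z. Im z > 0 \<Longrightarrow> cmod (f z) \<le> 1"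
    and G: "G \<in> sets borel" "emeasure lborel G < \<infinity>"
    and bv: "AE t in lborel. t \<notin> G \<longrightarrow> ((\<lambda>y. Im (f (Complex t y))) \<longlongrightarrow> 0) (at_right 0)"
    and Y: "Y > 0"
  shows "\<bar>Im (f (Complex a Y))\<bar> \<le> measure lborel G / (pi * Y)"
proof -
  define K where "K t = Y / ((t - a)\<^sup>2 + Y\<^sup>2)" for t
  define y where "y n = inverse (real (Suc n))" for n
  have y0: "y n > 0" for n by (simp add: y_def)
  have ylim: "y \<longlonglongrightarrow> 0" unfolding y_def by (rule LIMSEQ_inverse_real_of_nat)
  have yright: "filterlim y (at_right 0) sequentially"
    using ylim by (rule tendsto_imp_filterlim_at_right) (simp add: y0)
  have Kpos: "(t - a)\<^sup>2 + Y\<^sup>2 > 0" for t using Y by (intro add_nonneg_pos) auto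
  have K_int: "integrable lborel K" using has_bochner_integral_poisson_kernel[OF Y, of a] unfolding K_def
    by (simp add: has_bochner_integral_iff)
  have [measurable]: "K \<in> borel_measurable borel" unfolding K_def by measurable
  note [measurable] = G(1)
  have K0: "0 \<le> K t" and KY: "K t \<le> 1 / Y" for t
  proof -
    show "0 \<le> K t" using Kpos[of t] Y by (simp add: K_def)
    have "K t \<le> Y / Y\<^sup>2" unfolding K_def using Y Kpos[of t] by (intro divide_left_mono) auto
    then show "K t \<le> 1 / Y" using Y by (simp add: power2_eq_square)
  qed
  have G_int: "integrable lborel (indicat_real G)" using G by (intro integrable_real_indicator) auto
  define u where "u n t = Im (f (Complex t (y n)))" for n t
  have u1: "\<bar>u n t\<bar> \<le> 1" for n t
    unfolding u_def using bd[of "Complex t (y n)"] y0[of n] abs_Im_le_cmod order_trans by fastforce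
  have u_meas [measurable]: "u n \<in> borel_measurable borel" for n
    unfolding u_def
    by (intro borel_measurable_continuous_onI continuous_intros continuous_on_compose2[OF holomorphic_on_imp_continuous_on[OF hol]])
      (use y0 in auto)
  have P: "pi * Im (f (Complex a (Y + y n))) = (\<integral>t. K t * u n t \<partial>lborel)" for n
  proof -
    define fn where "fn z = f (z + \<i> * of_real (y n))" for z
    have "fn holomorphic_on {z. Im z > - y n}"
      unfolding fn_def by (rule holomorphic_on_compose_gen[OF _ hol, unfolded o_def]) (auto intro!: holomorphic_intros)
    note pf = poisson_formula[OF this y0 Y, of a]
    have bd': "cmod (fn z) \<le> 1" if "Im z \<ge> 0" for z unfolding fn_def using that y0[of n] by (intro bd) auto
    have e1: "fn (of_real t) = f (Complex t (y n))" for t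
      unfolding fn_def by (rule arg_cong[where f = f]) (simp add: complex_eq_iff)
    have e2: "fn (Complex a Y) = f (Complex a (Y + y n))"
      unfolding fn_def by (rule arg_cong[where f = f]) (simp add: complex_eq_iff)
    have i: "integrable lborel (\<lambda>t. of_real (K t) * f (Complex t (y n)))"
      using pf(1)[OF bd'] unfolding K_def e1 .
    have "(\<integral>t. K t * u n t \<partial>lborel) = (\<integral>t. Im (of_real (K t) * f (Complex t (y n))) \<partial>lborel)"
      by (simp add: u_def)
    also have "\<dots> = Im (\<integral>t. of_real (K t) * f (Complex t (y n)) \<partial>lborel)" by (rule integral_Im[OF i])
    also have "(\<integral>t. of_real (K t) * f (Complex t (y n)) \<partial>lborel) = of_real pi * f (Complex a (Y + y n))"
      using pf(2)[OF bd'] unfolding K_def e1 e2 .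
    finally show ?thesis by simp
  qed
  have bound: "pi * \<bar>Im (f (Complex a (Y + y n)))\<bar> \<le> measure lborel G / Y + (\<integral>t. K t * (indicator (- G) t * \<bar>u n t\<bar>) \<partial>lborel)" for n
  proof -
    have i2: "integrable lborel (\<lambda>t. K t * (indicator (- G) t * \<bar>u n t\<bar>))"
    proof (rule Bochner_Integration.integrable_bound[OF K_int])
      show "AE t in lborel. norm (K t * (indicator (- G) t * \<bar>u n t\<bar>)) \<le> norm (K t)"
        using u1[of n] by (auto simp: abs_mult indicator_def intro!: mult_left_le)
    qed measurable
    have i1: "integrable lborel (\<lambda>t. K t * u n t)"
    proof (rule Bochner_Integration.integrable_bound[OF K_int])
      show "AE t in lborel. norm (K t * u n t) \<le> norm (K t)"
        using u1[of n] by (auto simp: abs_mult intro!: mult_left_le)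
    qed measurable
    have "pi * \<bar>Im (f (Complex a (Y + y n)))\<bar> = \<bar>\<integral>t. K t * u n t \<partial>lborel\<bar>"
      unfolding P[symmetric] by (simp add: abs_mult)
    also have "\<dots> \<le> (\<integral>t. \<bar>K t * u n t\<bar> \<partial>lborel)" by (rule integral_abs_bound)
    also have "\<dots> \<le> (\<integral>t. 1 / Y * indicator G t + K t * (indicator (- G) t * \<bar>u n t\<bar>) \<partial>lborel)"
    proof (rule integral_mono)
      fix t
      have "K t * \<bar>u n t\<bar> \<le> 1 / Y * 1" using u1[of n t] KY[of t] Y K0[of t] by (intro mult_mono) auto
      then show "\<bar>K t * u n t\<bar> \<le> 1 / Y * indicator G t + K t * (indicator (- G) t * \<bar>u n t\<bar>)"
        using K0[of t] by (auto simp: indicator_def abs_mult)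
    qed (use i1 i2 G_int in auto)
    also have "\<dots> = measure lborel G / Y + (\<integral>t. K t * (indicator (- G) t * \<bar>u n t\<bar>) \<partial>lborel)"
      using i2 G_int by simp
    finally show ?thesis .
  qed
  have lim0: "(\<lambda>n. \<integral>t. K t * (indicator (- G) t * \<bar>u n t\<bar>) \<partial>lborel) \<longlonglongrightarrow> integral\<^sup>L lborel (\<lambda>t::real. 0::real)"
  proof (rule integral_dominated_convergence[where w = K and s = "\<lambda>n t. K t * (indicator (- G) t * \<bar>u n t\<bar>)" and f = "\<lambda>t. 0" and M = lborel])
    show "AE t in lborel. (\<lambda>n. K t * (indicator (- G) t * \<bar>u n t\<bar>)) \<longlonglongrightarrow> 0" using bv
    proof eventually_elim
      case (elim t)
      show ?case
      proof (cases "t \<in> G")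
        case False
        with elim have "((\<lambda>y. Im (f (Complex t y))) \<longlongrightarrow> 0) (at_right 0)" by simp
        then have "(\<lambda>n. u n t) \<longlonglongrightarrow> 0" unfolding u_def by (rule filterlim_compose[OF _ yright])
        then have "(\<lambda>n. K t * (1 * \<bar>u n t\<bar>)) \<longlonglongrightarrow> K t * (1 * \<bar>0\<bar>)" by (intro tendsto_intros)
        then show ?thesis using False by simp
      qed simp
    qed
    show "AE t in lborel. norm (K t * (indicator (- G) t * \<bar>u n t\<bar>)) \<le> K t" for n
      using u1[of n] K0 by (auto simp: abs_mult indicator_def intro!: mult_left_le)
  qed (use K_int in auto)
  have "(\<lambda>n. pi * \<bar>Im (f (Complex a (Y + y n)))\<bar>) \<longlonglongrightarrow> pi * \<bar>Im (f (Complex a (Y + 0)))\<bar>"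
  proof (intro tendsto_intros)
    have "isCont f (Complex a (Y + 0))"
      using holomorphic_on_imp_continuous_on[OF hol] Y
      by (subst (asm) continuous_on_eq_continuous_at) (auto simp: open_halfspace_Im_gt)
    then show "(\<lambda>n. f (Complex a (Y + y n))) \<longlonglongrightarrow> f (Complex a (Y + 0))"
      by (rule isCont_tendsto_compose) (intro tendsto_Complex tendsto_intros ylim)
  qed
  moreover have "(\<lambda>n. measure lborel G / Y + (\<integral>t. K t * (indicator (- G) t * \<bar>u n t\<bar>) \<partial>lborel)) \<longlonglongrightarrow> measure lborel G / Y + 0"
    using lim0 by (intro tendsto_intros) simp
  ultimately have "pi * \<bar>Im (f (Complex a (Y + 0)))\<bar> \<le> measure lborel G / Y + 0"
    by (rule LIMSEQ_le) (use bound in blast)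
  then show ?thesis using Y by (simp add: field_simps)
qed

section \<open>Convergence to the arcsine distribution\<close>

lemma prob_measure_on_real_distribution:
  assumes "prob_measure_on K \<mu>"
  shows "real_distribution \<mu>"
  using prob_measure_onD[OF assms] by (simp add: real_distribution_def real_distribution_axioms_def)

lemma real_distribution_prob_measure_on:
  assumes "real_distribution \<mu>"
  shows "prob_measure_on UNIV \<mu>"
proof -
  interpret real_distribution \<mu> by fact
  show ?thesis unfolding prob_measure_on_def by (auto simp: prob_space_axioms)
qed

text \<open>By the Poisson formula for the bounded function exp(i x z), integrating it against the Poisson kernel
Im (1/(t - s - i)) reproduces it up to the factor exp(-x).\<close>
lemma char_via_cauchy:
  assumes \<mu>: "prob_measure_on K \<mu>" and x: "x \<ge> 0"
  shows "(\<integral>s. iexp (x * s) * of_real (Im (cauchy \<mu> (Complex s 1))) \<partial>lborel) = of_real (pi * exp (- x)) * char \<mu> x"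
proof -
  note [measurable_cong] = prob_measure_onD(1)[OF \<mu>]
  interpret M: prob_space \<mu> using prob_measure_onD(2)[OF \<mu>] .
  interpret P: pair_sigma_finite \<mu> lborel ..
  define k where "k t s = 1 / ((s - t)\<^sup>2 + 1\<^sup>2)" for t s :: real
  have [measurable]: "case_prod k \<in> borel_measurable (borel \<Otimes>\<^sub>M borel)" unfolding k_def by measurable
  have k: "has_bochner_integral lborel (k t) pi" for t
    unfolding k_def by (rule has_bochner_integral_poisson_kernel) simp
  have k0: "0 \<le> k t s" for t s by (simp add: k_def)
  have Imk: "Im (1 / (of_real t - Complex s 1)) = k t s" for t s
    by (simp add: k_def Im_divide power2_commute)
  define \<Phi> where "\<Phi> t s = iexp (x * s) * of_real (k t s)" for t s
  have [measurable]: "case_prod \<Phi> \<in> borel_measurable (borel \<Otimes>\<^sub>M borel)" unfolding \<Phi>_def by measurable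
  have n\<Phi>: "norm (\<Phi> t s) = k t s" for t s using k0[of t s] by (simp add: \<Phi>_def norm_mult)
  have int: "integrable (\<mu> \<Otimes>\<^sub>M lborel) (case_prod \<Phi>)"
  proof (rule P.Fubini_integrable)
    have "(\<integral>s. norm (\<Phi> t s) \<partial>lborel) = pi" for t using k[of t] unfolding n\<Phi> by (simp add: has_bochner_integral_iff)
    then show "integrable \<mu> (\<lambda>t. \<integral>s. norm (case (t, s) of (t, s) \<Rightarrow> \<Phi> t s) \<partial>lborel)" by simp
    show "AE t in \<mu>. integrable lborel (\<lambda>s. case (t, s) of (t, s) \<Rightarrow> \<Phi> t s)"
    proof (rule AE_I2)
      fix t
      have "integrable lborel (\<Phi> t)"
      proof (rule Bochner_Integration.integrable_bound)
        show "integrable lborel (k t)" using k[of t] by (simp add: has_bochner_integral_iff)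
        show "AE s in lborel. norm (\<Phi> t s) \<le> norm (k t s)" using k0 by (simp add: n\<Phi>)
      qed measurable
      then show "integrable lborel (\<lambda>s. case (t, s) of (t, s) \<Rightarrow> \<Phi> t s)" by simp
    qed
  qed measurable
  have "(\<integral>s. iexp (x * s) * of_real (Im (cauchy \<mu> (Complex s 1))) \<partial>lborel) = (\<integral>s. \<integral>t. \<Phi> t s \<partial>\<mu> \<partial>lborel)"
  proof (rule Bochner_Integration.integral_cong[OF refl])
    fix s
    have "Im (cauchy \<mu> (Complex s 1)) = (\<integral>t. k t s \<partial>\<mu>)"
      unfolding cauchy_def Imk[symmetric]
      by (rule integral_Im[symmetric, OF integrable_cauchy[OF \<mu> apart_Im]]) simp
    then show "iexp (x * s) * of_real (Im (cauchy \<mu> (Complex s 1))) = (\<integral>t. \<Phi> t s \<partial>\<mu>)"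
      unfolding \<Phi>_def by (simp add: integral_complex_of_real)
  qed
  also have "\<dots> = (\<integral>t. \<integral>s. \<Phi> t s \<partial>lborel \<partial>\<mu>)" by (rule P.Fubini_integral[OF int])
  also have "\<dots> = (\<integral>t. of_real (pi * exp (- x)) * iexp (x * t) \<partial>\<mu>)"
  proof (rule Bochner_Integration.integral_cong[OF refl])
    fix t
    have "(\<integral>s. of_real (1 / ((s - t)\<^sup>2 + 1\<^sup>2)) * exp (\<i> * of_real x * of_real s) \<partial>lborel) = of_real pi * exp (\<i> * of_real x * Complex t 1)"
      by (rule poisson_formula(2)[where \<delta> = 1]) (use x in \<open>auto intro!: holomorphic_intros\<close>)
    also have "exp (\<i> * of_real x * Complex t 1) = of_real (exp (- x)) * iexp (x * t)"
    proof -
      have "\<i> * of_real x * Complex t 1 = of_real (- x) + \<i> * of_real (x * t)" by (simp add: complex_eq_iff)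
      then show ?thesis by (simp only: exp_add exp_of_real)
    qed
    finally show "(\<integral>s. \<Phi> t s \<partial>lborel) = of_real (pi * exp (- x)) * iexp (x * t)"
      unfolding \<Phi>_def k_def by (simp add: mult_ac)
  qed
  also have "\<dots> = of_real (pi * exp (- x)) * char \<mu> x"
    unfolding char_def by (rule integral_mult_right_zero)
  finally show ?thesis .
qed

lemma char_uminus: "char \<mu> (- x) = cnj (char \<mu> x)"
proof -
  have "(\<integral>t. iexp (- x * t) \<partial>\<mu>) = (\<integral>t. cnj (iexp (x * t)) \<partial>\<mu>)"
    by (rule Bochner_Integration.integral_cong) (simp_all add: exp_cnj)
  then show ?thesis unfolding char_def by simp
qed

lemma cauchy_determines_measure:
  assumes \<mu>: "prob_measure_on K \<mu>" and \<nu>: "prob_measure_on L \<nu>"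
    and eq: "\<And>z. Im z > 0 \<Longrightarrow> cauchy \<mu> z = cauchy \<nu> z"
  shows "\<mu> = \<nu>"
proof (rule Levy_uniqueness)
  have nonneg: "char \<mu> x = char \<nu> x" if x: "x \<ge> 0" for x
  proof -
    have "complex_of_real (pi * exp (- x)) * char \<mu> x = of_real (pi * exp (- x)) * char \<nu> x"
      unfolding char_via_cauchy[OF \<mu> x, symmetric] char_via_cauchy[OF \<nu> x, symmetric]
      by (simp add: eq)
    then show ?thesis by simp
  qed
  show "char \<mu> = char \<nu>"
  proof
    fix x show "char \<mu> x = char \<nu> x"
      using nonneg[of x] nonneg[of "- x"] char_uminus[of \<mu> "- x"] char_uminus[of \<nu> "- x"]
      by (cases "x \<ge> 0") auto
  qed
qed (use prob_measure_on_real_distribution[OF \<mu>] prob_measure_on_real_distribution[OF \<nu>] in auto)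

text \<open>This normalisation fixes the constant factor in the comparison of two Cauchy transforms.\<close>
lemma cauchy_at_infinity:
  assumes \<mu>: "prob_measure_on K \<mu>"
  shows "(\<lambda>n. \<i> * of_nat n * cauchy \<mu> (\<i> * of_nat n)) \<longlonglongrightarrow> -1"
proof -
  note [measurable_cong] = prob_measure_onD(1)[OF \<mu>]
  interpret prob_space \<mu> using prob_measure_onD(2)[OF \<mu>] .
  have "(\<lambda>n. \<integral>t. \<i> * of_nat n * (1 / (of_real t - \<i> * of_nat n)) \<partial>\<mu>) \<longlonglongrightarrow> (\<integral>t. (-1::complex) \<partial>\<mu>)"
  proof (rule integral_dominated_convergence[where w = "\<lambda>_. 1"])
    show "AE t in \<mu>. (\<lambda>n. \<i> * of_nat n * (1 / (of_real t - \<i> * of_nat n))) \<longlonglongrightarrow> (-1::complex)"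
    proof (rule AE_I2)
      fix t
      have "(\<lambda>n. \<i> / (of_real t * of_real (1 / real n) - \<i>)) \<longlonglongrightarrow> \<i> / (of_real t * of_real 0 - \<i>)"
        by (intro tendsto_intros lim_const_over_n) auto
      moreover have "\<forall>\<^sub>F n in sequentially. \<i> / (of_real t * of_real (1 / real n) - \<i>) = \<i> * of_nat n * (1 / (of_real t - \<i> * of_nat n))"
        using eventually_gt_at_top[of 0]
      proof eventually_elim
        case (elim n)
        have "of_real t * of_real (1 / real n) - \<i> = (of_real t - \<i> * of_nat n) / of_nat n"
          using elim by (simp add: diff_divide_distrib)
        then show ?case by simp
      qed
      ultimately show "(\<lambda>n. \<i> * of_nat n * (1 / (of_real t - \<i> * of_nat n))) \<longlonglongrightarrow> (-1::complex)"
        by (rule Lim_transform_eventually[THEN tendsto_eq_rhs]) (simp add: divide_minus_right)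
    qed
    show "AE t in \<mu>. norm (\<i> * of_nat n * (1 / (of_real t - \<i> * of_nat n))) \<le> 1" for n
    proof (rule AE_I2)
      fix t
      have "real n \<le> cmod (of_real t - \<i> * of_nat n)"
        using abs_Im_le_cmod[of "of_real t - \<i> * of_nat n"] by simp
      then show "norm (\<i> * of_nat n * (1 / (of_real t - \<i> * of_nat n))) \<le> 1"
        by (simp add: norm_mult norm_divide divide_le_eq)
    qed
  qed auto
  then show ?thesis unfolding cauchy_def
    by (simp only: integral_mult_right_zero) (simp add: prob_space)
qed

lemma real_valued_holomorphic_constant:
  assumes "f holomorphic_on S" "open S" "connected S" "\<And>z. z \<in> S \<Longrightarrow> Im (f z) = 0"
  shows "f constant_on S"
proof (rule ccontr)
  assume "\<not> f constant_on S"
  then have "open (f ` S)" "S \<noteq> {}"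
    using open_mapping_thm[OF assms(1,2,3,2)] by (auto simp: constant_on_def)
  then obtain z where "z \<in> S" by auto
  with \<open>open (f ` S)\<close> obtain e where e: "z \<in> S" "e > 0" "ball (f z) e \<subseteq> f ` S"
    unfolding open_contains_ball by (metis imageI)
  have "f z + \<i> * of_real (e/2) \<in> ball (f z) e" using e(2) by (simp add: dist_norm norm_mult)
  with e(3) obtain u where "u \<in> S" "f u = f z + \<i> * of_real (e/2)" by (metis imageE subsetD)
  then have "Im (f z + \<i> * of_real (e/2)) = 0" using assms(4) by metis
  with assms(4)[OF e(1)] e(2) show False by simp
qed

lemma rcauchy_sign:
  assumes "prob_measure_on K \<mu>" "K \<subseteq> {p..r}"
  shows "t < p \<Longrightarrow> 0 \<le> rcauchy \<mu> t" "r < t \<Longrightarrow> rcauchy \<mu> t \<le> 0"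
proof -
  show "0 \<le> rcauchy \<mu> t" if "t < p"
    unfolding rcauchy_def
  proof (rule integral_nonneg_AE)
    show "AE s in \<mu>. 0 \<le> 1 / (s - t)" using prob_measure_onD(3)[OF assms(1)]
      by eventually_elim (use assms(2) that in auto)
  qed
  have "0 \<le> - rcauchy \<mu> t" if "r < t"
    unfolding rcauchy_def Bochner_Integration.integral_minus[symmetric]
  proof (rule integral_nonneg_AE)
    show "AE s in \<mu>. 0 \<le> - (1 / (s - t))" using prob_measure_onD(3)[OF assms(1)]
    proof eventually_elim
      case (elim s)
      then have "s - t \<le> 0" using assms(2) that by auto
      then show ?case by (simp add: divide_nonneg_nonpos)
    qed
  qed
  then show "rcauchy \<mu> t \<le> 0" if "r < t" using that by simp
qed

text \<open>In the upper half-plane this is the quotient of the Cauchy transforms of the measure and of the arcsine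
distribution of (p, r).\<close>
definition arcsine_ratio :: "real \<Rightarrow> real \<Rightarrow> real measure \<Rightarrow> complex \<Rightarrow> complex" where
  "arcsine_ratio p r \<mu> z = - (cauchy \<mu> z * (csqrt (z - of_real p) * csqrt (z - of_real r)))"

text \<open>The square root takes the plane without the negative half-line to the right half-plane, and the Cayley
transform takes this to the unit disc.  Nonnegative reals are mapped to reals, and so is the
limit q = 0, so the boundary values are real also where the quotient vanishes.\<close>
definition cayley_sqrt :: "complex \<Rightarrow> complex" where
  "cayley_sqrt q = (csqrt q - 1) / (csqrt q + 1)"

lemma Re_csqrt_pos: "q \<notin> \<real>\<^sub>\<le>\<^sub>0 \<Longrightarrow> 0 < Re (csqrt q)"
proof -
  assume q: "q \<notin> \<real>\<^sub>\<le>\<^sub>0"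
  have "Re (csqrt q) \<noteq> 0"
  proof
    assume *: "Re (csqrt q) = 0"
    then obtain v where "csqrt q = \<i> * of_real v" by (metis complex_eq mult.commute of_real_0 add_0)
    then have "q = (\<i> * of_real v)\<^sup>2" using power2_csqrt[of q] by simp
    also have "\<dots> = of_real (- (v\<^sup>2))" by (simp add: power_mult_distrib)
    finally have "q = of_real (- (v\<^sup>2))" .
    then show False using q by (metis complex_nonpos_Reals_iff Im_complex_of_real Re_complex_of_real neg_le_0_iff_le zero_le_power2)
  qed
  then show ?thesis using csqrt_principal[of q] by auto
qed

lemma cayley_sqrt_bound:
  assumes "0 \<le> Re (csqrt q)"
  shows "csqrt q + 1 \<noteq> 0" "cmod (cayley_sqrt q) \<le> 1"
proof -
  show ne: "csqrt q + 1 \<noteq> 0"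
  proof
    assume "csqrt q + 1 = 0"
    then have "Re (csqrt q + 1) = Re 0" by (rule arg_cong)
    then have "Re (csqrt q) + 1 = 0" by (simp only: plus_complex.sel one_complex.sel zero_complex.sel)
    then show False using assms by linarith
  qed
  have "(cmod (s - 1))\<^sup>2 \<le> (cmod (s + 1))\<^sup>2" if "0 \<le> Re s" for s
    unfolding cmod_power2 using that by (simp add: power2_eq_square algebra_simps)
  from this[OF assms] have "(cmod (csqrt q - 1))\<^sup>2 \<le> (cmod (csqrt q + 1))\<^sup>2" .
  then have "cmod (csqrt q - 1) \<le> cmod (csqrt q + 1)" by (rule power2_le_imp_le) simp
  then show "cmod (cayley_sqrt q) \<le> 1" using ne by (simp add: cayley_sqrt_def norm_divide divide_le_eq)
qed

lemma cayley_sqrt_inverse: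
  assumes "csqrt q + 1 \<noteq> 0"
  shows "q = ((1 + cayley_sqrt q) / (1 - cayley_sqrt q))\<^sup>2"
proof -
  have "1 + cayley_sqrt q = 2 * csqrt q / (csqrt q + 1)" "1 - cayley_sqrt q = 2 / (csqrt q + 1)"
    using assms unfolding cayley_sqrt_def by (simp_all add: divide_simps)
  then show ?thesis using assms by simp
qed

lemma tendsto_csqrt_nonneg_real:
  assumes "(f \<longlongrightarrow> of_real x) F" "x \<ge> 0"
  shows "((\<lambda>y. csqrt (f y)) \<longlongrightarrow> of_real (sqrt x)) F"
proof (cases "x = 0")
  case True
  have "((\<lambda>y. sqrt (cmod (f y))) \<longlongrightarrow> sqrt (cmod (of_real x))) F"
    using assms(1) by (intro tendsto_intros)
  then have "((\<lambda>y. cmod (csqrt (f y))) \<longlongrightarrow> sqrt (cmod (of_real x))) F"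
    by (simp only: norm_csqrt)
  then have "((\<lambda>y. csqrt (f y)) \<longlongrightarrow> 0) F"
    unfolding True of_real_0 norm_zero real_sqrt_zero by (rule tendsto_norm_zero_cancel)
  then show ?thesis unfolding True of_real_0 real_sqrt_zero .
next
  case False
  then have "complex_of_real x \<notin> \<real>\<^sub>\<le>\<^sub>0" using assms(2) by (simp add: complex_nonpos_Reals_iff)
  then have "((\<lambda>y. csqrt (f y)) \<longlongrightarrow> csqrt (of_real x)) F"
    by (rule isCont_tendsto_compose[OF continuous_at_csqrt assms(1)])
  then show ?thesis using assms(2) by (simp add: csqrt_of_real)
qed

lemma cayley_sqrt_boundary:
  assumes "(f \<longlongrightarrow> of_real x) F" "x \<ge> 0"
  shows "((\<lambda>y. Im (cayley_sqrt (f y))) \<longlongrightarrow> 0) F"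
proof -
  have "(of_real (sqrt x) + 1 :: complex) = of_real (sqrt x + 1)" by simp
  moreover have "sqrt x + 1 \<noteq> 0" using assms(2) by (smt (verit) real_sqrt_ge_zero)
  ultimately have ne: "(of_real (sqrt x) + 1 :: complex) \<noteq> 0" by (metis of_real_eq_0_iff)
  have "((\<lambda>y. Im (cayley_sqrt (f y))) \<longlongrightarrow> Im ((of_real (sqrt x) - 1) / (of_real (sqrt x) + 1))) F"
    unfolding cayley_sqrt_def using ne by (intro tendsto_intros tendsto_csqrt_nonneg_real[OF assms])
  also have "(of_real (sqrt x) - 1) / (of_real (sqrt x) + 1) = complex_of_real ((sqrt x - 1) / (sqrt x + 1))" by simp
  finally show ?thesis by (simp only: Im_complex_of_real)
qed

text \<open>Both Cauchy transforms have positive imaginary part, so neither is a nonpositive multiple of the other.\<close>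
lemma arcsine_ratio_upper:
  assumes \<mu>: "prob_measure_on K \<mu>" and pr: "p < r" and z: "Im z > 0"
  shows "cauchy \<mu> z = arcsine_ratio p r \<mu> z * cauchy (arcsine p r) z" "arcsine_ratio p r \<mu> z \<notin> \<real>\<^sub>\<le>\<^sub>0"
proof -
  have "z - of_real p \<noteq> 0" "z - of_real r \<noteq> 0" using z by auto
  then show *: "cauchy \<mu> z = arcsine_ratio p r \<mu> z * cauchy (arcsine p r) z"
    by (simp add: cauchy_arcsine[OF pr z] arcsine_ratio_def)
  show "arcsine_ratio p r \<mu> z \<notin> \<real>\<^sub>\<le>\<^sub>0"
  proof
    assume "arcsine_ratio p r \<mu> z \<in> \<real>\<^sub>\<le>\<^sub>0"
    then have "Im (arcsine_ratio p r \<mu> z) = 0" "Re (arcsine_ratio p r \<mu> z) \<le> 0" by (auto simp: complex_nonpos_Reals_iff)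
    then have "Im (cauchy \<mu> z) \<le> 0"
      using Im_cauchy_pos[OF prob_measure_on_arcsine[OF pr] z] unfolding * by (simp add: mult_nonpos_nonneg)
    then show False using Im_cauchy_pos[OF \<mu> z] by simp
  qed
qed

text \<open>Inside the interval both boundary values lie on the positive imaginary axis; outside they are real with
the same sign.\<close>
lemma arcsine_ratio_boundary:
  assumes \<mu>: "prob_measure_on K \<mu>" and pr: "p < r" and K: "K \<subseteq> {p..r}"
    and t: "t \<notin> {p..r} \<or> (t \<in> {p<..<r} \<and> imaginary_boundary_value \<mu> t)"
  obtains x where "x \<ge> 0" "((\<lambda>y. arcsine_ratio p r \<mu> (Complex t y)) \<longlongrightarrow> of_real x) (at_right 0)"
proof -
  have eq: "\<forall>\<^sub>F y in at_right 0. cauchy \<mu> (Complex t y) / cauchy (arcsine p r) (Complex t y) = arcsine_ratio p r \<mu> (Complex t y)"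
    unfolding eventually_at_filter
  proof (intro always_eventually allI impI)
    fix y :: real assume "y \<in> {0<..}"
    then have z: "Im (Complex t y) > 0" by simp
    have "cauchy (arcsine p r) (Complex t y) \<noteq> 0"
      using Im_cauchy_pos[OF prob_measure_on_arcsine[OF pr] z] by force
    then show "cauchy \<mu> (Complex t y) / cauchy (arcsine p r) (Complex t y) = arcsine_ratio p r \<mu> (Complex t y)"
      using arcsine_ratio_upper(1)[OF \<mu> pr z] by (simp add: nonzero_divide_eq_eq)
  qed
  from t show ?thesis
  proof
    assume t: "t \<notin> {p..r}"
    have "apart {p..r} (of_real t)" using t by (intro apart_closed) auto
    then have o: "apart K (of_real t)" "apart {p<..<r} (of_real t)" using K by (auto elim!: apart_mono)
    define A where "A = rcauchy (arcsine p r) t"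
    have pos: "(p - t) * (r - t) > 0" using t pr by (auto simp: zero_less_mult_iff not_le)
    have A: "A = (if t < p then 1 else -1) / sqrt ((p - t) * (r - t))" unfolding A_def by (rule rcauchy_arcsine(2)[OF pr t])
    have "p - t \<noteq> 0" "r - t \<noteq> 0" using pos by auto
    then have A0: "A \<noteq> 0" by (simp add: A)
    have "((\<lambda>y. cauchy \<mu> (Complex t y) / cauchy (arcsine p r) (Complex t y)) \<longlongrightarrow> of_real (rcauchy \<mu> t) / of_real A) (at_right 0)"
      unfolding A_def
      by (intro tendsto_divide cauchy_boundary_real[OF \<mu> o(1)] cauchy_boundary_real[OF prob_measure_on_arcsine[OF pr] o(2)])
        (use A0 in \<open>simp add: A_def\<close>)
    then have "((\<lambda>y. arcsine_ratio p r \<mu> (Complex t y)) \<longlongrightarrow> of_real (rcauchy \<mu> t / A)) (at_right 0)"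
      using Lim_transform_eventually[OF _ eq] by simp
    moreover have "rcauchy \<mu> t / A \<ge> 0"
    proof (cases "t < p")
      case True
      then show ?thesis using rcauchy_sign(1)[OF \<mu> K True] pos unfolding A by simp
    next
      case False
      then have "r < t" using t by auto
      then show ?thesis using rcauchy_sign(2)[OF \<mu> K] pos False unfolding A
        by (intro divide_nonpos_nonpos) auto
    qed
    ultimately show ?thesis using that by blast
  next
    assume t: "t \<in> {p<..<r} \<and> imaginary_boundary_value \<mu> t"
    then obtain w where w: "((\<lambda>y. cauchy \<mu> (Complex t y)) \<longlongrightarrow> w) (at_right 0)" "Re w = 0" by (auto simp: imaginary_boundary_value_def)
    define h where "h = sqrt ((t - p) * (r - t))"
    have h: "h > 0" using t by (simp add: h_def)
    have "0 \<le> Im w"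
    proof (rule tendsto_lowerbound[OF tendsto_Im[OF w(1)]])
      show "\<forall>\<^sub>F y in at_right 0. 0 \<le> Im (cauchy \<mu> (Complex t y))"
        unfolding eventually_at_filter
        by (intro always_eventually allI impI less_imp_le Im_cauchy_pos[OF \<mu>]) simp
    qed simp
    have "((\<lambda>y. cauchy \<mu> (Complex t y) / cauchy (arcsine p r) (Complex t y)) \<longlongrightarrow> w / (\<i> / of_real h)) (at_right 0)"
      unfolding h_def by (intro tendsto_divide w(1) cauchy_arcsine_boundary[OF pr]) (use t h in \<open>auto simp: h_def\<close>)
    moreover have "w / (\<i> / of_real h) = of_real (Im w * h)" using w(2) h by (simp add: complex_eq_iff)
    ultimately have "((\<lambda>y. arcsine_ratio p r \<mu> (Complex t y)) \<longlongrightarrow> of_real (Im w * h)) (at_right 0)"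
      using Lim_transform_eventually[OF _ eq] by simp
    then show ?thesis using that[of "Im w * h"] h \<open>0 \<le> Im w\<close> by simp
  qed
qed

lemma holomorphic_cayley_ratio:
  assumes \<mu>: "prob_measure_on K \<mu>" and pr: "p < r"
  shows "(\<lambda>z. cayley_sqrt (arcsine_ratio p r \<mu> z)) holomorphic_on {z. Im z > 0}"
proof -
  have c: "cauchy \<mu> holomorphic_on {z. Im z > 0}" by (rule holomorphic_cauchy[OF \<mu> apart_Im]) auto
  have n: "z - of_real u \<notin> \<real>\<^sub>\<le>\<^sub>0" if "Im z > 0" for z u using that by (auto simp: complex_nonpos_Reals_iff)
  have a: "arcsine_ratio p r \<mu> holomorphic_on {z. Im z > 0}"
    unfolding arcsine_ratio_def using n by (intro holomorphic_intros c) auto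
  have s: "(\<lambda>z. csqrt (arcsine_ratio p r \<mu> z)) holomorphic_on {z. Im z > 0}"
    using arcsine_ratio_upper(2)[OF \<mu> pr] by (intro holomorphic_intros a) auto
  show ?thesis unfolding cayley_sqrt_def
    using cayley_sqrt_bound(1) Re_csqrt_pos[OF arcsine_ratio_upper(2)[OF \<mu> pr]]
    by (intro holomorphic_intros s) (auto simp: less_imp_le)
qed

text \<open>A quantitative form of uniqueness: the quotient is nearly a positive constant if the set on which the measure is
reflectionless nearly exhausts the interval.\<close>
lemma Im_cayley_ratio_bound:
  assumes \<mu>: "\<mu> \<in> reflectionless_measures K" and K: "K \<in> sets borel" "K \<subseteq> {p..r}" and pr: "p < r" and z: "Im z > 0"
  shows "\<bar>Im (cayley_sqrt (arcsine_ratio p r \<mu> z))\<bar> \<le> measure lborel ({p..r} - K) / (pi * Im z)"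
proof -
  from \<mu> have m: "prob_measure_on K \<mu>" and bv: "AE x in lborel. x \<in> K \<longrightarrow> imaginary_boundary_value \<mu> x"
    unfolding reflectionless_measures_iff[OF K(1)] by auto
  have "\<bar>Im (cayley_sqrt (arcsine_ratio p r \<mu> (Complex (Re z) (Im z))))\<bar> \<le> measure lborel ({p..r} - K) / (pi * Im z)"
  proof (rule Im_bound_by_boundary[OF holomorphic_cayley_ratio[OF m pr] _ _ _ _ z])
    show "cmod (cayley_sqrt (arcsine_ratio p r \<mu> z)) \<le> 1" if "Im z > 0" for z
      using Re_csqrt_pos[OF arcsine_ratio_upper(2)[OF m pr that]] by (intro cayley_sqrt_bound) simp
    show "{p..r} - K \<in> sets borel" using K by auto
    have "emeasure lborel ({p..r} - K) \<le> emeasure lborel {p..r}" by (rule emeasure_mono) auto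
    also have "\<dots> < \<infinity>" by (simp add: emeasure_lborel_Icc_eq)
    finally show "emeasure lborel ({p..r} - K) < \<infinity>" .
    have "AE t in lborel. t \<noteq> p" "AE t in lborel. t \<noteq> r" by (rule AE_lborel_singleton)+
    with bv show "AE t in lborel. t \<notin> {p..r} - K \<longrightarrow> ((\<lambda>y. Im (cayley_sqrt (arcsine_ratio p r \<mu> (Complex t y)))) \<longlongrightarrow> 0) (at_right 0)"
    proof eventually_elim
      case (elim t)
      show ?case
      proof
        assume "t \<notin> {p..r} - K"
        then have "t \<notin> {p..r} \<or> (t \<in> {p<..<r} \<and> imaginary_boundary_value \<mu> t)" using elim by auto
        from arcsine_ratio_boundary[OF m pr K(2) this] obtain x where
          "x \<ge> 0" "((\<lambda>y. arcsine_ratio p r \<mu> (Complex t y)) \<longlongrightarrow> of_real x) (at_right 0)" .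
        then show "((\<lambda>y. Im (cayley_sqrt (arcsine_ratio p r \<mu> (Complex t y)))) \<longlongrightarrow> 0) (at_right 0)"
          by (intro cayley_sqrt_boundary)
      qed
    qed
  qed
  then show ?thesis by simp
qed

lemma weak_conv_cauchy:
  assumes "\<And>n. prob_measure_on (K n) (\<omega> n)" "real_distribution \<nu>" "weak_conv_m \<omega> \<nu>" "Im z > 0"
  shows "(\<lambda>n. cauchy (\<omega> n) z) \<longlonglongrightarrow> cauchy \<nu> z"
  unfolding cauchy_def
proof (rule weak_conv_imp_integral_bdd_continuous_conv[OF _ assms(2,3)])
  show "real_distribution (\<omega> n)" for n using prob_measure_on_real_distribution[OF assms(1)] .
  have ne: "of_real t - z \<noteq> 0" for t using assms(4) by auto
  show "isCont (\<lambda>t. 1 / (of_real t - z)) t" for t using ne by (intro continuous_intros) auto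
  show "cmod (1 / (of_real t - z)) \<le> 1 / Im z" for t
    using abs_Im_le_cmod[of "of_real t - z"] assms(4) by (auto simp: norm_divide intro!: divide_left_mono mult_pos_pos ne)
qed

text \<open>For a weak limit of a subsequence the bounded function of the quotient is real, hence constant, and
comparing the behaviour at infinity shows that the constant quotient is 1.\<close>
lemma reflectionless_limit:
  assumes pr: "p < r" and \<omega>: "\<And>n. \<omega> n \<in> reflectionless_measures (K n)"
    and K: "\<And>n. K n \<in> sets borel" "\<And>n. K n \<subseteq> {p..r}"
    and lim: "(\<lambda>n. measure lborel ({p..r} - K n)) \<longlonglongrightarrow> 0"
  shows "weak_conv_m \<omega> (arcsine p r)"
proof (rule tight_subseq_weak_converge)
  have m: "prob_measure_on (K n) (\<omega> n)" for n using \<omega> unfolding reflectionless_measures_def by auto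
  note A = prob_measure_on_arcsine[OF pr]
  show rd: "real_distribution (\<omega> n)" for n using prob_measure_on_real_distribution[OF m] .
  show "real_distribution (arcsine p r)" using prob_measure_on_real_distribution[OF A] .
  \<comment> \<open>All measures live on the same bounded interval.\<close>
  show "tight \<omega>" unfolding tight_def
  proof (intro conjI allI impI rd)
    fix \<epsilon> :: real assume \<epsilon>: "\<epsilon> > 0"
    have "measure (\<omega> n) {p - 1<..r} = 1" for n
    proof -
      interpret prob_space "\<omega> n" using prob_measure_onD(2)[OF m] .
      show ?thesis
      proof (subst prob_eq_1)
        show "{p - 1<..r} \<in> sets (\<omega> n)" using prob_measure_onD(1)[OF m[of n]] by simp
        show "AE x in \<omega> n. x \<in> {p - 1<..r}" using prob_measure_onD(3)[OF m[of n]]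
          by eventually_elim (use K(2) in fastforce)
      qed
    qed
    then show "\<exists>a b. a < b \<and> (\<forall>n. 1 - \<epsilon> < measure (\<omega> n) {a<..b})"
      using \<epsilon> pr by (intro exI[of _ "p - 1"] exI[of _ r]) auto
  qed
  fix s :: "nat \<Rightarrow> nat" and \<nu>
  assume s: "strict_mono s" and \<nu>: "real_distribution \<nu>" and conv: "weak_conv_m (\<omega> \<circ> s) \<nu>"
  note \<nu>m = real_distribution_prob_measure_on[OF \<nu>]
  have cl: "(\<lambda>n. cauchy (\<omega> (s n)) z) \<longlonglongrightarrow> cauchy \<nu> z" if "Im z > 0" for z
    using weak_conv_cauchy[OF _ \<nu> conv that, of "\<lambda>n. K (s n)"] m by (simp add: comp_def)
  let ?F = "\<lambda>\<mu> z. cayley_sqrt (arcsine_ratio p r \<mu> z)"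
  have Im0: "Im (?F \<nu> z) = 0" if z: "Im z > 0" for z
  proof -
    have r: "(\<lambda>n. arcsine_ratio p r (\<omega> (s n)) z) \<longlonglongrightarrow> arcsine_ratio p r \<nu> z"
      unfolding arcsine_ratio_def by (intro tendsto_intros cl z)
    have q: "arcsine_ratio p r \<nu> z \<notin> \<real>\<^sub>\<le>\<^sub>0" by (rule arcsine_ratio_upper(2)[OF \<nu>m pr z])
    have c: "(\<lambda>n. csqrt (arcsine_ratio p r (\<omega> (s n)) z)) \<longlonglongrightarrow> csqrt (arcsine_ratio p r \<nu> z)"
      by (rule isCont_tendsto_compose[OF continuous_at_csqrt[OF q] r])
    have "(\<lambda>n. \<bar>Im (?F (\<omega> (s n)) z)\<bar>) \<longlonglongrightarrow> \<bar>Im (?F \<nu> z)\<bar>"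
      unfolding cayley_sqrt_def using cayley_sqrt_bound(1)[OF less_imp_le[OF Re_csqrt_pos[OF q]]]
      by (intro tendsto_intros c)
    moreover have "(\<lambda>n. measure lborel ({p..r} - K (s n)) / (pi * Im z)) \<longlonglongrightarrow> 0 / (pi * Im z)"
      using LIMSEQ_subseq_LIMSEQ[OF lim s] z by (intro tendsto_divide tendsto_const) (auto simp: comp_def)
    ultimately have "\<bar>Im (?F \<nu> z)\<bar> \<le> 0 / (pi * Im z)"
      by (rule LIMSEQ_le) (use Im_cayley_ratio_bound[OF \<omega> K pr z] in auto)
    then show ?thesis by simp
  qed
  have "?F \<nu> constant_on {z. Im z > 0}"
    by (rule real_valued_holomorphic_constant[OF holomorphic_cayley_ratio[OF \<nu>m pr]])
      (use Im0 half_plane_convex in \<open>auto intro: convex_connected\<close>)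
  then obtain k where k: "\<And>z. Im z > 0 \<Longrightarrow> ?F \<nu> z = k" by (auto simp: constant_on_def)
  define \<kappa> where "\<kappa> = ((1 + k) / (1 - k))\<^sup>2"
  have eq: "cauchy \<nu> z = \<kappa> * cauchy (arcsine p r) z" if z: "Im z > 0" for z
  proof -
    have "csqrt (arcsine_ratio p r \<nu> z) + 1 \<noteq> 0"
      using Re_csqrt_pos[OF arcsine_ratio_upper(2)[OF \<nu>m pr z]] by (intro cayley_sqrt_bound) simp
    from cayley_sqrt_inverse[OF this] have "arcsine_ratio p r \<nu> z = \<kappa>" unfolding k[OF z] \<kappa>_def .
    with arcsine_ratio_upper(1)[OF \<nu>m pr z] show ?thesis by simp
  qed
  have "(\<lambda>n. \<kappa> * (\<i> * of_nat n * cauchy (arcsine p r) (\<i> * of_nat n))) \<longlonglongrightarrow> \<kappa> * (-1)"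
    by (intro tendsto_mult tendsto_const cauchy_at_infinity[OF A])
  moreover have "\<forall>\<^sub>F n in sequentially. \<kappa> * (\<i> * of_nat n * cauchy (arcsine p r) (\<i> * of_nat n)) = \<i> * of_nat n * cauchy \<nu> (\<i> * of_nat n)"
    using eventually_gt_at_top[of 0] by eventually_elim (simp add: eq)
  ultimately have "(\<lambda>n. \<i> * of_nat n * cauchy \<nu> (\<i> * of_nat n)) \<longlonglongrightarrow> \<kappa> * (-1)"
    by (rule Lim_transform_eventually)
  from LIMSEQ_unique[OF this cauchy_at_infinity[OF \<nu>m]] have "\<kappa> = 1" by simp
  with eq have "\<nu> = arcsine p r" by (intro cauchy_determines_measure[OF \<nu>m A]) simp
  with conv show "weak_conv_m (\<omega> \<circ> s) (arcsine p r)" by simp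
qed

section \<open>One open gap\<close>

lemma eventually_at_right_0_Im:
  assumes "\<And>z. Im z > 0 \<Longrightarrow> P z"
  shows "\<forall>\<^sub>F y in at_right 0. P (Complex t y)"
  unfolding eventually_at_filter by (intro always_eventually allI impI assms) simp

lemma imaginary_boundary_value_mult_real:
  assumes "imaginary_boundary_value \<mu> t" "((\<lambda>y. g (Complex t y)) \<longlongrightarrow> of_real c) (at_right 0)"
    "\<And>z. Im z > 0 \<Longrightarrow> cauchy \<mu>' z = cauchy \<mu> z * g z"
  shows "imaginary_boundary_value \<mu>' t"
proof -
  obtain w where w: "((\<lambda>y. cauchy \<mu> (Complex t y)) \<longlongrightarrow> w) (at_right 0)" "Re w = 0"
    using assms(1) by (auto simp: imaginary_boundary_value_def)
  have "((\<lambda>y. cauchy \<mu> (Complex t y) * g (Complex t y)) \<longlongrightarrow> w * of_real c) (at_right 0)"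
    by (intro tendsto_mult w(1) assms(2))
  then have "((\<lambda>y. cauchy \<mu>' (Complex t y)) \<longlongrightarrow> w * of_real c) (at_right 0)"
    by (rule Lim_transform_eventually) (rule eventually_at_right_0_Im, simp add: assms(3))
  then show ?thesis using w(2) unfolding imaginary_boundary_value_def by (intro exI[of _ "w * of_real c"]) simp
qed

text \<open>The factor (z - c)/(z - g) has real boundary values, so the boundary values remain imaginary.\<close>
lemma move_reflectionless:
  assumes \<mu>: "\<mu> \<in> reflectionless_measures K" and KB: "K \<in> sets borel"
    and ab: "a < b" and gap: "K \<inter> {a<..<b} = {}" and K: "a \<in> K" "b \<in> K"
    and cd: "(c = a \<and> d = b) \<or> (c = b \<and> d = a)"
  obtains \<mu>' \<gamma> where "\<gamma> \<in> {a..b}" "\<mu>' \<in> reflectionless_measures K"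
    "\<And>s. apart K (of_real s) \<Longrightarrow> rcauchy \<mu>' s * (s - \<gamma>) = rcauchy \<mu> s * (s - c)"
    "zero_at \<mu>' a b c"
    "\<And>g. g \<in> borel_measurable borel \<Longrightarrow> (\<And>t. g t \<noteq> 0 \<Longrightarrow> 0 \<le> (t - d) * (d - c))
      \<Longrightarrow> (\<integral>\<^sup>+t. g t \<partial>\<mu>) \<le> (\<integral>\<^sup>+t. g t \<partial>\<mu>')"
proof -
  from \<mu> have m: "prob_measure_on K \<mu>" and bv: "AE x in lborel. x \<in> K \<longrightarrow> imaginary_boundary_value \<mu> x"
    unfolding reflectionless_measures_iff[OF KB] by auto
  show ?thesis
  proof (rule move_zero[OF m ab gap K cd])
  fix \<mu>' \<gamma> assume *: "\<gamma> \<in> {a..b}" "prob_measure_on K \<mu>'"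
    "\<And>z. apart K z \<Longrightarrow> cauchy \<mu>' z * (z - of_real \<gamma>) = cauchy \<mu> z * (z - of_real c)"
    "zero_at \<mu>' a b c"
    "\<And>g. g \<in> borel_measurable borel \<Longrightarrow> (\<And>t. g t \<noteq> 0 \<Longrightarrow> 0 \<le> (t - d) * (d - c))
      \<Longrightarrow> (\<integral>\<^sup>+t. g t \<partial>\<mu>) \<le> (\<integral>\<^sup>+t. g t \<partial>\<mu>')"
  have eq: "cauchy \<mu>' z = cauchy \<mu> z * ((z - of_real c) / (z - of_real \<gamma>))" if "Im z > 0" for z
  proof -
    have "z - of_real \<gamma> \<noteq> 0" using that by auto
    then show ?thesis using *(3)[OF apart_Im, of z] that by (simp add: eq_divide_eq)
  qed
  have "AE t in lborel. t \<noteq> \<gamma>" by (rule AE_lborel_singleton)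
  with bv have "AE t in lborel. t \<in> K \<longrightarrow> imaginary_boundary_value \<mu>' t"
  proof eventually_elim
    case (elim t)
    show ?case
    proof
      assume "t \<in> K"
      then have "imaginary_boundary_value \<mu> t" using elim by simp
      moreover have "((\<lambda>y. (Complex t y - of_real c) / (Complex t y - of_real \<gamma>)) \<longlongrightarrow> (of_real t - of_real c) / (of_real t - of_real \<gamma>)) (at_right 0)"
        using elim(2) by (intro tendsto_intros tendsto_Complex_at_right) auto
      then have "((\<lambda>y. (Complex t y - of_real c) / (Complex t y - of_real \<gamma>)) \<longlongrightarrow> of_real ((t - c) / (t - \<gamma>))) (at_right 0)" by simp
      ultimately show "imaginary_boundary_value \<mu>' t" by (rule imaginary_boundary_value_mult_real) (rule eq)
    qed
  qed
  then have R: "\<mu>' \<in> reflectionless_measures K" using *(2) unfolding reflectionless_measures_iff[OF KB] by simp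
  have r: "rcauchy \<mu>' s * (s - \<gamma>) = rcauchy \<mu> s * (s - c)" if "apart K (of_real s)" for s
    using *(3)[OF that] unfolding cauchy_of_real by (simp flip: of_real_diff of_real_mult)
  show ?thesis by (rule that[OF *(1) R r *(4,5)])
  qed
qed

lemma apart_interval:
  assumes "apart {a<..<b} (of_real s)" "a < b"
  shows "s \<notin> {a..b}"
proof
  assume s: "s \<in> {a..b}"
  obtain e where e: "e > 0" "\<And>t. t \<in> {a<..<b} \<Longrightarrow> e \<le> cmod (of_real t - of_real s)"
    using assms(1) unfolding apart_def by auto
  have "s \<in> closure {a<..<b}" using s assms(2) by simp
  then obtain t where "t \<in> {a<..<b}" "dist t s < e" using e(1) unfolding closure_approachable by blast
  then show False using e(2)[of t] by (simp add: dist_real_def flip: of_real_diff)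
qed

text \<open>On the old set the factor has real boundary values.  In the gap it has imaginary ones while the old
transform is real, so there the product is imaginary as well.\<close>
lemma fill_reflectionless:
  assumes \<mu>: "\<mu> \<in> reflectionless_measures K" and KB: "K \<in> sets borel"
    and ab: "a < b" and gap: "K \<inter> {a<..<b} = {}"
    and cd: "(c = a \<and> d = b) \<or> (c = b \<and> d = a)" and z: "zero_at \<mu> a b c"
  obtains \<mu>' where "\<mu>' \<in> reflectionless_measures (K \<union> {a<..<b})"
    "\<And>z. Im z > 0 \<Longrightarrow> cauchy \<mu>' z = cauchy \<mu> z * ((of_real d - z) * cauchy (arcsine a b) z)"
    "\<And>s. apart (K \<union> {a<..<b}) (of_real s) \<Longrightarrow> rcauchy \<mu>' s = rcauchy \<mu> s * fill_weight c d s"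
    "\<And>g. g \<in> borel_measurable borel \<Longrightarrow> (\<And>t. t \<in> {a<..<b} \<Longrightarrow> g t = 0)
      \<Longrightarrow> (\<integral>\<^sup>+t. g t \<partial>\<mu>') = (\<integral>\<^sup>+t. g t * ennreal (fill_weight c d t) \<partial>\<mu>)"
proof -
  from \<mu> have m: "prob_measure_on K \<mu>" and bv: "AE x in lborel. x \<in> K \<longrightarrow> imaginary_boundary_value \<mu> x"
    unfolding reflectionless_measures_iff[OF KB] by auto
  note A = prob_measure_on_arcsine[OF ab]
  show ?thesis
  proof (rule fill_gap[OF m ab gap cd z])
  fix \<mu>' assume *: "prob_measure_on (K \<union> {a<..<b}) \<mu>'"
    "\<And>z. apart (K \<union> {a<..<b}) z \<Longrightarrow> cauchy \<mu>' z = cauchy \<mu> z * ((of_real d - z) * cauchy (arcsine a b) z)"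
    "\<And>g. g \<in> borel_measurable borel \<Longrightarrow> (\<And>t. t \<in> {a<..<b} \<Longrightarrow> g t = 0)
      \<Longrightarrow> (\<integral>\<^sup>+t. g t \<partial>\<mu>') = (\<integral>\<^sup>+t. g t * ennreal (fill_weight c d t) \<partial>\<mu>)"
  have eq: "cauchy \<mu>' z = cauchy \<mu> z * ((of_real d - z) * cauchy (arcsine a b) z)" if "Im z > 0" for z
    using *(2)[OF apart_Im] that by auto
  have KB': "K \<union> {a<..<b} \<in> sets borel" using KB by auto
  have "AE t in lborel. t \<noteq> a" "AE t in lborel. t \<noteq> b" by (rule AE_lborel_singleton)+
  with bv have "AE t in lborel. t \<in> K \<union> {a<..<b} \<longrightarrow> imaginary_boundary_value \<mu>' t"
  proof eventually_elim
    case (elim t)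
    show ?case
    proof
      assume "t \<in> K \<union> {a<..<b}"
      then consider "t \<in> {a<..<b}" | "t \<in> K" "t \<notin> {a..b}" using elim gap by force
      then show "imaginary_boundary_value \<mu>' t"
      proof cases
        case 1
        have "((\<lambda>y. cauchy \<mu> (Complex t y) * ((of_real d - Complex t y) * cauchy (arcsine a b) (Complex t y)))
           \<longlongrightarrow> of_real (rcauchy \<mu> t) * ((of_real d - of_real t) * (\<i> / of_real (sqrt ((t - a) * (b - t)))))) (at_right 0)"
          by (intro tendsto_intros tendsto_Complex_at_right cauchy_boundary_real[OF m apart_gap[OF 1 gap]] cauchy_arcsine_boundary[OF ab 1])
        then have "((\<lambda>y. cauchy \<mu>' (Complex t y)) \<longlongrightarrow> of_real (rcauchy \<mu> t) * ((of_real d - of_real t) * (\<i> / of_real (sqrt ((t - a) * (b - t)))))) (at_right 0)"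
          by (rule Lim_transform_eventually) (rule eventually_at_right_0_Im, simp add: eq)
        moreover have "Re (of_real (rcauchy \<mu> t) * ((of_real d - of_real t) * (\<i> / of_real h))) = 0" for h
          by (simp flip: of_real_diff)
        ultimately show ?thesis unfolding imaginary_boundary_value_def by blast
      next
        case 2
        then have "imaginary_boundary_value \<mu> t" using elim by simp
        moreover have "apart {a..b} (of_real t)" using 2 by (intro apart_closed) auto
        then have o: "apart {a<..<b} (of_real t)" by (rule apart_mono) auto
        have "((\<lambda>y. (of_real d - Complex t y) * cauchy (arcsine a b) (Complex t y)) \<longlongrightarrow> (of_real d - of_real t) * of_real (rcauchy (arcsine a b) t)) (at_right 0)"
          by (intro tendsto_intros tendsto_Complex_at_right cauchy_boundary_real[OF A o])
        then have "((\<lambda>y. (of_real d - Complex t y) * cauchy (arcsine a b) (Complex t y)) \<longlongrightarrow> of_real ((d - t) * rcauchy (arcsine a b) t)) (at_right 0)" by simp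
        ultimately show ?thesis by (rule imaginary_boundary_value_mult_real) (rule eq)
      qed
    qed
  qed
  then have R: "\<mu>' \<in> reflectionless_measures (K \<union> {a<..<b})"
    using *(1) unfolding reflectionless_measures_iff[OF KB'] by simp
  have r: "rcauchy \<mu>' s = rcauchy \<mu> s * fill_weight c d s" if s: "apart (K \<union> {a<..<b}) (of_real s)" for s
  proof -
    have "s \<notin> {a..b}" by (rule apart_interval[OF apart_mono[OF s] ab]) auto
    from fill_weight_eq[OF cd ab this] *(2)[OF s] show ?thesis
      unfolding cauchy_of_real by (simp flip: of_real_diff of_real_mult)
  qed
  show ?thesis by (rule that[OF R eq r *(3)])
  qed
qed

text \<open>For t at most a this is 1/(x - t) divided by the weight for filling (a, b) with zero at a; beyond a it
is 0.  The formula with min and max shows its continuity.\<close>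
definition tail_kernel :: "real \<Rightarrow> real \<Rightarrow> real \<Rightarrow> real \<Rightarrow> real" where
  "tail_kernel a b x t = sqrt (max 0 (a - t) / (b - min t a)) / (x - min t a)"

lemma tail_kernel_continuous:
  assumes "a < x" "x < b"
  shows "isCont (tail_kernel a b x) t"
proof -
  have "b - min t a \<noteq> 0" "x - min t a \<noteq> 0" using assms by auto
  then show ?thesis unfolding tail_kernel_def[abs_def] by (intro continuous_intros) auto
qed

lemma tail_kernel_bound:
  assumes "a < x" "x < b"
  shows "0 \<le> tail_kernel a b x t" "tail_kernel a b x t \<le> 1 / (x - a)"
proof -
  have pos: "b - min t a > 0" "x - min t a > 0" using assms by auto
  show "0 \<le> tail_kernel a b x t" unfolding tail_kernel_def using pos by simp
  have "max 0 (a - t) \<le> b - min t a" using assms by (auto simp: max_def min_def)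
  then have "max 0 (a - t) / (b - min t a) \<le> 1" using pos(1) by (simp add: divide_le_eq)
  then have "sqrt (max 0 (a - t) / (b - min t a)) \<le> 1" by simp
  then have "tail_kernel a b x t \<le> 1 / (x - min t a)" unfolding tail_kernel_def using pos by (intro divide_right_mono) auto
  also have "\<dots> \<le> 1 / (x - a)" using assms pos by (intro divide_left_mono mult_pos_pos) auto
  finally show "tail_kernel a b x t \<le> 1 / (x - a)" .
qed

lemma tail_kernel_measurable [measurable]: "tail_kernel a b x \<in> borel_measurable borel"
  unfolding tail_kernel_def[abs_def] by measurable

text \<open>Near p the singularity 1/sqrt(t - p) dominates, while the other factors are at most 2/(x - p).  Far from
p one has x - p <= 2 (t - p), and 1/(x - t) is replaced by 1/(a - t).\<close>
lemma tail_kernel_estimate: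
  assumes t: "p < t" "t < a" and x: "a < x" "x < b"
  shows "sqrt (x - p) * tail_kernel a b x t / sqrt (t - p)
     \<le> 2 / (sqrt (x - p) * sqrt (t - p)) + sqrt 2 / (sqrt (a - t) * sqrt (b - t))"
proof -
  have k: "tail_kernel a b x t = sqrt ((a - t) / (b - t)) / (x - t)" using t by (simp add: tail_kernel_def)
  have pos: "a - t > 0" "b - t > 0" "x - t > 0" "t - p > 0" "x - p > 0" using assms by auto
  show ?thesis
  proof (cases "t - p \<le> (x - p) / 2")
    case True
    have "sqrt ((a - t) / (b - t)) \<le> 1" using pos x by (simp add: divide_le_eq)
    moreover have "(x - p) / 2 \<le> x - t" using True by (simp add: field_simps)
    ultimately have "tail_kernel a b x t \<le> 1 / ((x - p) / 2)" unfolding k using pos by (intro frac_le) auto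
    then have "sqrt (x - p) * tail_kernel a b x t / sqrt (t - p) \<le> sqrt (x - p) * (1 / ((x - p) / 2)) / sqrt (t - p)"
      using pos by (intro divide_right_mono mult_left_mono) auto
    also have "\<dots> = 2 / (sqrt (x - p) * sqrt (t - p))"
    proof -
      have "x - p = sqrt (x - p) * sqrt (x - p)" using pos by simp
      moreover have "q * (1 / (q * q / 2)) / u = 2 / (q * u)" if "q > 0" for q u :: real using that by simp
      ultimately show ?thesis using pos by (metis real_sqrt_gt_zero)
    qed
    also have "\<dots> \<le> 2 / (sqrt (x - p) * sqrt (t - p)) + sqrt 2 / (sqrt (a - t) * sqrt (b - t))" using pos by simp
    finally show ?thesis .
  next
    case False
    have "tail_kernel a b x t \<le> sqrt ((a - t) / (b - t)) / (a - t)"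
      unfolding k using pos x by (intro divide_left_mono mult_pos_pos) auto
    also have "\<dots> = 1 / (sqrt (a - t) * sqrt (b - t))"
    proof -
      have "u / v / (u * u) = 1 / (u * v)" if "u > 0" "v > 0" for u v :: real using that by simp
      from this[of "sqrt (a - t)" "sqrt (b - t)"] show ?thesis using pos by (simp add: real_sqrt_divide)
    qed
    finally have 1: "tail_kernel a b x t \<le> 1 / (sqrt (a - t) * sqrt (b - t))" .
    have "x - p \<le> 2 * (t - p)" using False by (simp add: field_simps)
    then have "sqrt (x - p) \<le> sqrt (2 * (t - p))" by (rule real_sqrt_le_mono)
    then have "sqrt (x - p) \<le> sqrt 2 * sqrt (t - p)" by (simp only: real_sqrt_mult)
    then have 2: "sqrt (x - p) / sqrt (t - p) \<le> sqrt 2" using pos by (simp add: divide_le_eq)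
    have "sqrt (x - p) * tail_kernel a b x t / sqrt (t - p) = (sqrt (x - p) / sqrt (t - p)) * tail_kernel a b x t" by simp
    also have "\<dots> \<le> sqrt 2 * (1 / (sqrt (a - t) * sqrt (b - t)))"
      using 1 2 tail_kernel_bound(1)[OF x] pos by (intro mult_mono) auto
    also have "\<dots> \<le> 2 / (sqrt (x - p) * sqrt (t - p)) + sqrt 2 / (sqrt (a - t) * sqrt (b - t))" using pos by simp
    finally show ?thesis .
  qed
qed

text \<open>The second term of the majorant integrates to a multiple of the logarithm; the rest is absorbed
generously by the constant 3.\<close>
lemma tail_majorant_integral:
  assumes pa: "p < a" and x: "a < x" "x < b"
  shows "\<exists>I. has_bochner_integral lborel (\<lambda>t. indicator {p<..<a} t *
      (2 / (sqrt (x - p) * sqrt (t - p)) + sqrt 2 / (sqrt (a - t) * sqrt (b - t)))) I \<and>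
      I \<le> pi * (3 + ln ((b - p) / (b - a)))"
proof -
  define G where "G t = 4 * (sqrt (t - p) / sqrt (x - p)) - 2 * sqrt 2 * ln (sqrt (a - t) + sqrt (b - t))" for t
  have hb: "has_bochner_integral lborel (\<lambda>t. indicator {p<..<a} t *
      (2 / (sqrt (x - p) * sqrt (t - p)) + sqrt 2 / (sqrt (a - t) * sqrt (b - t)))) (G a - G p)"
  proof (rule FTC_open_interval[OF pa, where F = G])
    fix t assume "t \<in> {p<..<a}"
    then have pos: "a - t > 0" "b - t > 0" "t - p > 0" "x - p > 0" using x by auto
    define u v where "u = sqrt (a - t)" and "v = sqrt (b - t)"
    have uv: "u > 0" "v > 0" using pos by (auto simp: u_def v_def)
    have du: "((\<lambda>t. sqrt (a - t)) has_real_derivative - (1 / (2 * u))) (at t)"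
      unfolding u_def using pos by (auto intro!: derivative_eq_intros simp: divide_simps)
    have dv: "((\<lambda>t. sqrt (b - t)) has_real_derivative - (1 / (2 * v))) (at t)"
      unfolding v_def using pos by (auto intro!: derivative_eq_intros simp: divide_simps)
    have dp: "((\<lambda>t. sqrt (t - p)) has_real_derivative (1 / (2 * sqrt (t - p)))) (at t)"
      using pos by (auto intro!: derivative_eq_intros simp: divide_simps)
    have uvp: "0 < sqrt (a - t) + sqrt (b - t)" using add_pos_pos[OF uv] by (simp only: u_def v_def)
    have "((\<lambda>t. ln (sqrt (a - t) + sqrt (b - t))) has_real_derivative (1 / (u + v)) * (- (1 / (2 * u)) + - (1 / (2 * v)))) (at t)"
      using DERIV_chain2[OF DERIV_ln_divide[OF uvp] DERIV_add[OF du dv]] by (simp add: u_def v_def)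
    also have "(1 / (u + v)) * (- (1 / (2 * u)) + - (1 / (2 * v))) = - (1 / (2 * (u * v)))"
    proof -
      have "- (1 / (2 * u)) + - (1 / (2 * v)) = - ((u + v) / (2 * (u * v)))" using uv by (simp add: field_simps)
      then show ?thesis using uv by (simp add: add_pos_pos)
    qed
    finally have dl: "((\<lambda>t. ln (sqrt (a - t) + sqrt (b - t))) has_real_derivative - (1 / (2 * (u * v)))) (at t)" .
    have "(G has_real_derivative 4 * ((1 / (2 * sqrt (t - p))) / sqrt (x - p)) - 2 * sqrt 2 * - (1 / (2 * (u * v)))) (at t)"
      unfolding G_def[abs_def] by (intro DERIV_diff DERIV_cmult DERIV_cdivide dp dl)
    also have "4 * ((1 / (2 * sqrt (t - p))) / sqrt (x - p)) - 2 * sqrt 2 * - (1 / (2 * (u * v)))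
       = 2 / (sqrt (x - p) * sqrt (t - p)) + sqrt 2 / (u * v)" using uv pos by (simp add: field_simps)
    finally show "(G has_real_derivative 2 / (sqrt (x - p) * sqrt (t - p)) + sqrt 2 / (sqrt (a - t) * sqrt (b - t))) (at t)"
      by (simp add: u_def v_def)
    show "isCont (\<lambda>t. 2 / (sqrt (x - p) * sqrt (t - p)) + sqrt 2 / (sqrt (a - t) * sqrt (b - t))) t"
      using pos by (intro continuous_intros) auto
    show "0 \<le> 2 / (sqrt (x - p) * sqrt (t - p)) + sqrt 2 / (sqrt (a - t) * sqrt (b - t))" using pos by simp
  next
    have cont: "continuous_on {p..a} G"
      unfolding G_def
    proof (intro continuous_intros ballI)
      fix t assume "t \<in> {p..a}"
      then have "sqrt (b - t) > 0" "sqrt (a - t) \<ge> 0" using x by auto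
      then show "sqrt (a - t) + sqrt (b - t) \<noteq> 0" by linarith
    qed (use pa x in auto)
    show "(G \<longlongrightarrow> G p) (at_right p)" "(G \<longlongrightarrow> G a) (at_left a)"
      using continuous_on_Icc_at_rightD[OF cont pa] continuous_on_Icc_at_leftD[OF cont pa] by auto
  qed
  have pos: "b - p > 0" "b - a > 0" "a - p > 0" using assms by auto
  define L where "L = ln ((b - p) / (b - a))"
  have L: "L = ln (b - p) - ln (b - a)" "L \<ge> 0" unfolding L_def using pos by (auto simp: ln_div le_divide_eq)
  have "sqrt (a - p) / sqrt (x - p) \<le> 1" using assms by (simp add: divide_le_eq)
  moreover have "ln (sqrt (a - p) + sqrt (b - p)) \<le> ln 2 + ln (b - p) / 2"
  proof -
    have "sqrt (a - p) + sqrt (b - p) \<le> 2 * sqrt (b - p)" using assms by simp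
    then have "ln (sqrt (a - p) + sqrt (b - p)) \<le> ln (2 * sqrt (b - p))"
      using pos by (subst ln_le_cancel_iff) (auto intro: add_nonneg_pos)
    also have "\<dots> = ln 2 + ln (b - p) / 2" using pos by (simp add: ln_mult ln_sqrt)
    finally show ?thesis .
  qed
  then have "2 * sqrt 2 * ln (sqrt (a - p) + sqrt (b - p)) \<le> 2 * sqrt 2 * (ln 2 + ln (b - p) / 2)" by simp
  moreover have "G a = 4 * (sqrt (a - p) / sqrt (x - p)) - 2 * sqrt 2 * (ln (b - a) / 2)"
    unfolding G_def using ln_sqrt[OF less_imp_le[OF pos(2)]] by simp
  moreover have "G p = - (2 * sqrt 2 * ln (sqrt (a - p) + sqrt (b - p)))" by (simp add: G_def)
  ultimately have "G a - G p \<le> 4 - 2 * sqrt 2 * (ln (b - a) / 2) + 2 * sqrt 2 * (ln 2 + ln (b - p) / 2)"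
    by linarith
  also have "\<dots> = 4 + 2 * sqrt 2 * ln 2 + sqrt 2 * L" unfolding L(1) by (simp add: algebra_simps)
  also have "\<dots> \<le> 3 * 3 + 3 * L"
  proof -
    have s: "sqrt 2 \<le> 3 / 2" by (rule real_le_lsqrt) (auto simp: power2_eq_square)
    have l: "ln 2 \<le> (1::real)" using ln_2_less_1 by simp
    have "sqrt 2 * ln 2 \<le> (3 / 2) * (1::real)" using s l by (intro mult_mono) auto
    moreover have "sqrt 2 * L \<le> 3 / 2 * L" using s L(2) by (intro mult_right_mono) auto
    ultimately show ?thesis using L(2) by linarith
  qed
  also have "\<dots> \<le> pi * (3 + L)"
  proof -
    have "3 * (3 + L) \<le> pi * (3 + L)" using pi_gt3 L(2) by (intro mult_right_mono) auto
    then show ?thesis by (simp add: algebra_simps)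
  qed
  finally show ?thesis using hb unfolding L_def by blast
qed

text \<open>The factor 1/sqrt(r - t) of the arcsine density is at most 1/sqrt(r - x) here, which leaves the
majorant above.\<close>
lemma arcsine_tail_bound:
  assumes pa: "p \<le> a" and x: "a < x" "x < b" and b: "b \<le> r"
  shows "(\<integral>t. tail_kernel a b x t \<partial>arcsine p r) \<le> (3 + ln ((b - p) / (b - a))) / sqrt ((x - p) * (r - x))"
proof -
  have pr: "p < r" using assms by simp
  define C where "C = sqrt (x - p) * sqrt (r - x)"
  have C: "C > 0" using assms by (simp add: C_def)
  define D where "D t = indicator {p<..<r} t * (1 / (pi * sqrt ((t - p) * (r - t))))" for t
  have eq: "(\<integral>t. tail_kernel a b x t \<partial>arcsine p r) = (\<integral>t. D t * tail_kernel a b x t \<partial>lborel)"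
    unfolding arcsine_def D_def by (subst integral_density) (use arcsine_density_nonneg in auto)
  have int: "integrable lborel (\<lambda>t. D t * tail_kernel a b x t)"
  proof -
    interpret prob_space "arcsine p r" using prob_measure_onD(2)[OF prob_measure_on_arcsine[OF pr]] .
    have "integrable (arcsine p r) (tail_kernel a b x)"
      by (rule integrable_const_bound[where B = "1 / (x - a)"]) (use tail_kernel_bound[OF x] in auto)
    then show ?thesis unfolding arcsine_def D_def
      by (subst (asm) integrable_density) (use arcsine_density_nonneg in auto)
  qed
  show ?thesis
  proof (cases "p = a")
    case True
    have "(\<integral>t. D t * tail_kernel a b x t \<partial>lborel) = integral\<^sup>L lborel (\<lambda>t::real. 0::real)"
      by (rule Bochner_Integration.integral_cong) (auto simp: D_def indicator_def tail_kernel_def True)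
    moreover have "0 \<le> (3 + ln ((b - p) / (b - a))) / sqrt ((x - p) * (r - x))"
      using x b True by simp
    ultimately show ?thesis unfolding eq by simp
  next
    case False
    then have pa: "p < a" using pa by simp
    obtain I where I: "has_bochner_integral lborel (\<lambda>t. indicator {p<..<a} t *
      (2 / (sqrt (x - p) * sqrt (t - p)) + sqrt 2 / (sqrt (a - t) * sqrt (b - t)))) I"
      "I \<le> pi * (3 + ln ((b - p) / (b - a)))"
      using tail_majorant_integral[OF pa x] by blast
    have "(\<integral>t. D t * tail_kernel a b x t \<partial>lborel) \<le> (\<integral>t. 1 / (pi * C) * (indicator {p<..<a} t *
      (2 / (sqrt (x - p) * sqrt (t - p)) + sqrt 2 / (sqrt (a - t) * sqrt (b - t)))) \<partial>lborel)"
    proof (rule integral_mono[OF int])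
      show "integrable lborel (\<lambda>t. 1 / (pi * C) * (indicator {p<..<a} t *
        (2 / (sqrt (x - p) * sqrt (t - p)) + sqrt 2 / (sqrt (a - t) * sqrt (b - t)))))"
        using I(1) by (intro integrable_mult_right) (simp add: has_bochner_integral_iff)
      fix t
      show "D t * tail_kernel a b x t \<le> 1 / (pi * C) * (indicator {p<..<a} t *
        (2 / (sqrt (x - p) * sqrt (t - p)) + sqrt 2 / (sqrt (a - t) * sqrt (b - t))))"
      proof (cases "t \<in> {p<..<a}")
        case True
        then have t: "p < t" "t < a" by auto
        have pos: "t - p > 0" "r - t > 0" "x - p > 0" "r - x > 0" using t x b by auto
        have "1 / sqrt (r - t) \<le> 1 / sqrt (r - x)"
          using t x pos by (intro divide_left_mono mult_pos_pos) auto
        then have "1 / (pi * sqrt (t - p)) * (1 / sqrt (r - t)) * tail_kernel a b x t \<le> 1 / (pi * sqrt (t - p)) * (1 / sqrt (r - x)) * tail_kernel a b x t"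
          using tail_kernel_bound(1)[OF x] pos by (intro mult_right_mono mult_left_mono) auto
        also have "\<dots> = 1 / (pi * C) * (sqrt (x - p) * tail_kernel a b x t / sqrt (t - p))"
        proof -
          have "sqrt (x - p) > 0" using pos by simp
          then show ?thesis unfolding C_def by (simp add: field_simps)
        qed
        also have "\<dots> \<le> 1 / (pi * C) * (2 / (sqrt (x - p) * sqrt (t - p)) + sqrt 2 / (sqrt (a - t) * sqrt (b - t)))"
          using C by (intro mult_left_mono tail_kernel_estimate[OF t x]) auto
        finally show ?thesis using True t x b by (simp add: D_def real_sqrt_mult)
      next
        case False
        then have e: "D t * tail_kernel a b x t = 0" by (auto simp: D_def indicator_def tail_kernel_def)
        show ?thesis unfolding e using False by simp
      qed
    qed
    also have "\<dots> = 1 / (pi * C) * I" using I(1) by (simp add: has_bochner_integral_iff)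
    also have "\<dots> \<le> 1 / (pi * C) * (pi * (3 + ln ((b - p) / (b - a))))" using I(2) C by (intro mult_left_mono) auto
    also have "\<dots> = (3 + ln ((b - p) / (b - a))) / sqrt ((x - p) * (r - x))" by (simp add: C_def real_sqrt_mult)
    finally show ?thesis unfolding eq .
  qed
qed

lemma cauchy_near_gap_point:
  assumes \<mu>: "prob_measure_on K \<mu>" and gap: "K \<inter> {a<..<b} = {}" and x: "x \<in> {a<..<b}"
    and y: "y > 0" and \<delta>: "\<delta> = min (x - a) (b - x)"
  shows "cmod (cauchy \<mu> (Complex x y) - of_real (rcauchy \<mu> x)) \<le> y / \<delta>\<^sup>2"
proof -
  interpret prob_space \<mu> using prob_measure_onD(2)[OF \<mu>] .
  note [measurable_cong] = prob_measure_onD(1)[OF \<mu>]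
  have \<delta>0: "\<delta> > 0" using x \<delta> by auto
  have i1: "integrable \<mu> (\<lambda>t. 1 / (of_real t - Complex x y))" using y by (intro integrable_cauchy[OF \<mu>] apart_Im) auto
  have i2: "integrable \<mu> (\<lambda>t. 1 / (of_real t - complex_of_real x))" by (intro integrable_cauchy[OF \<mu>] apart_gap[OF x gap])
  have "cauchy \<mu> (Complex x y) - cauchy \<mu> (of_real x) = (\<integral>t. 1 / (of_real t - Complex x y) - 1 / (of_real t - of_real x) \<partial>\<mu>)"
    unfolding cauchy_def using i1 i2 by simp
  also have "cmod \<dots> \<le> (\<integral>t. cmod (1 / (of_real t - Complex x y) - 1 / (of_real t - of_real x)) \<partial>\<mu>)"
    by (rule integral_norm_bound)
  also have "\<dots> \<le> (\<integral>t. y / \<delta>\<^sup>2 \<partial>\<mu>)"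
  proof (rule integral_mono_AE)
    show "AE t in \<mu>. cmod (1 / (of_real t - Complex x y) - 1 / (of_real t - of_real x)) \<le> y / \<delta>\<^sup>2"
      using prob_measure_onD(3)[OF \<mu>]
    proof eventually_elim
      case (elim t)
      then have "t \<le> a \<or> b \<le> t" using gap by force
      then have far: "\<delta> \<le> \<bar>t - x\<bar>" using \<delta> x by auto
      have u: "\<delta> \<le> cmod (of_real t - Complex x y)" using far abs_Re_le_cmod[of "of_real t - Complex x y"] by simp
      have v: "\<delta> \<le> cmod (of_real t - of_real x)" using far by (simp flip: of_real_diff)
      have ne: "of_real t - Complex x y \<noteq> 0" "of_real t - complex_of_real x \<noteq> 0" using u v \<delta>0 by auto
      have "1 / (of_real t - Complex x y) - 1 / (of_real t - of_real x)
        = ((of_real t - of_real x) - (of_real t - Complex x y)) / ((of_real t - Complex x y) * (of_real t - of_real x))"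
        using ne by (simp add: diff_frac_eq)
      also have "(of_real t - of_real x) - (of_real t - Complex x y) = \<i> * of_real y" by (simp add: complex_eq_iff)
      finally have "cmod (1 / (of_real t - Complex x y) - 1 / (of_real t - of_real x)) = y / (cmod (of_real t - Complex x y) * cmod (of_real t - of_real x))"
        using y by (simp add: norm_divide norm_mult)
      also have "\<dots> \<le> y / (\<delta> * \<delta>)" using u v \<delta>0 y by (intro divide_left_mono mult_mono mult_pos_pos) auto
      finally show ?case by (simp add: power2_eq_square)
    qed
  qed (use i1 i2 in auto)
  finally show ?thesis by (simp add: cauchy_of_real prob_space)
qed

text \<open>After the gap is filled, the measures converge to the arcsine distribution.  In the upper half-plane this
gives the limit of the original transforms, and the bound on how fast they vary near x carries it to x.
The integral to the left of the gap becomes the integral of a bounded continuous function over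
the filled measure.\<close>
lemma one_gap_limit:
  assumes ab: "p \<le> a" "a < b" "b \<le> r" and x: "x \<in> {a<..<b}"
    and cd: "(c = a \<and> d = b) \<or> (c = b \<and> d = a)"
    and \<tau>: "\<And>n. \<tau> n \<in> reflectionless_measures (K n)" "\<And>n. zero_at (\<tau> n) a b c"
    and K: "\<And>n. K n \<in> sets borel" "\<And>n. K n \<subseteq> {p..r} - {a<..<b}"
    and lim: "(\<lambda>n. measure lborel ({p..r} - {a<..<b} - K n)) \<longlonglongrightarrow> 0"
  shows "(\<lambda>n. \<bar>rcauchy (\<tau> n) x\<bar>) \<longlonglongrightarrow> sqrt (\<bar>x - c\<bar> / \<bar>x - d\<bar>) / sqrt ((x - p) * (r - x))"
    and "c = a \<Longrightarrow> (\<lambda>n. \<integral>\<^sup>+t. ennreal (indicator {..a} t / (x - t)) \<partial>\<tau> n) \<longlonglongrightarrow> ennreal (\<integral>t. tail_kernel a b x t \<partial>arcsine p r)"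
proof -
  have pr: "p < r" using ab by simp
  have xb: "a < x" "x < b" using x by auto
  have m: "prob_measure_on (K n) (\<tau> n)" for n using \<tau>(1)[of n] unfolding reflectionless_measures_def by simp
  have gap: "K n \<inter> {a<..<b} = {}" for n using K(2)[of n] by auto
  define Q where "Q n \<mu>' \<longleftrightarrow> \<mu>' \<in> reflectionless_measures (K n \<union> {a<..<b}) \<and>
    (\<forall>z. Im z > 0 \<longrightarrow> cauchy \<mu>' z = cauchy (\<tau> n) z * ((of_real d - z) * cauchy (arcsine a b) z)) \<and>
    (\<forall>g. g \<in> borel_measurable borel \<longrightarrow> (\<forall>t. t \<in> {a<..<b} \<longrightarrow> g t = 0)
      \<longrightarrow> (\<integral>\<^sup>+t. g t \<partial>\<mu>') = (\<integral>\<^sup>+t. g t * ennreal (fill_weight c d t) \<partial>\<tau> n))" for n \<mu>'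
  have "\<exists>\<mu>'. Q n \<mu>'" for n
    by (rule fill_reflectionless[OF \<tau>(1) K(1) ab(2) gap cd \<tau>(2), of n]) (auto simp: Q_def intro!: exI)
  then have "\<exists>\<omega>. \<forall>n. Q n (\<omega> n)" by (intro choice allI)
  then obtain \<omega> where Q: "\<And>n. Q n (\<omega> n)" by blast
  have \<omega>: "\<And>n. \<omega> n \<in> reflectionless_measures (K n \<union> {a<..<b})"
    "\<And>n z. Im z > 0 \<Longrightarrow> cauchy (\<omega> n) z = cauchy (\<tau> n) z * ((of_real d - z) * cauchy (arcsine a b) z)"
    "\<And>n g. g \<in> borel_measurable borel \<Longrightarrow> (\<And>t. t \<in> {a<..<b} \<Longrightarrow> g t = 0)
      \<Longrightarrow> (\<integral>\<^sup>+t. g t \<partial>\<omega> n) = (\<integral>\<^sup>+t. g t * ennreal (fill_weight c d t) \<partial>\<tau> n)"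
    using Q unfolding Q_def by blast+
  have \<omega>m: "prob_measure_on (K n \<union> {a<..<b}) (\<omega> n)" for n using \<omega>(1)[of n] unfolding reflectionless_measures_def by simp
  have "{p..r} - (K n \<union> {a<..<b}) = {p..r} - {a<..<b} - K n" for n by auto
  then have lim': "(\<lambda>n. measure lborel ({p..r} - (K n \<union> {a<..<b}))) \<longlonglongrightarrow> 0" using lim by simp
  have wc: "weak_conv_m \<omega> (arcsine p r)"
  proof (rule reflectionless_limit[OF pr \<omega>(1) _ _ lim'])
    show "K n \<union> {a<..<b} \<in> sets borel" for n using K(1)[of n] by simp
    show "K n \<union> {a<..<b} \<subseteq> {p..r}" for n using K(2)[of n] ab by auto
  qed
  note rdA = prob_measure_on_real_distribution[OF prob_measure_on_arcsine[OF pr]]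
  define M where "M z = cauchy (arcsine p r) z / ((of_real d - z) * cauchy (arcsine a b) z)" for z
  have Mlim: "(\<lambda>n. cauchy (\<tau> n) z) \<longlonglongrightarrow> M z" if z: "Im z > 0" for z
  proof -
    have ne: "(of_real d - z) * cauchy (arcsine a b) z \<noteq> 0"
      using Im_cauchy_pos[OF prob_measure_on_arcsine[OF ab(2)] z] z by auto
    have "(\<lambda>n. cauchy (\<omega> n) z / ((of_real d - z) * cauchy (arcsine a b) z)) \<longlonglongrightarrow> M z"
      unfolding M_def by (intro tendsto_divide tendsto_const weak_conv_cauchy[OF \<omega>m rdA wc z] ne)
    then show ?thesis using ne by (simp add: \<omega>(2)[OF z])
  qed
  define m0 where "m0 = sqrt ((x - a) * (b - x)) / ((d - x) * sqrt ((x - p) * (r - x)))"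
  have pos: "(x - a) * (b - x) > 0" "(x - p) * (r - x) > 0" "d - x \<noteq> 0" using xb ab cd by auto
  have M0: "((\<lambda>y. M (Complex x y)) \<longlongrightarrow> of_real m0) (at_right 0)"
  proof -
    have h1: "complex_of_real d - of_real x \<noteq> 0" using pos(3) by simp
    have h2: "complex_of_real (sqrt ((x - a) * (b - x))) \<noteq> 0"
      using pos(1) by (simp only: of_real_eq_0_iff real_sqrt_eq_0_iff)
    have "x \<in> {p<..<r}" using xb ab by auto
    then have "((\<lambda>y. M (Complex x y)) \<longlongrightarrow> (\<i> / of_real (sqrt ((x - p) * (r - x)))) / ((of_real d - of_real x) * (\<i> / of_real (sqrt ((x - a) * (b - x)))))) (at_right 0)"
      unfolding M_def
      by (intro tendsto_intros tendsto_Complex_at_right cauchy_arcsine_boundary pr ab(2) x)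
        (simp_all only: mult_eq_0_iff divide_eq_0_iff h1 h2 complex_i_not_zero simp_thms)
    moreover have "(\<i> / P) / (D * (\<i> / Q)) = Q / (D * P)" for P Q D :: complex by simp
    ultimately show ?thesis by (simp add: m0_def mult.commute)
  qed
  define \<delta> where "\<delta> = min (x - a) (b - x)"
  have \<delta>0: "\<delta> > 0" using xb by (simp add: \<delta>_def)
  have "(\<lambda>n. complex_of_real (rcauchy (\<tau> n) x)) \<longlonglongrightarrow> of_real m0"
    unfolding tendsto_iff
  proof (intro allI impI)
    fix e :: real assume e: "e > 0"
    have "\<forall>\<^sub>F y in at_right 0. dist (M (Complex x y)) (of_real m0) < e / 3" using tendstoD[OF M0, of "e/3"] e by simp
    moreover have "\<forall>\<^sub>F y in at_right (0::real). y < e / 3 * \<delta>\<^sup>2"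
      using e \<delta>0 by (intro eventually_at_rightI[of 0 "e / 3 * \<delta>\<^sup>2"]) auto
    moreover have "\<forall>\<^sub>F y in at_right (0::real). y > 0" by (rule eventually_at_right_less)
    ultimately have "\<forall>\<^sub>F y in at_right 0. dist (M (Complex x y)) (of_real m0) < e / 3 \<and> y < e / 3 * \<delta>\<^sup>2 \<and> y > 0"
      by eventually_elim simp
    then obtain y where y: "dist (M (Complex x y)) (of_real m0) < e / 3" "y < e / 3 * \<delta>\<^sup>2" "y > 0"
      using eventually_happens'[OF trivial_limit_at_right_real] by blast
    have y3: "y / \<delta>\<^sup>2 < e / 3" using y(2) \<delta>0 by (simp add: divide_less_eq)
    have "\<forall>\<^sub>F n in sequentially. dist (cauchy (\<tau> n) (Complex x y)) (M (Complex x y)) < e / 3"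
      using tendstoD[OF Mlim, of "Complex x y" "e/3"] e y by simp
    then show "\<forall>\<^sub>F n in sequentially. dist (complex_of_real (rcauchy (\<tau> n) x)) (of_real m0) < e"
    proof eventually_elim
      case (elim n)
      have "dist (complex_of_real (rcauchy (\<tau> n) x)) (cauchy (\<tau> n) (Complex x y)) < e / 3"
        using cauchy_near_gap_point[OF m gap x y(3) \<delta>_def, of n] y3
        unfolding dist_norm norm_minus_commute[of "complex_of_real _"] by linarith
      moreover have "dist (complex_of_real (rcauchy (\<tau> n) x)) (of_real m0) \<le> dist (complex_of_real (rcauchy (\<tau> n) x)) (cauchy (\<tau> n) (Complex x y))
          + dist (cauchy (\<tau> n) (Complex x y)) (M (Complex x y)) + dist (M (Complex x y)) (of_real m0)"
        using dist_triangle[of "complex_of_real (rcauchy (\<tau> n) x)" "of_real m0" "M (Complex x y)"]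
          dist_triangle[of "complex_of_real (rcauchy (\<tau> n) x)" "M (Complex x y)" "cauchy (\<tau> n) (Complex x y)"] by linarith
      ultimately show ?case using elim y(1) by linarith
    qed
  qed
  then have "(\<lambda>n. rcauchy (\<tau> n) x) \<longlonglongrightarrow> m0" by (simp only: tendsto_of_real_iff)
  then have "(\<lambda>n. \<bar>rcauchy (\<tau> n) x\<bar>) \<longlonglongrightarrow> \<bar>m0\<bar>" by (rule tendsto_rabs)
  moreover have "\<bar>m0\<bar> = sqrt (\<bar>x - c\<bar> / \<bar>x - d\<bar>) / sqrt ((x - p) * (r - x))"
  proof -
    have e: "(x - a) * (b - x) = \<bar>x - c\<bar> * \<bar>x - d\<bar>" using cd xb by auto
    define u v where "u = sqrt \<bar>x - c\<bar>" and "v = sqrt \<bar>x - d\<bar>"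
    have v: "v > 0" "\<bar>d - x\<bar> = v * v" using pos(3) by (auto simp: v_def abs_minus_commute)
    have "\<bar>m0\<bar> = (u * v) / ((v * v) * sqrt ((x - p) * (r - x)))"
    proof -
      have "\<bar>Q / (D * P)\<bar> = Q / (\<bar>D\<bar> * P)" if "Q \<ge> 0" "P \<ge> 0" for Q D P :: real using that by (simp add: abs_mult)
      moreover have "sqrt (\<bar>x - c\<bar> * \<bar>x - d\<bar>) = u * v" by (simp only: real_sqrt_mult u_def v_def)
      moreover have "0 \<le> u * v" "0 \<le> sqrt ((x - p) * (r - x))" using pos by (auto simp: u_def v_def)
      ultimately show ?thesis unfolding m0_def e by (simp only: v(2))
    qed
    also have "\<dots> = (u / v) / sqrt ((x - p) * (r - x))" using v(1) by simp
    finally show ?thesis by (simp add: u_def v_def real_sqrt_divide)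
  qed
  ultimately show "(\<lambda>n. \<bar>rcauchy (\<tau> n) x\<bar>) \<longlonglongrightarrow> sqrt (\<bar>x - c\<bar> / \<bar>x - d\<bar>) / sqrt ((x - p) * (r - x))" by simp
  assume ca: "c = a"
  then have db: "d = b" using cd ab by auto
  have eq: "(\<integral>\<^sup>+t. ennreal (indicator {..a} t / (x - t)) \<partial>\<tau> n) = ennreal (\<integral>t. tail_kernel a b x t \<partial>\<omega> n)" for n
  proof -
    note [measurable_cong] = prob_measure_onD(1)[OF m[of n]]
    interpret W: prob_space "\<omega> n" using prob_measure_onD(2)[OF \<omega>m] .
    have "AE t in \<tau> n. t \<noteq> c" by (rule endpoint_zero_integrable(1)[OF m ab(2) gap cd \<tau>(2)])
    then have "AE t in \<tau> n. ennreal (indicator {..a} t / (x - t)) = ennreal (tail_kernel a b x t) * ennreal (fill_weight c d t)"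
    proof eventually_elim
      case (elim t)
      show ?case
      proof (cases "t < a")
        case True
        have "tail_kernel a b x t * fill_weight c d t = 1 / (x - t)"
        proof -
          have "tail_kernel a b x t * fill_weight c d t = (sqrt ((a - t) / (b - t)) * sqrt ((b - t) / (a - t))) / (x - t)"
            using True by (simp add: tail_kernel_def fill_weight_def ca db)
          also have "sqrt ((a - t) / (b - t)) * sqrt ((b - t) / (a - t)) = 1"
            using True ab by (simp flip: real_sqrt_mult)
          finally show ?thesis .
        qed
        then show ?thesis using True tail_kernel_bound(1)[OF xb] by (simp flip: ennreal_mult')
      next
        case False
        then show ?thesis using elim ca by (simp add: tail_kernel_def)
      qed
    qed
    then have "(\<integral>\<^sup>+t. ennreal (indicator {..a} t / (x - t)) \<partial>\<tau> n) = (\<integral>\<^sup>+t. ennreal (tail_kernel a b x t) * ennreal (fill_weight c d t) \<partial>\<tau> n)"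
      by (rule nn_integral_cong_AE)
    also have "\<dots> = (\<integral>\<^sup>+t. ennreal (tail_kernel a b x t) \<partial>\<omega> n)"
      by (rule \<omega>(3)[symmetric]) (auto simp: tail_kernel_def)
    also have "\<dots> = ennreal (\<integral>t. tail_kernel a b x t \<partial>\<omega> n)"
    proof (rule nn_integral_eq_integral)
      note [measurable_cong] = prob_measure_onD(1)[OF \<omega>m[of n]]
      show "integrable (\<omega> n) (tail_kernel a b x)"
        by (rule W.integrable_const_bound[where B = "1 / (x - a)"]) (use tail_kernel_bound[OF xb] in auto)
    qed (use tail_kernel_bound[OF xb] in auto)
    finally show ?thesis .
  qed
  have "(\<lambda>n. \<integral>t. tail_kernel a b x t \<partial>\<omega> n) \<longlonglongrightarrow> (\<integral>t. tail_kernel a b x t \<partial>arcsine p r)"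
    by (rule weak_conv_imp_integral_bdd_continuous_conv[OF prob_measure_on_real_distribution[OF \<omega>m] rdA wc])
      (use tail_kernel_continuous[OF xb] tail_kernel_bound[OF xb] in auto)
  then show "(\<lambda>n. \<integral>\<^sup>+t. ennreal (indicator {..a} t / (x - t)) \<partial>\<tau> n) \<longlonglongrightarrow> ennreal (\<integral>t. tail_kernel a b x t \<partial>arcsine p r)"
    unfolding eq by (intro tendsto_ennrealI)
qed

section \<open>Finitely many gaps\<close>

lemma fill_weight_measurable [measurable]: "fill_weight c d \<in> borel_measurable borel"
  unfolding fill_weight_def[abs_def] by measurable

text \<open>The factor (s - c)/(s - g) is positive outside the gap that contains c and g.\<close>
lemma zero_at_move_other:
  assumes z: "zero_at \<mu> u v e" and gap: "K \<inter> {u<..<v} = {}" and ab: "a \<in> K" "b \<in> K" "{u<..<v} \<inter> {a<..<b} = {}"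
    and c: "c \<in> {a..b}" "\<gamma> \<in> {a..b}"
    and eq: "\<And>s. apart K (of_real s) \<Longrightarrow> rcauchy \<mu>' s * (s - \<gamma>) = rcauchy \<mu> s * (s - c)"
  shows "zero_at \<mu>' u v e"
  unfolding zero_at_def
proof
  fix s assume s: "s \<in> {u<..<v}"
  have "s \<noteq> a" "s \<noteq> b" "s \<notin> {a<..<b}" using s gap ab by auto
  then have "s < a \<or> b < s" by auto
  then have pos: "0 < (s - c) * (s - \<gamma>)" using c by (auto intro: mult_neg_neg)
  have "(rcauchy \<mu>' s * (s - e)) * (s - \<gamma>)\<^sup>2 = (rcauchy \<mu>' s * (s - \<gamma>)) * ((s - e) * (s - \<gamma>))" by algebra
  also have "\<dots> = (rcauchy \<mu> s * (s - e)) * ((s - c) * (s - \<gamma>))" unfolding eq[OF apart_gap[OF s gap]] by algebra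
  also have "\<dots> \<ge> 0"
  proof (rule mult_nonneg_nonneg)
    show "0 \<le> rcauchy \<mu> s * (s - e)" using z s unfolding zero_at_def by blast
  qed (use pos in simp)
  finally have "0 \<le> (rcauchy \<mu>' s * (s - e)) * (s - \<gamma>)\<^sup>2" .
  moreover have "0 < (s - \<gamma>)\<^sup>2" using pos by auto
  ultimately show "0 \<le> rcauchy \<mu>' s * (s - e)" by (metis mult_neg_pos not_le)
qed

text \<open>The statement collects what moving one zero does: it leaves zeros in other gaps in place, increases the
mass on the side of d, and increases the transform at points from which c is the farthest point of the gap.\<close>
lemma move_zeros:
  fixes \<alpha> \<beta> c d :: "nat \<Rightarrow> real"
  assumes A: "finite A" and KB: "K \<in> sets borel"
    and gaps: "\<And>j. j \<in> A \<Longrightarrow> \<alpha> j < \<beta> j" "\<And>j. j \<in> A \<Longrightarrow> K \<inter> {\<alpha> j<..<\<beta> j} = {}"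
      "\<And>j. j \<in> A \<Longrightarrow> \<alpha> j \<in> K" "\<And>j. j \<in> A \<Longrightarrow> \<beta> j \<in> K"
    and disj: "\<And>i j. i \<in> A \<Longrightarrow> j \<in> A \<Longrightarrow> i \<noteq> j \<Longrightarrow> {\<alpha> i<..<\<beta> i} \<inter> {\<alpha> j<..<\<beta> j} = {}"
    and cd: "\<And>j. j \<in> A \<Longrightarrow> (c j = \<alpha> j \<and> d j = \<beta> j) \<or> (c j = \<beta> j \<and> d j = \<alpha> j)"
    and \<sigma>: "\<sigma> \<in> reflectionless_measures K"
  shows "\<exists>\<sigma>'\<in>reflectionless_measures K. (\<forall>j\<in>A. zero_at \<sigma>' (\<alpha> j) (\<beta> j) (c j)) \<and>
    (\<forall>u v e. K \<inter> {u<..<v} = {} \<longrightarrow> (\<forall>j\<in>A. {u<..<v} \<inter> {\<alpha> j<..<\<beta> j} = {}) \<longrightarrow> zero_at \<sigma> u v e \<longrightarrow> zero_at \<sigma>' u v e) \<and>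
    (\<forall>g. g \<in> borel_measurable borel \<longrightarrow> (\<forall>t. g t \<noteq> 0 \<longrightarrow> (\<forall>j\<in>A. 0 \<le> (t - d j) * (d j - c j))) \<longrightarrow> (\<integral>\<^sup>+t. g t \<partial>\<sigma>) \<le> (\<integral>\<^sup>+t. g t \<partial>\<sigma>')) \<and>
    (\<forall>x. apart K (of_real x) \<longrightarrow> (\<forall>j\<in>A. \<forall>\<gamma>\<in>{\<alpha> j..\<beta> j}. \<bar>x - \<gamma>\<bar> \<le> \<bar>x - c j\<bar>) \<longrightarrow> \<bar>rcauchy \<sigma> x\<bar> \<le> \<bar>rcauchy \<sigma>' x\<bar>)"
    (is "\<exists>\<sigma>'\<in>_. ?Q A \<sigma>'")
  using A gaps disj cd
proof (induction A rule: finite_induct)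
  case empty
  show ?case by (rule bexI[OF _ \<sigma>]) simp
next
  case (insert j A)
  from insert.IH[OF insert.prems(1-6)] obtain \<sigma>1 where \<sigma>1: "\<sigma>1 \<in> reflectionless_measures K" and Q1: "?Q A \<sigma>1"
    by (smt (verit) insertI2)
  have j: "j \<in> insert j A" by simp
  note cdj = insert.prems(6)[OF j]
  show ?case
  proof (rule move_reflectionless[OF \<sigma>1 KB insert.prems(1-4)[OF j] cdj])
    fix \<sigma>2 \<gamma> assume *: "\<gamma> \<in> {\<alpha> j..\<beta> j}" "\<sigma>2 \<in> reflectionless_measures K"
      "\<And>s. apart K (of_real s) \<Longrightarrow> rcauchy \<sigma>2 s * (s - \<gamma>) = rcauchy \<sigma>1 s * (s - c j)"
      "zero_at \<sigma>2 (\<alpha> j) (\<beta> j) (c j)"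
      "\<And>g. g \<in> borel_measurable borel \<Longrightarrow> (\<And>t. g t \<noteq> 0 \<Longrightarrow> 0 \<le> (t - d j) * (d j - c j))
        \<Longrightarrow> (\<integral>\<^sup>+t. g t \<partial>\<sigma>1) \<le> (\<integral>\<^sup>+t. g t \<partial>\<sigma>2)"
    have cj: "c j \<in> {\<alpha> j..\<beta> j}" using cdj insert.prems(1)[OF j] by auto
    have keep: "zero_at \<sigma>2 u v e" if "zero_at \<sigma>1 u v e" "K \<inter> {u<..<v} = {}" "{u<..<v} \<inter> {\<alpha> j<..<\<beta> j} = {}" for u v e
      by (rule zero_at_move_other[OF that(1,2) insert.prems(3,4)[OF j] that(3) cj *(1) *(3)])
    have "?Q (insert j A) \<sigma>2"
    proof (intro conjI ballI allI impI)
      fix i assume "i \<in> insert j A"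
      then show "zero_at \<sigma>2 (\<alpha> i) (\<beta> i) (c i)"
      proof
        assume i: "i \<in> A"
        then have "i \<noteq> j" using insert.hyps by auto
        with i Q1 insert.prems(2,5)[of i] j show ?thesis by (intro keep) auto
      qed (use *(4) in simp)
    next
      fix u v e assume "K \<inter> {u<..<v} = {}" "\<forall>j\<in>insert j A. {u<..<v} \<inter> {\<alpha> j<..<\<beta> j} = {}" "zero_at \<sigma> u v e"
      then show "zero_at \<sigma>2 u v e" using Q1 by (intro keep) auto
    next
      fix g :: "real \<Rightarrow> ennreal" assume g: "g \<in> borel_measurable borel"
        "\<forall>t. g t \<noteq> 0 \<longrightarrow> (\<forall>j\<in>insert j A. 0 \<le> (t - d j) * (d j - c j))"
      have "(\<integral>\<^sup>+t. g t \<partial>\<sigma>) \<le> (\<integral>\<^sup>+t. g t \<partial>\<sigma>1)" using Q1 g by auto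
      also have "\<dots> \<le> (\<integral>\<^sup>+t. g t \<partial>\<sigma>2)" using g by (intro *(5)) auto
      finally show "(\<integral>\<^sup>+t. g t \<partial>\<sigma>) \<le> (\<integral>\<^sup>+t. g t \<partial>\<sigma>2)" .
    next
      fix x assume x: "apart K (of_real x)" "\<forall>j\<in>insert j A. \<forall>\<gamma>\<in>{\<alpha> j..\<beta> j}. \<bar>x - \<gamma>\<bar> \<le> \<bar>x - c j\<bar>"
      have 1: "\<bar>rcauchy \<sigma> x\<bar> \<le> \<bar>rcauchy \<sigma>1 x\<bar>" using Q1 x by auto
      have "c j \<in> K" using cdj insert.prems(3,4)[OF j] by auto
      then have ne: "\<bar>x - c j\<bar> > 0" using apart_notin[OF x(1)] by auto
      have "\<bar>rcauchy \<sigma>1 x\<bar> * \<bar>x - c j\<bar> = \<bar>rcauchy \<sigma>2 x\<bar> * \<bar>x - \<gamma>\<bar>"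
        using *(3)[OF x(1)] by (simp flip: abs_mult)
      also have "\<dots> \<le> \<bar>rcauchy \<sigma>2 x\<bar> * \<bar>x - c j\<bar>" using x(2) *(1) j by (intro mult_left_mono) auto
      finally have "\<bar>rcauchy \<sigma>1 x\<bar> \<le> \<bar>rcauchy \<sigma>2 x\<bar>" using ne by simp
      with 1 show "\<bar>rcauchy \<sigma> x\<bar> \<le> \<bar>rcauchy \<sigma>2 x\<bar>" by linarith
    qed
    with *(2) show ?thesis by blast
  qed
qed

lemma fill_gaps:
  fixes \<alpha> \<beta> c d :: "nat \<Rightarrow> real"
  assumes A: "finite A" and KB: "K \<in> sets borel"
    and gaps: "\<And>j. j \<in> A \<Longrightarrow> \<alpha> j < \<beta> j" "\<And>j. j \<in> A \<Longrightarrow> K \<inter> {\<alpha> j<..<\<beta> j} = {}"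
    and disj: "\<And>i j. i \<in> A \<Longrightarrow> j \<in> A \<Longrightarrow> i \<noteq> j \<Longrightarrow> {\<alpha> i<..<\<beta> i} \<inter> {\<alpha> j<..<\<beta> j} = {}"
    and cd: "\<And>j. j \<in> A \<Longrightarrow> (c j = \<alpha> j \<and> d j = \<beta> j) \<or> (c j = \<beta> j \<and> d j = \<alpha> j)"
    and \<sigma>: "\<sigma> \<in> reflectionless_measures K"
    and z: "\<And>j. j \<in> A \<Longrightarrow> zero_at \<sigma> (\<alpha> j) (\<beta> j) (c j)"
  shows "\<exists>\<tau>\<in>reflectionless_measures (K \<union> (\<Union>j\<in>A. {\<alpha> j<..<\<beta> j})).
    (\<forall>s. apart (K \<union> (\<Union>j\<in>A. {\<alpha> j<..<\<beta> j})) (of_real s) \<longrightarrow> rcauchy \<tau> s = rcauchy \<sigma> s * (\<Prod>j\<in>A. fill_weight (c j) (d j) s)) \<and>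
    (\<forall>g. g \<in> borel_measurable borel \<longrightarrow> (\<forall>j\<in>A. \<forall>t\<in>{\<alpha> j<..<\<beta> j}. g t = 0) \<longrightarrow>
      (\<integral>\<^sup>+t. g t \<partial>\<tau>) = (\<integral>\<^sup>+t. g t * ennreal (\<Prod>j\<in>A. fill_weight (c j) (d j) t) \<partial>\<sigma>))"
    (is "\<exists>\<tau>\<in>reflectionless_measures (?K A). ?Q A \<tau>")
  using A gaps disj cd z
proof (induction A rule: finite_induct)
  case empty
  show ?case using \<sigma> by (intro bexI[of _ \<sigma>]) auto
next
  case (insert j A)
  have "\<exists>\<tau>\<in>reflectionless_measures (?K A). ?Q A \<tau>"
    by (rule insert.IH) (use insert.prems in auto)
  then obtain \<tau> where \<tau>: "\<tau> \<in> reflectionless_measures (?K A)" and Q: "?Q A \<tau>" by blast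
  have j: "j \<in> insert j A" by simp
  note cdj = insert.prems(4)[OF j]
  have KAB: "?K A \<in> sets borel" using KB insert.hyps(1) by (intro sets.Un sets.finite_UN) auto
  have disjA: "{\<alpha> i<..<\<beta> i} \<inter> {\<alpha> j<..<\<beta> j} = {}" if "i \<in> A" for i
    using insert.prems(3)[of i j] that insert.hyps(2) by auto
  have gapj: "?K A \<inter> {\<alpha> j<..<\<beta> j} = {}" using insert.prems(2)[OF j] disjA by blast
  have zj: "zero_at \<tau> (\<alpha> j) (\<beta> j) (c j)"
    unfolding zero_at_def
  proof
    fix s assume s: "s \<in> {\<alpha> j<..<\<beta> j}"
    have "0 \<le> (\<Prod>i\<in>A. fill_weight (c i) (d i) s)"
    proof (rule prod_nonneg)
      fix i assume i: "i \<in> A"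
      then have "s \<notin> {\<alpha> i<..<\<beta> i}" using disjA[OF i] s by auto
      then show "0 \<le> fill_weight (c i) (d i) s"
        using insert.prems(4)[of i] insert.prems(1)[of i] i by (intro fill_weight_nonneg(2)) auto
    qed
    moreover have "0 \<le> rcauchy \<sigma> s * (s - c j)" using insert.prems(5)[OF j] s by (auto simp: zero_at_def)
    ultimately have "0 \<le> (rcauchy \<sigma> s * (s - c j)) * (\<Prod>i\<in>A. fill_weight (c i) (d i) s)" by simp
    also have "\<dots> = rcauchy \<tau> s * (s - c j)" using Q apart_gap[OF s gapj] by simp
    finally show "0 \<le> rcauchy \<tau> s * (s - c j)" .
  qed
  have Keq: "?K A \<union> {\<alpha> j<..<\<beta> j} = ?K (insert j A)" by auto
  show ?case
  proof (rule fill_reflectionless[OF \<tau> KAB insert.prems(1)[OF j] gapj cdj zj], unfold Keq)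
    fix \<tau>' assume *: "\<tau>' \<in> reflectionless_measures (?K (insert j A))"
      "\<And>s. apart (?K (insert j A)) (of_real s) \<Longrightarrow> rcauchy \<tau>' s = rcauchy \<tau> s * fill_weight (c j) (d j) s"
      "\<And>g. g \<in> borel_measurable borel \<Longrightarrow> (\<And>t. t \<in> {\<alpha> j<..<\<beta> j} \<Longrightarrow> g t = 0)
        \<Longrightarrow> (\<integral>\<^sup>+t. g t \<partial>\<tau>') = (\<integral>\<^sup>+t. g t * ennreal (fill_weight (c j) (d j) t) \<partial>\<tau>)"
    have "?Q (insert j A) \<tau>'"
    proof (intro conjI allI impI)
      fix s assume s: "apart (?K (insert j A)) (of_real s)"
      then have "apart (?K A) (of_real s)" by (rule apart_mono) auto
      then show "rcauchy \<tau>' s = rcauchy \<sigma> s * (\<Prod>j\<in>insert j A. fill_weight (c j) (d j) s)"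
        using *(2)[OF s] Q insert.hyps by simp
    next
      fix g :: "real \<Rightarrow> ennreal" assume [measurable]: "g \<in> borel_measurable borel" and g: "\<forall>j\<in>insert j A. \<forall>t\<in>{\<alpha> j<..<\<beta> j}. g t = 0"
      have "(\<integral>\<^sup>+t. g t \<partial>\<tau>') = (\<integral>\<^sup>+t. g t * ennreal (fill_weight (c j) (d j) t) \<partial>\<tau>)"
        using g by (intro *(3)) auto
      also have "\<dots> = (\<integral>\<^sup>+t. g t * ennreal (fill_weight (c j) (d j) t) * ennreal (\<Prod>j\<in>A. fill_weight (c j) (d j) t) \<partial>\<sigma>)"
        using g Q by simp
      also have "\<dots> = (\<integral>\<^sup>+t. g t * ennreal (\<Prod>j\<in>insert j A. fill_weight (c j) (d j) t) \<partial>\<sigma>)"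
      proof (rule nn_integral_cong)
        fix t
        show "g t * ennreal (fill_weight (c j) (d j) t) * ennreal (\<Prod>j\<in>A. fill_weight (c j) (d j) t)
          = g t * ennreal (\<Prod>j\<in>insert j A. fill_weight (c j) (d j) t)"
        proof (cases "g t = 0")
          case False
          then have "t \<notin> {\<alpha> j<..<\<beta> j}" using g by auto
          then have "0 \<le> fill_weight (c j) (d j) t" using cdj insert.prems(1)[OF j] by (intro fill_weight_nonneg(2)) auto
          then show ?thesis using insert.hyps by (simp add: ennreal_mult' mult.assoc)
        qed simp
      qed
      finally show "(\<integral>\<^sup>+t. g t \<partial>\<tau>') = (\<integral>\<^sup>+t. g t * ennreal (\<Prod>j\<in>insert j A. fill_weight (c j) (d j) t) \<partial>\<sigma>)" .
    qed
    with *(1) show ?thesis by blast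
  qed
qed

section \<open>The extremal value of the Cauchy transform\<close>

text \<open>The square root of far distance over near distance is the factor of the product in the theorem, but
symmetric in the two endpoints.\<close>
definition gap_factor :: "(nat \<Rightarrow> real) \<Rightarrow> (nat \<Rightarrow> real) \<Rightarrow> real \<Rightarrow> nat \<Rightarrow> real" where
  "gap_factor \<alpha> \<beta> x j = sqrt (max \<bar>x - \<alpha> j\<bar> \<bar>x - \<beta> j\<bar> / min \<bar>x - \<alpha> j\<bar> \<bar>x - \<beta> j\<bar>)"

definition extremal_value :: "nat set \<Rightarrow> (nat \<Rightarrow> real) \<Rightarrow> (nat \<Rightarrow> real) \<Rightarrow> real \<Rightarrow> real" where
  "extremal_value J \<alpha> \<beta> x = (\<Prod>j. if j \<in> J then gap_factor \<alpha> \<beta> x j else 1) / sqrt ((x - \<beta> 0) * (\<alpha> 0 - x))"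

lemma zero_at_scaled:
  assumes "zero_at \<mu> u v e" "\<And>s. s \<in> {u<..<v} \<Longrightarrow> rcauchy \<mu>' s = rcauchy \<mu> s * w s" "\<And>s. s \<in> {u<..<v} \<Longrightarrow> 0 \<le> w s"
  shows "zero_at \<mu>' u v e"
  unfolding zero_at_def
proof
  fix s assume s: "s \<in> {u<..<v}"
  have "0 \<le> (rcauchy \<mu> s * (s - e)) * w s"
  proof (rule mult_nonneg_nonneg)
    show "0 \<le> rcauchy \<mu> s * (s - e)" using assms(1) s unfolding zero_at_def by blast
  qed (rule assms(3)[OF s])
  also have "\<dots> = rcauchy \<mu>' s * (s - e)" using assms(2)[OF s] by simp
  finally show "0 \<le> rcauchy \<mu>' s * (s - e)" .
qed

lemma gap_split:
  assumes \<mu>: "prob_measure_on K \<mu>" and gap: "K \<inter> {a<..<b} = {}" and x: "x \<in> {a<..<b}"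
  obtains P N where "P \<ge> 0" "N \<ge> 0" "(\<integral>\<^sup>+t. ennreal (indicator {b..} t / (t - x)) \<partial>\<mu>) = ennreal P"
    "(\<integral>\<^sup>+t. ennreal (indicator {..a} t / (x - t)) \<partial>\<mu>) = ennreal N" "rcauchy \<mu> x = P - N"
    "(\<integral>t. 1 / \<bar>t - x\<bar> \<partial>\<mu>) = P + N"
proof -
  note [measurable_cong] = prob_measure_onD(1)[OF \<mu>]
  have int: "integrable \<mu> (\<lambda>t. \<bar>1 / (t - x)\<bar>)"
    by (intro integrable_abs integrable_rcauchy[OF \<mu> apart_gap[OF x gap]])
  have ip: "integrable \<mu> (\<lambda>t. indicator {b..} t / (t - x))"
    by (rule Bochner_Integration.integrable_bound[OF int]) (auto simp: indicator_def)
  have iN: "integrable \<mu> (\<lambda>t. indicator {..a} t / (x - t))"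
    by (rule Bochner_Integration.integrable_bound[OF int]) (auto simp: indicator_def abs_minus_commute)
  have p0: "0 \<le> indicator {b..} t / (t - x)" and n0: "0 \<le> indicator {..a} t / (x - t)" for t
    using x by (auto simp: indicator_def)
  show ?thesis
  proof (rule that)
    show "0 \<le> (\<integral>t. indicator {b..} t / (t - x) \<partial>\<mu>)" "0 \<le> (\<integral>t. indicator {..a} t / (x - t) \<partial>\<mu>)"
      using p0 n0 by (auto intro: Bochner_Integration.integral_nonneg)
    show "(\<integral>\<^sup>+t. ennreal (indicator {b..} t / (t - x)) \<partial>\<mu>) = ennreal (\<integral>t. indicator {b..} t / (t - x) \<partial>\<mu>)"
      using ip p0 by (intro nn_integral_eq_integral) auto
    show "(\<integral>\<^sup>+t. ennreal (indicator {..a} t / (x - t)) \<partial>\<mu>) = ennreal (\<integral>t. indicator {..a} t / (x - t) \<partial>\<mu>)"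
      using iN n0 by (intro nn_integral_eq_integral) auto
    have side: "AE t in \<mu>. t \<le> a \<or> b \<le> t"
      using prob_measure_onD(3)[OF \<mu>] by eventually_elim (use gap in force)
    have "rcauchy \<mu> x = (\<integral>t. indicator {b..} t / (t - x) - indicator {..a} t / (x - t) \<partial>\<mu>)"
      unfolding rcauchy_def
    proof (rule integral_cong_AE)
      show "AE t in \<mu>. 1 / (t - x) = indicator {b..} t / (t - x) - indicator {..a} t / (x - t)"
        using side
      proof eventually_elim
        case (elim t)
        have "1 / (t - x) = - (1 / (x - t))" by (metis minus_diff_eq divide_minus_right)
        then show ?case using elim x by (auto simp: indicator_def)
      qed
    qed auto
    then show "rcauchy \<mu> x = (\<integral>t. indicator {b..} t / (t - x) \<partial>\<mu>) - (\<integral>t. indicator {..a} t / (x - t) \<partial>\<mu>)"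
      using ip iN by simp
    have "(\<integral>t. 1 / \<bar>t - x\<bar> \<partial>\<mu>) = (\<integral>t. indicator {b..} t / (t - x) + indicator {..a} t / (x - t) \<partial>\<mu>)"
    proof (rule integral_cong_AE)
      show "AE t in \<mu>. 1 / \<bar>t - x\<bar> = indicator {b..} t / (t - x) + indicator {..a} t / (x - t)"
        using side by eventually_elim (use x in \<open>auto simp: indicator_def\<close>)
    qed auto
    then show "(\<integral>t. 1 / \<bar>t - x\<bar> \<partial>\<mu>) = (\<integral>t. indicator {b..} t / (t - x) \<partial>\<mu>) + (\<integral>t. indicator {..a} t / (x - t) \<partial>\<mu>)"
      using ip iN by simp
  qed
qed

text \<open>In terms of the distance u to the near endpoint and the length h of the gap, the weight is the
square root of u/(u + h).\<close>
lemma fill_weight_far_mono: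
  assumes cd: "(c = a \<and> d = b) \<or> (c = b \<and> d = a)" and ab: "a < b"
    and x: "0 < (x - d) * (d - c)" and t: "\<bar>x - d\<bar> \<le> \<bar>t - d\<bar>" "0 < (t - d) * (d - c)"
  shows "fill_weight c d x \<le> fill_weight c d t"
proof -
  define h u v where "h = \<bar>d - c\<bar>" and "u = \<bar>x - d\<bar>" and "v = \<bar>t - d\<bar>"
  have h: "h > 0" "u > 0" "v > 0" "u \<le> v" using cd ab x t by (auto simp: h_def u_def v_def)
  have eq: "(d - y) / (c - y) = \<bar>y - d\<bar> / (\<bar>y - d\<bar> + h)" if "0 < (y - d) * (d - c)" for y
  proof (cases "d > c")
    case True
    then have y: "y - d > 0" using that by (simp add: zero_less_mult_iff)
    have "(d - y) / (c - y) = (- (y - d)) / (- (y - c))" by simp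
    also have "\<dots> = (y - d) / (y - c)" by (rule minus_divide_divide)
    finally show ?thesis using y True by (simp add: h_def)
  next
    case False
    then have y: "y - d < 0" "d < c" using that cd ab by (auto simp: zero_less_mult_iff)
    then show ?thesis by (simp add: h_def)
  qed
  have "u / (u + h) \<le> v / (v + h)" using h by (simp add: divide_simps) (simp add: algebra_simps)
  then show ?thesis unfolding fill_weight_def eq[OF x] eq[OF t(2)] u_def v_def by (rule real_sqrt_le_mono)
qed

locale inner_gap =
  fixes E :: "real set" and J :: "nat set" and \<alpha> \<beta> :: "nat \<Rightarrow> real" and k :: nat and x :: real
  assumes compact_E: "compact E" and E_ne: "E \<noteq> {}" and enum: "gap_enumeration E J \<alpha> \<beta>"
    and k: "k \<in> J" and x: "x \<in> {\<alpha> k<..<\<beta> k}"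
begin

abbreviation gap :: "nat \<Rightarrow> real set" where "gap j \<equiv> {\<alpha> j<..<\<beta> j}"

lemma E_bounds: "E \<subseteq> {\<beta> 0..\<alpha> 0}" and E_borel: "E \<in> sets borel"
proof -
  have b: "bdd_below E" "bdd_above E" using compact_imp_bounded[OF compact_E] by (simp_all add: bounded_imp_bdd_below bounded_imp_bdd_above)
  have "\<beta> 0 = Inf E" "\<alpha> 0 = Sup E" using enum by (auto simp: gap_enumeration_def)
  then show "E \<subseteq> {\<beta> 0..\<alpha> 0}" using b by (auto intro: cInf_lower cSup_upper)
  show "E \<in> sets borel" using compact_imp_closed[OF compact_E] by simp
qed

lemma gap_less: "j \<in> J \<Longrightarrow> \<alpha> j < \<beta> j"
  using enum by (auto simp: gap_enumeration_def)

lemma gap_sub: "j \<in> J \<Longrightarrow> gap j \<subseteq> {\<beta> 0..\<alpha> 0} - E"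
  using enum unfolding gap_enumeration_def by blast

lemma gap_E: "j \<in> J \<Longrightarrow> E \<inter> gap j = {}"
  using gap_sub by blast

lemma complement_E: "{\<beta> 0..\<alpha> 0} - E = (\<Union>j\<in>J. gap j)"
  using enum by (auto simp: gap_enumeration_def)

lemma gap_disjoint: "i \<in> J \<Longrightarrow> j \<in> J \<Longrightarrow> i \<noteq> j \<Longrightarrow> gap i \<inter> gap j = {}"
  using enum by (auto simp: gap_enumeration_def disjoint_family_on_def)

lemma gap_order:
  assumes "i \<in> J" "j \<in> J" "i \<noteq> j"
  shows "\<beta> i \<le> \<alpha> j \<or> \<beta> j \<le> \<alpha> i"
proof (rule ccontr)
  assume "\<not> ?thesis"
  then have "max (\<alpha> i) (\<alpha> j) < min (\<beta> i) (\<beta> j)" using gap_less assms by auto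
  then obtain t where "max (\<alpha> i) (\<alpha> j) < t" "t < min (\<beta> i) (\<beta> j)" using dense by blast
  then have "t \<in> gap i \<inter> gap j" by auto
  then show False using gap_disjoint[OF assms] by auto
qed

text \<open>An endpoint outside E would lie in another gap, and this gap would overlap the given one.\<close>
lemma endpoint_in_E:
  assumes j: "j \<in> J" and c: "c \<in> {\<alpha> j, \<beta> j}"
  shows "c \<in> E"
proof (rule ccontr)
  assume "c \<notin> E"
  have "c \<in> closure (gap j)" using c gap_less[OF j] by auto
  also have "\<dots> \<subseteq> {\<beta> 0..\<alpha> 0}" using gap_sub[OF j] by (intro closure_minimal) auto
  finally have "c \<in> {\<beta> 0..\<alpha> 0} - E" using \<open>c \<notin> E\<close> by auto
  then obtain i where i: "i \<in> J" "c \<in> gap i" using complement_E by auto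
  have "i \<noteq> j" using i c by auto
  from gap_order[OF i(1) j this] show False using i c gap_less[OF j] by auto
qed

lemma alpha_in: "j \<in> J \<Longrightarrow> \<alpha> j \<in> E" and beta_in: "j \<in> J \<Longrightarrow> \<beta> j \<in> E"
  using endpoint_in_E by auto

lemma order_k: "\<beta> 0 \<le> \<alpha> k" "\<alpha> k < \<beta> k" "\<beta> k \<le> \<alpha> 0" "\<alpha> k < x" "x < \<beta> k" "\<beta> 0 < x" "x < \<alpha> 0"
  using alpha_in[OF k] beta_in[OF k] E_bounds gap_less[OF k] x by auto

lemma apart_x: "E \<inter> gap k = {}" "apart E (of_real x)"
  using gap_E[OF k] apart_gap[OF x gap_E[OF k]] by auto

definition first_gaps :: "nat \<Rightarrow> nat set" where "first_gaps n = {j \<in> J. j \<le> n} - {k}"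

definition filled :: "nat set \<Rightarrow> real set" where "filled A = E \<union> (\<Union>j\<in>A. gap j)"

lemma first_gaps: "finite (first_gaps n)" "first_gaps n \<subseteq> J" "k \<notin> first_gaps n"
  by (auto simp: first_gaps_def intro: finite_subset[of _ "{..n}"])

lemma filled_borel: "finite A \<Longrightarrow> filled A \<in> sets borel"
  unfolding filled_def using E_borel by (intro sets.Un sets.finite_UN) auto

lemma filled_gap:
  assumes "A \<subseteq> J" "j \<in> J" "j \<notin> A"
  shows "filled A \<inter> gap j = {}"
  using gap_E[OF assms(2)] gap_disjoint[OF assms(2)] assms unfolding filled_def by blast

lemma filled_sub: "A \<subseteq> J \<Longrightarrow> k \<notin> A \<Longrightarrow> filled A \<subseteq> {\<beta> 0..\<alpha> 0} - gap k"
  using filled_gap[of A k] k E_bounds gap_sub unfolding filled_def by blast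

lemma filled_empty [simp]: "filled {} = E"
  by (simp add: filled_def)

lemma move_set:
  assumes B: "finite B" "B \<subseteq> J" and A: "finite A" "A \<subseteq> J" "A \<inter> B = {}"
    and cd: "\<And>j. j \<in> A \<Longrightarrow> (c j = \<alpha> j \<and> d j = \<beta> j) \<or> (c j = \<beta> j \<and> d j = \<alpha> j)"
    and \<sigma>: "\<sigma> \<in> reflectionless_measures (filled B)"
  obtains \<sigma>' where "\<sigma>' \<in> reflectionless_measures (filled B)" "\<And>j. j \<in> A \<Longrightarrow> zero_at \<sigma>' (\<alpha> j) (\<beta> j) (c j)"
    "\<And>i e. i \<in> J - A - B \<Longrightarrow> zero_at \<sigma> (\<alpha> i) (\<beta> i) e \<Longrightarrow> zero_at \<sigma>' (\<alpha> i) (\<beta> i) e"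
    "\<And>g. g \<in> borel_measurable borel \<Longrightarrow> (\<And>t j. g t \<noteq> 0 \<Longrightarrow> j \<in> A \<Longrightarrow> 0 \<le> (t - d j) * (d j - c j)) \<Longrightarrow> (\<integral>\<^sup>+t. g t \<partial>\<sigma>) \<le> (\<integral>\<^sup>+t. g t \<partial>\<sigma>')"
    "\<And>y. apart (filled B) (of_real y) \<Longrightarrow> (\<And>j \<gamma>. j \<in> A \<Longrightarrow> \<gamma> \<in> {\<alpha> j..\<beta> j} \<Longrightarrow> \<bar>y - \<gamma>\<bar> \<le> \<bar>y - c j\<bar>) \<Longrightarrow> \<bar>rcauchy \<sigma> y\<bar> \<le> \<bar>rcauchy \<sigma>' y\<bar>"
proof -
  have g1: "\<alpha> j < \<beta> j" and g2: "filled B \<inter> gap j = {}" and g3: "\<alpha> j \<in> filled B" and g4: "\<beta> j \<in> filled B" if "j \<in> A" for j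
    using that A B gap_less[of j] filled_gap[of B j] alpha_in[of j] beta_in[of j] by (auto simp: filled_def)
  have g5: "gap i \<inter> gap j = {}" if "i \<in> A" "j \<in> A" "i \<noteq> j" for i j
    using that A gap_disjoint by blast
  have "\<exists>\<sigma>'\<in>reflectionless_measures (filled B). (\<forall>j\<in>A. zero_at \<sigma>' (\<alpha> j) (\<beta> j) (c j)) \<and>
    (\<forall>u v e. filled B \<inter> {u<..<v} = {} \<longrightarrow> (\<forall>j\<in>A. {u<..<v} \<inter> gap j = {}) \<longrightarrow> zero_at \<sigma> u v e \<longrightarrow> zero_at \<sigma>' u v e) \<and>
    (\<forall>g. g \<in> borel_measurable borel \<longrightarrow> (\<forall>t. g t \<noteq> 0 \<longrightarrow> (\<forall>j\<in>A. 0 \<le> (t - d j) * (d j - c j))) \<longrightarrow> (\<integral>\<^sup>+t. g t \<partial>\<sigma>) \<le> (\<integral>\<^sup>+t. g t \<partial>\<sigma>')) \<and>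
    (\<forall>x. apart (filled B) (of_real x) \<longrightarrow> (\<forall>j\<in>A. \<forall>\<gamma>\<in>{\<alpha> j..\<beta> j}. \<bar>x - \<gamma>\<bar> \<le> \<bar>x - c j\<bar>) \<longrightarrow> \<bar>rcauchy \<sigma> x\<bar> \<le> \<bar>rcauchy \<sigma>' x\<bar>)"
    by (rule move_zeros[OF A(1) filled_borel[OF B(1)] _ _ _ _ _ _ \<sigma>]; rule g1 g2 g3 g4 g5 cd; assumption)
  then obtain \<sigma>' where s1: "\<sigma>' \<in> reflectionless_measures (filled B)" and s2: "\<forall>j\<in>A. zero_at \<sigma>' (\<alpha> j) (\<beta> j) (c j)"
    and s3: "\<forall>u v e. filled B \<inter> {u<..<v} = {} \<longrightarrow> (\<forall>j\<in>A. {u<..<v} \<inter> gap j = {}) \<longrightarrow> zero_at \<sigma> u v e \<longrightarrow> zero_at \<sigma>' u v e"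
    and s4: "\<forall>g. g \<in> borel_measurable borel \<longrightarrow> (\<forall>t. g t \<noteq> 0 \<longrightarrow> (\<forall>j\<in>A. 0 \<le> (t - d j) * (d j - c j))) \<longrightarrow> (\<integral>\<^sup>+t. g t \<partial>\<sigma>) \<le> (\<integral>\<^sup>+t. g t \<partial>\<sigma>')"
    and s5: "\<forall>x. apart (filled B) (of_real x) \<longrightarrow> (\<forall>j\<in>A. \<forall>\<gamma>\<in>{\<alpha> j..\<beta> j}. \<bar>x - \<gamma>\<bar> \<le> \<bar>x - c j\<bar>) \<longrightarrow> \<bar>rcauchy \<sigma> x\<bar> \<le> \<bar>rcauchy \<sigma>' x\<bar>"
    by (elim bexE conjE) (rule that; assumption)
  show ?thesis
  proof (rule that[OF s1])
    fix i e assume i: "i \<in> J - A - B" "zero_at \<sigma> (\<alpha> i) (\<beta> i) e"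
    moreover have "filled B \<inter> gap i = {}" using filled_gap[of B i] i B by auto
    moreover have "\<forall>j\<in>A. gap i \<inter> gap j = {}" using gap_disjoint[of i] i A by blast
    ultimately show "zero_at \<sigma>' (\<alpha> i) (\<beta> i) e" using s3 by blast
  qed (use s2 s4 s5 in auto)
qed

lemma fill_set:
  assumes B: "finite B" "B \<subseteq> J" and A: "finite A" "A \<subseteq> J" "A \<inter> B = {}"
    and cd: "\<And>j. j \<in> A \<Longrightarrow> (c j = \<alpha> j \<and> d j = \<beta> j) \<or> (c j = \<beta> j \<and> d j = \<alpha> j)"
    and \<sigma>: "\<sigma> \<in> reflectionless_measures (filled B)" and z: "\<And>j. j \<in> A \<Longrightarrow> zero_at \<sigma> (\<alpha> j) (\<beta> j) (c j)"
  obtains \<tau> where "\<tau> \<in> reflectionless_measures (filled (B \<union> A))"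
    "\<And>i e. i \<in> J - A - B \<Longrightarrow> zero_at \<sigma> (\<alpha> i) (\<beta> i) e \<Longrightarrow> zero_at \<tau> (\<alpha> i) (\<beta> i) e"
    "\<And>s. apart (filled (B \<union> A)) (of_real s) \<Longrightarrow> rcauchy \<tau> s = rcauchy \<sigma> s * (\<Prod>j\<in>A. fill_weight (c j) (d j) s)"
    "\<And>g. g \<in> borel_measurable borel \<Longrightarrow> (\<And>j t. j \<in> A \<Longrightarrow> t \<in> gap j \<Longrightarrow> g t = 0) \<Longrightarrow>
      (\<integral>\<^sup>+t. g t \<partial>\<tau>) = (\<integral>\<^sup>+t. g t * ennreal (\<Prod>j\<in>A. fill_weight (c j) (d j) t) \<partial>\<sigma>)"
proof -
  have g1: "\<alpha> j < \<beta> j" and g2: "filled B \<inter> gap j = {}" if "j \<in> A" for j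
    using that A B gap_less[of j] filled_gap[of B j] by auto
  have g5: "gap i \<inter> gap j = {}" if "i \<in> A" "j \<in> A" "i \<noteq> j" for i j
    using that A gap_disjoint by blast
  have eq: "filled B \<union> (\<Union>j\<in>A. gap j) = filled (B \<union> A)" by (auto simp: filled_def)
  have "\<exists>\<tau>\<in>reflectionless_measures (filled B \<union> (\<Union>j\<in>A. gap j)).
    (\<forall>s. apart (filled B \<union> (\<Union>j\<in>A. gap j)) (of_real s) \<longrightarrow> rcauchy \<tau> s = rcauchy \<sigma> s * (\<Prod>j\<in>A. fill_weight (c j) (d j) s)) \<and>
    (\<forall>g. g \<in> borel_measurable borel \<longrightarrow> (\<forall>j\<in>A. \<forall>t\<in>gap j. g t = 0) \<longrightarrow>
      (\<integral>\<^sup>+t. g t \<partial>\<tau>) = (\<integral>\<^sup>+t. g t * ennreal (\<Prod>j\<in>A. fill_weight (c j) (d j) t) \<partial>\<sigma>))"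
    by (rule fill_gaps[OF A(1) filled_borel[OF B(1)] _ _ _ _ \<sigma>]; rule g1 g2 g5 cd z; assumption)
  then obtain \<tau> where s1: "\<tau> \<in> reflectionless_measures (filled (B \<union> A))"
    and s3: "\<forall>s. apart (filled (B \<union> A)) (of_real s) \<longrightarrow> rcauchy \<tau> s = rcauchy \<sigma> s * (\<Prod>j\<in>A. fill_weight (c j) (d j) s)"
    and s4: "\<forall>g. g \<in> borel_measurable borel \<longrightarrow> (\<forall>j\<in>A. \<forall>t\<in>gap j. g t = 0) \<longrightarrow>
      (\<integral>\<^sup>+t. g t \<partial>\<tau>) = (\<integral>\<^sup>+t. g t * ennreal (\<Prod>j\<in>A. fill_weight (c j) (d j) t) \<partial>\<sigma>)"
    unfolding eq by (elim bexE conjE) (rule that; assumption)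
  show ?thesis
  proof (rule that[OF s1])
    fix i e assume i: "i \<in> J - A - B" and zi: "zero_at \<sigma> (\<alpha> i) (\<beta> i) e"
    have gi: "filled (B \<union> A) \<inter> gap i = {}" using filled_gap[of "B \<union> A" i] i A B by auto
    show "zero_at \<tau> (\<alpha> i) (\<beta> i) e"
    proof (rule zero_at_scaled[OF zi])
      fix s assume s: "s \<in> gap i"
      show "rcauchy \<tau> s = rcauchy \<sigma> s * (\<Prod>j\<in>A. fill_weight (c j) (d j) s)" using s3 apart_gap[OF s gi] by blast
      show "0 \<le> (\<Prod>j\<in>A. fill_weight (c j) (d j) s)"
      proof (rule prod_nonneg)
        fix j assume j: "j \<in> A"
        then have "s \<notin> gap j" using s gi unfolding filled_def by blast
        then show "0 \<le> fill_weight (c j) (d j) s" using cd[OF j] g1[OF j] by (intro fill_weight_nonneg(2)) auto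
      qed
    qed
  qed (use s3 s4 in auto)
qed

text \<open>What is left unfilled lies in the gaps with index above n; these sets decrease to the empty set because
the gaps are disjoint.\<close>
lemma unfilled_measure_lim:
  "(\<lambda>n. measure lborel ({\<beta> 0..\<alpha> 0} - gap k - filled (first_gaps n))) \<longlonglongrightarrow> 0"
proof -
  define D where "D n = (\<Union>j\<in>{j\<in>J. n < j}. gap j)" for n
  have Dm: "D n \<in> sets lborel" for n unfolding D_def by (intro sets.countable_UN') auto
  have Dsub: "D n \<subseteq> {\<beta> 0..\<alpha> 0}" for n using gap_sub unfolding D_def by blast
  have fin: "emeasure lborel (D n) \<noteq> \<infinity>" for n
  proof -
    have "emeasure lborel (D n) \<le> emeasure lborel {\<beta> 0..\<alpha> 0}" by (rule emeasure_mono[OF Dsub]) simp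
    also have "\<dots> < \<infinity>" by (simp add: emeasure_lborel_Icc_eq)
    finally show ?thesis by simp
  qed
  have "decseq D" unfolding D_def decseq_def by (intro allI impI UN_mono) auto
  moreover have "(\<Inter>n. D n) = {}"
  proof (rule ccontr)
    assume "(\<Inter>n. D n) \<noteq> {}"
    then obtain t where t: "\<And>n. t \<in> D n" by blast
    obtain j where j: "j \<in> J" "t \<in> gap j" using t[of 0] by (auto simp: D_def)
    obtain i where i: "i \<in> J" "j < i" "t \<in> gap i" using t[of j] by (auto simp: D_def)
    then show False using gap_disjoint[of i j] j by auto
  qed
  ultimately have "(\<lambda>n. measure lborel (D n)) \<longlonglongrightarrow> measure lborel {}"
    using Lim_measure_decseq[of D lborel] Dm fin by auto
  then have lim: "(\<lambda>n. measure lborel (D n)) \<longlonglongrightarrow> 0" by simp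
  show ?thesis
  proof (rule tendsto_sandwich[OF _ _ tendsto_const lim])
    show "\<forall>\<^sub>F n in sequentially. 0 \<le> measure lborel ({\<beta> 0..\<alpha> 0} - gap k - filled (first_gaps n))" by simp
    have "measure lborel ({\<beta> 0..\<alpha> 0} - gap k - filled (first_gaps n)) \<le> measure lborel (D n)" for n
    proof (rule measure_mono_fmeasurable)
      show "{\<beta> 0..\<alpha> 0} - gap k - filled (first_gaps n) \<subseteq> D n"
      proof
        fix t assume t: "t \<in> {\<beta> 0..\<alpha> 0} - gap k - filled (first_gaps n)"
        then have "t \<in> {\<beta> 0..\<alpha> 0} - E" by (auto simp: filled_def)
        then obtain j where j: "j \<in> J" "t \<in> gap j" using complement_E by auto
        then have "j \<noteq> k" "j \<notin> first_gaps n" using t by (auto simp: filled_def)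
        then show "t \<in> D n" using j by (auto simp: first_gaps_def D_def)
      qed
      show "{\<beta> 0..\<alpha> 0} - gap k - filled (first_gaps n) \<in> sets lborel"
        using filled_borel[OF first_gaps(1)] by auto
      show "D n \<in> fmeasurable lborel" using Dm fin by (auto simp: fmeasurable_def less_top)
    qed
    then show "\<forall>\<^sub>F n in sequentially. measure lborel ({\<beta> 0..\<alpha> 0} - gap k - filled (first_gaps n)) \<le> measure lborel (D n)" by simp
  qed
qed

lemma summable_gap_lengths: "summable (\<lambda>j. if j \<in> J then \<beta> j - \<alpha> j else 0)"
proof (rule summableI_nonneg_bounded)
  show "0 \<le> (if j \<in> J then \<beta> j - \<alpha> j else 0)" for j using gap_less[of j] by auto
  show "(\<Sum>j<n. if j \<in> J then \<beta> j - \<alpha> j else 0) \<le> \<alpha> 0 - \<beta> 0" for n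
  proof -
    let ?I = "{j \<in> {..<n}. j \<in> J}"
    have "ennreal (\<Sum>j\<in>?I. \<beta> j - \<alpha> j) = (\<Sum>j\<in>?I. emeasure lborel (gap j))"
      using gap_less by (subst sum_ennreal[symmetric]) (auto simp: less_imp_le intro!: sum.cong)
    also have "\<dots> = emeasure lborel (\<Union>j\<in>?I. gap j)"
      by (rule sum_emeasure) (use gap_disjoint in \<open>auto simp: disjoint_family_on_def\<close>)
    also have "\<dots> \<le> emeasure lborel {\<beta> 0..\<alpha> 0}"
      by (rule emeasure_mono) (use gap_sub in \<open>auto simp: subset_eq\<close>)
    also have "\<dots> = ennreal (\<alpha> 0 - \<beta> 0)" using order_k by simp
    finally have "(\<Sum>j\<in>?I. \<beta> j - \<alpha> j) \<le> \<alpha> 0 - \<beta> 0" using order_k by (subst (asm) ennreal_le_iff) auto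
    then show ?thesis by (simp add: sum.If_cases Int_def)
  qed
qed

definition far :: "nat \<Rightarrow> real" where "far j = (if \<bar>x - \<beta> j\<bar> \<le> \<bar>x - \<alpha> j\<bar> then \<alpha> j else \<beta> j)"
definition near :: "nat \<Rightarrow> real" where "near j = (if \<bar>x - \<beta> j\<bar> \<le> \<bar>x - \<alpha> j\<bar> then \<beta> j else \<alpha> j)"
abbreviation factor :: "nat \<Rightarrow> real" where "factor j \<equiv> gap_factor \<alpha> \<beta> x j"

lemma far_near: "(far j = \<alpha> j \<and> near j = \<beta> j) \<or> (far j = \<beta> j \<and> near j = \<alpha> j)"
  by (auto simp: far_def near_def)

lemma factor_far_near: "factor j = sqrt (\<bar>x - far j\<bar> / \<bar>x - near j\<bar>)"
  unfolding gap_factor_def far_def near_def by (auto simp: max_def min_def)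

lemma near_pos: "j \<in> J \<Longrightarrow> 0 < \<bar>x - near j\<bar>" and far_ge_near: "\<bar>x - near j\<bar> \<le> \<bar>x - far j\<bar>"
proof -
  show "0 < \<bar>x - near j\<bar>" if "j \<in> J"
  proof -
    have "near j \<in> E" using that alpha_in beta_in far_near[of j] by auto
    then show ?thesis using apart_notin[OF apart_x(2)] by auto
  qed
  show "\<bar>x - near j\<bar> \<le> \<bar>x - far j\<bar>" by (auto simp: far_def near_def)
qed

lemma factor_ge_1: "j \<in> J \<Longrightarrow> 1 \<le> factor j"
  using near_pos[of j] far_ge_near[of j] unfolding factor_far_near by (simp add: le_divide_eq)

lemma far_left: "j \<in> J \<Longrightarrow> \<beta> j \<le> \<alpha> k \<Longrightarrow> far j = \<alpha> j \<and> near j = \<beta> j"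
  using gap_less[of j] order_k unfolding far_def near_def by auto

lemma far_right: "j \<in> J \<Longrightarrow> \<beta> k \<le> \<alpha> j \<Longrightarrow> far j = \<beta> j \<and> near j = \<alpha> j"
  using gap_less[of j] order_k unfolding far_def near_def by auto

lemma far_max:
  assumes "j \<in> J" "\<gamma> \<in> {\<alpha> j..\<beta> j}"
  shows "\<bar>x - \<gamma>\<bar> \<le> \<bar>x - far j\<bar>"
  using assms unfolding far_def by auto

lemma weight_factor:
  assumes "j \<in> J" "j \<noteq> k"
  shows "fill_weight (far j) (near j) x * factor j = 1"
proof -
  have side: "\<beta> j \<le> \<alpha> k \<or> \<beta> k \<le> \<alpha> j" using gap_order[OF assms(1) k assms(2)] by auto
  have n: "\<bar>x - near j\<bar> > 0" using near_pos[OF assms(1)] .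
  then have f: "\<bar>x - far j\<bar> > 0" using far_ge_near[of j] by linarith
  have "(near j - x) / (far j - x) = \<bar>x - near j\<bar> / \<bar>x - far j\<bar>"
    using side
  proof
    assume l: "\<beta> j \<le> \<alpha> k"
    then have "near j - x < 0" "far j - x < 0" using far_left[OF assms(1) l] gap_less[OF assms(1)] order_k by auto
    moreover have "(near j - x) / (far j - x) = (x - near j) / (x - far j)" by (metis minus_diff_eq minus_divide_divide)
    ultimately show ?thesis by simp
  next
    assume r: "\<beta> k \<le> \<alpha> j"
    then have "near j - x > 0" "far j - x > 0" using far_right[OF assms(1) r] gap_less[OF assms(1)] order_k by auto
    then show ?thesis by (simp add: abs_minus_commute)
  qed
  then show ?thesis using n f unfolding fill_weight_def factor_far_near by (simp flip: real_sqrt_mult)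
qed

lemma weights_factors:
  assumes "A \<subseteq> J" "k \<notin> A"
  shows "(\<Prod>j\<in>A. fill_weight (far j) (near j) x) * (\<Prod>j\<in>A. factor j) = 1"
  unfolding prod.distrib[symmetric] by (rule prod.neutral) (use weight_factor assms in auto)

text \<open>Apart from gap k, the near endpoints keep a positive distance from x, so the factors differ from 1 by
at most a multiple of the gap lengths, whose sum is at most the length of the whole interval.\<close>
lemma convergent_factors: "convergent_prod (\<lambda>j. if j \<in> J then factor j else 1)"
proof -
  define \<delta> where "\<delta> = min (x - \<alpha> k) (\<beta> k - x)"
  have \<delta>: "\<delta> > 0" using x by (auto simp: \<delta>_def)
  define f where "f j = (if j \<in> J then factor j else 1)" for j
  have "summable (\<lambda>j. norm (f j - 1))"
  proof (rule summable_comparison_test_ev)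
    show "summable (\<lambda>j. (if j \<in> J then \<beta> j - \<alpha> j else 0) / \<delta>)"
      by (rule summable_divide[OF summable_gap_lengths])
    show "\<forall>\<^sub>F j in sequentially. norm (norm (f j - 1)) \<le> (if j \<in> J then \<beta> j - \<alpha> j else 0) / \<delta>"
      using eventually_gt_at_top[of k]
    proof eventually_elim
      case (elim j)
      show ?case
      proof (cases "j \<in> J")
        case True
        have "near j \<in> E" using True alpha_in beta_in far_near[of j] by auto
        then have "near j \<notin> gap k" using apart_x(1) by auto
        then have n: "\<delta> \<le> \<bar>x - near j\<bar>" using x by (auto simp: \<delta>_def)
        have n0: "\<bar>x - near j\<bar> > 0" using near_pos[OF True] .
        define q where "q = \<bar>x - far j\<bar> / \<bar>x - near j\<bar>"
        have q: "1 \<le> q" using far_ge_near[of j] n0 by (simp add: q_def)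
        have "sqrt q \<le> q"
        proof (rule real_le_lsqrt)
          show "q \<le> q\<^sup>2" using q by (simp add: power2_eq_square)
        qed (use q in auto)
        then have "factor j - 1 \<le> q - 1" by (simp add: factor_far_near q_def)
        also have "\<dots> = (\<bar>x - far j\<bar> - \<bar>x - near j\<bar>) / \<bar>x - near j\<bar>" using n0 by (simp add: q_def diff_divide_distrib)
        also have "\<dots> \<le> (\<beta> j - \<alpha> j) / \<delta>"
        proof (rule frac_le)
          show "\<bar>x - far j\<bar> - \<bar>x - near j\<bar> \<le> \<beta> j - \<alpha> j" using far_near[of j] gap_less[OF True] by auto
        qed (use n \<delta> gap_less[OF True] in auto)
        finally show ?thesis using factor_ge_1[OF True] True by (simp add: f_def)
      qed (simp add: f_def)
    qed
  qed
  then have "abs_convergent_prod f" by (rule summable_imp_abs_convergent_prod)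
  then show ?thesis unfolding f_def by (rule abs_convergent_prod_imp_convergent_prod)
qed

lemma first_factors_lim:
  "(\<lambda>n. \<Prod>j\<in>first_gaps n. factor j) \<longlonglongrightarrow> (\<Prod>j. if j \<in> J then factor j else 1) / factor k"
proof -
  have fk: "factor k > 0" using factor_ge_1[OF k] by simp
  have "(\<lambda>n. (\<Prod>j\<le>n. if j \<in> J then factor j else 1) / factor k) \<longlonglongrightarrow> (\<Prod>j. if j \<in> J then factor j else 1) / factor k"
    by (intro tendsto_divide convergent_prod_LIMSEQ convergent_factors tendsto_const) (use fk in simp)
  moreover have "\<forall>\<^sub>F n in sequentially. (\<Prod>j\<le>n. if j \<in> J then factor j else 1) / factor k = (\<Prod>j\<in>first_gaps n. factor j)"
    using eventually_ge_at_top[of k]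
  proof eventually_elim
    case (elim n)
    have "(\<Prod>j\<le>n. if j \<in> J then factor j else 1) = (\<Prod>j\<in>insert k (first_gaps n). factor j)"
      using elim k by (intro prod.mono_neutral_cong_right) (auto simp: first_gaps_def)
    also have "\<dots> = factor k * (\<Prod>j\<in>first_gaps n. factor j)" using first_gaps[of n] by (subst prod.insert) auto
    finally show ?case using fk by simp
  qed
  ultimately show ?thesis by (rule Lim_transform_eventually)
qed

lemma prob_of: "\<sigma> \<in> reflectionless_measures K \<Longrightarrow> prob_measure_on K \<sigma>"
  by (simp add: reflectionless_measures_def)

text \<open>The zeros of the first n gaps and of gap k are moved to the far endpoints.  Filling all of these gaps
except gap k divides the value at x by the corresponding factors, and leaves a measure whose transform at x has
a known limit.\<close>
lemma far_sequence:
  assumes \<sigma>: "\<sigma> \<in> reflectionless_measures E"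
  shows "\<exists>\<sigma>s. (\<forall>n. \<sigma>s n \<in> reflectionless_measures E \<and> \<bar>rcauchy \<sigma> x\<bar> \<le> \<bar>rcauchy (\<sigma>s n) x\<bar>) \<and>
    (\<lambda>n. \<bar>rcauchy (\<sigma>s n) x\<bar>) \<longlonglongrightarrow> extremal_value J \<alpha> \<beta> x"
proof -
  define Q where "Q n st \<longleftrightarrow> (case st of (\<sigma>', \<tau>) \<Rightarrow> \<sigma>' \<in> reflectionless_measures E \<and> \<bar>rcauchy \<sigma> x\<bar> \<le> \<bar>rcauchy \<sigma>' x\<bar> \<and>
     \<tau> \<in> reflectionless_measures (filled (first_gaps n)) \<and> zero_at \<tau> (\<alpha> k) (\<beta> k) (far k) \<and>
     rcauchy \<sigma>' x = rcauchy \<tau> x * (\<Prod>j\<in>first_gaps n. factor j))" for n st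
  have "\<exists>st. Q n st" for n
  proof -
    let ?A = "first_gaps n"
    have sub: "insert k ?A \<subseteq> J" using first_gaps k by auto
    have \<sigma>0: "\<sigma> \<in> reflectionless_measures (filled {})" using \<sigma> by simp
    obtain \<sigma>' where \<sigma>': "\<sigma>' \<in> reflectionless_measures E" "\<And>j. j \<in> insert k ?A \<Longrightarrow> zero_at \<sigma>' (\<alpha> j) (\<beta> j) (far j)"
      and le: "\<bar>rcauchy \<sigma> x\<bar> \<le> \<bar>rcauchy \<sigma>' x\<bar>"
    proof (rule move_set[of "{}" "insert k ?A" far near \<sigma>])
      fix \<sigma>' assume *: "\<sigma>' \<in> reflectionless_measures (filled {})" "\<And>j. j \<in> insert k ?A \<Longrightarrow> zero_at \<sigma>' (\<alpha> j) (\<beta> j) (far j)"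
        "\<And>y. apart (filled {}) (of_real y) \<Longrightarrow> (\<And>j \<gamma>. j \<in> insert k ?A \<Longrightarrow> \<gamma> \<in> {\<alpha> j..\<beta> j} \<Longrightarrow> \<bar>y - \<gamma>\<bar> \<le> \<bar>y - far j\<bar>) \<Longrightarrow> \<bar>rcauchy \<sigma> y\<bar> \<le> \<bar>rcauchy \<sigma>' y\<bar>"
      show thesis
      proof (rule that)
        show "\<bar>rcauchy \<sigma> x\<bar> \<le> \<bar>rcauchy \<sigma>' x\<bar>"
          by (rule *(3)) (use apart_x(2) far_max sub in auto)
      qed (use * in auto)
    qed (use first_gaps(1) sub far_near \<sigma>0 in auto)
    have \<sigma>'0: "\<sigma>' \<in> reflectionless_measures (filled {})" using \<sigma>' by simp
    have gk: "filled ?A \<inter> gap k = {}" using filled_gap[of ?A k] first_gaps k by auto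
    obtain \<tau> where \<tau>: "\<tau> \<in> reflectionless_measures (filled ?A)" and z: "zero_at \<tau> (\<alpha> k) (\<beta> k) (far k)"
      and eq: "rcauchy \<tau> x = rcauchy \<sigma>' x * (\<Prod>j\<in>?A. fill_weight (far j) (near j) x)"
    proof (rule fill_set[of "{}" ?A far near \<sigma>'])
      fix \<tau> assume *: "\<tau> \<in> reflectionless_measures (filled ({} \<union> ?A))"
        "\<And>i e. i \<in> J - ?A - {} \<Longrightarrow> zero_at \<sigma>' (\<alpha> i) (\<beta> i) e \<Longrightarrow> zero_at \<tau> (\<alpha> i) (\<beta> i) e"
        "\<And>s. apart (filled ({} \<union> ?A)) (of_real s) \<Longrightarrow> rcauchy \<tau> s = rcauchy \<sigma>' s * (\<Prod>j\<in>?A. fill_weight (far j) (near j) s)"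
      show thesis
      proof (rule that)
        show "zero_at \<tau> (\<alpha> k) (\<beta> k) (far k)" using *(2) \<sigma>'(2) k first_gaps(3) by auto
        show "rcauchy \<tau> x = rcauchy \<sigma>' x * (\<Prod>j\<in>?A. fill_weight (far j) (near j) x)"
          using *(3) apart_gap[OF x gk] by simp
      qed (use * in simp)
    qed (use first_gaps(1,2) far_near \<sigma>'0 \<sigma>'(2) in auto)
    from eq have "rcauchy \<tau> x * (\<Prod>j\<in>?A. factor j) = rcauchy \<sigma>' x"
      using weights_factors[of ?A] first_gaps[of n] by (simp add: mult.assoc)
    then show ?thesis using \<sigma>'(1) le \<tau> z unfolding Q_def by (intro exI[of _ "(\<sigma>', \<tau>)"]) auto
  qed
  then have "\<exists>f. \<forall>n. Q n (f n)" by (intro choice allI)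
  then obtain f where f: "\<And>n. Q n (f n)" by blast
  define \<sigma>s \<tau>s where "\<sigma>s n = fst (f n)" and "\<tau>s n = snd (f n)" for n
  have \<sigma>s: "\<sigma>s n \<in> reflectionless_measures E" "\<bar>rcauchy \<sigma> x\<bar> \<le> \<bar>rcauchy (\<sigma>s n) x\<bar>"
    "\<tau>s n \<in> reflectionless_measures (filled (first_gaps n))" "zero_at (\<tau>s n) (\<alpha> k) (\<beta> k) (far k)"
    "rcauchy (\<sigma>s n) x = rcauchy (\<tau>s n) x * (\<Prod>j\<in>first_gaps n. factor j)" for n
    using f[of n] unfolding Q_def \<sigma>s_def \<tau>s_def by (auto split: prod.splits)
  have lim: "(\<lambda>n. \<bar>rcauchy (\<tau>s n) x\<bar>) \<longlonglongrightarrow> factor k / sqrt ((x - \<beta> 0) * (\<alpha> 0 - x))"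
    unfolding factor_far_near
    by (rule one_gap_limit(1)[OF order_k(1,2,3) x far_near \<sigma>s(3,4) filled_borel[OF first_gaps(1)] filled_sub[OF first_gaps(2,3)] unfilled_measure_lim])
  have fk: "factor k > 0" using factor_ge_1[OF k] by simp
  have "(\<lambda>n. \<bar>rcauchy (\<tau>s n) x\<bar> * (\<Prod>j\<in>first_gaps n. factor j)) \<longlonglongrightarrow>
     factor k / sqrt ((x - \<beta> 0) * (\<alpha> 0 - x)) * ((\<Prod>j. if j \<in> J then factor j else 1) / factor k)"
    by (intro tendsto_mult lim first_factors_lim)
  moreover have "\<bar>rcauchy (\<tau>s n) x\<bar> * (\<Prod>j\<in>first_gaps n. factor j) = \<bar>rcauchy (\<sigma>s n) x\<bar>" for n
  proof -
    have "0 \<le> (\<Prod>j\<in>first_gaps n. factor j)"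
      using factor_ge_1 first_gaps(2)[of n] by (intro prod_nonneg) force
    then show ?thesis by (simp add: \<sigma>s(5) abs_mult)
  qed
  ultimately have "(\<lambda>n. \<bar>rcauchy (\<sigma>s n) x\<bar>) \<longlonglongrightarrow> extremal_value J \<alpha> \<beta> x"
    using fk by (simp add: extremal_value_def)
  then show ?thesis using \<sigma>s(1,2) by blast
qed

lemma rcauchy_le_extremal:
  assumes "\<sigma> \<in> reflectionless_measures E"
  shows "\<bar>rcauchy \<sigma> x\<bar> \<le> extremal_value J \<alpha> \<beta> x"
  using far_sequence[OF assms] by (auto intro: LIMSEQ_le_const)

lemma extremal_le_bound:
  assumes "\<sigma> \<in> reflectionless_measures E" "\<And>\<mu>. \<mu> \<in> reflectionless_measures E \<Longrightarrow> \<bar>rcauchy \<mu> x\<bar> \<le> B"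
  shows "extremal_value J \<alpha> \<beta> x \<le> B"
  using far_sequence[OF assms(1)] assms(2) by (auto intro: LIMSEQ_le_const2)

end

section \<open>The mass on one side of the gap\<close>

context inner_gap
begin

definition right_kernel :: "real \<Rightarrow> ennreal" where "right_kernel t = ennreal (indicator {\<beta> k..} t / (t - x))"
definition left_kernel :: "real \<Rightarrow> ennreal" where "left_kernel t = ennreal (indicator {..\<alpha> k} t / (x - t))"

lemma kernels_measurable [measurable]: "right_kernel \<in> borel_measurable borel" "left_kernel \<in> borel_measurable borel"
  unfolding right_kernel_def[abs_def] left_kernel_def[abs_def] by measurable

lemma right_kernel_support: "right_kernel t \<noteq> 0 \<Longrightarrow> \<beta> k \<le> t" and left_kernel_support: "left_kernel t \<noteq> 0 \<Longrightarrow> t \<le> \<alpha> k"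
  by (rule ccontr, simp add: right_kernel_def left_kernel_def)+

lemma weights_mono:
  assumes A: "finite A" "A \<subseteq> J" "k \<notin> A"
    and t: "(\<forall>j\<in>A. \<beta> j \<le> \<alpha> k) \<and> x \<le> t \<or> (\<forall>j\<in>A. \<beta> k \<le> \<alpha> j) \<and> t \<le> x"
  shows "(\<Prod>j\<in>A. fill_weight (far j) (near j) x) \<le> (\<Prod>j\<in>A. fill_weight (far j) (near j) t)"
proof (rule prod_mono)
  fix j assume j: "j \<in> A"
  then have jJ: "j \<in> J" using A by auto
  note l = gap_less[OF jJ]
  have fw: "0 \<le> fill_weight (far j) (near j) x"
  proof (rule fill_weight_nonneg(2)[OF far_near _ l])
    have "j \<noteq> k" using j A by auto
    then show "x \<notin> gap j" using gap_disjoint[OF jJ k] x by blast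
  qed
  have "fill_weight (far j) (near j) x \<le> fill_weight (far j) (near j) t"
    using t
  proof (elim disjE conjE)
    assume a: "\<forall>j\<in>A. \<beta> j \<le> \<alpha> k" "x \<le> t"
    then have "far j = \<alpha> j \<and> near j = \<beta> j" using far_left[OF jJ] j by auto
    moreover have "\<beta> j < x" using a j order_k by force
    ultimately show ?thesis using l a
      by (intro fill_weight_far_mono[of _ "\<alpha> j" _ "\<beta> j"]) auto
  next
    assume a: "\<forall>j\<in>A. \<beta> k \<le> \<alpha> j" "t \<le> x"
    then have "far j = \<beta> j \<and> near j = \<alpha> j" using far_right[OF jJ] j by auto
    moreover have "x < \<alpha> j" using a j order_k by force
    ultimately show ?thesis using l a
      by (intro fill_weight_far_mono[of _ "\<alpha> j" _ "\<beta> j"]) (auto intro: mult_neg_neg)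
  qed
  with fw show "0 \<le> fill_weight (far j) (near j) x \<and> fill_weight (far j) (near j) x \<le> fill_weight (far j) (near j) t" by simp
qed

lemma weighted_integral_ge:
  assumes [measurable]: "sets \<mu> = sets borel" and [measurable]: "g \<in> borel_measurable borel"
    and le: "\<And>t. g t \<noteq> 0 \<Longrightarrow> w0 \<le> w t" and eq: "(\<integral>\<^sup>+t. g t \<partial>\<nu>) = (\<integral>\<^sup>+t. g t * ennreal (w t) \<partial>\<mu>)"
  shows "ennreal w0 * (\<integral>\<^sup>+t. g t \<partial>\<mu>) \<le> (\<integral>\<^sup>+t. g t \<partial>\<nu>)"
proof -
  have [measurable]: "g \<in> borel_measurable \<mu>" 
    using assms(2) unfolding measurable_cong_sets[OF assms(1) refl] .
  have "ennreal w0 * (\<integral>\<^sup>+t. g t \<partial>\<mu>) = (\<integral>\<^sup>+t. ennreal w0 * g t \<partial>\<mu>)" by (rule nn_integral_cmult[symmetric]) measurable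
  also have "\<dots> \<le> (\<integral>\<^sup>+t. g t * ennreal (w t) \<partial>\<mu>)"
  proof (rule nn_integral_mono)
    fix t show "ennreal w0 * g t \<le> g t * ennreal (w t)"
    proof (cases "g t = 0")
      case False
      from le[OF this] have "ennreal w0 \<le> ennreal (w t)" by (rule ennreal_leI)
      then show ?thesis by (subst mult.commute) (rule mult_left_mono, simp_all)
    qed simp
  qed
  finally show ?thesis unfolding eq .
qed

text \<open>One finite stage of the estimate, with all of the first n gaps except gap k filled at the end.\<close>
lemma right_mass_step:
  assumes \<rho>: "\<rho> \<in> reflectionless_measures E" and P: "(\<integral>\<^sup>+t. right_kernel t \<partial>\<rho>) = ennreal P" "P \<ge> 0"
  shows "\<exists>\<tau> N. \<tau> \<in> reflectionless_measures (filled (first_gaps n)) \<and> zero_at \<tau> (\<alpha> k) (\<beta> k) (\<alpha> k) \<and>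
     N \<ge> 0 \<and> (\<integral>\<^sup>+t. left_kernel t \<partial>\<tau>) = ennreal N \<and>
     P \<le> extremal_value J \<alpha> \<beta> x + (\<Prod>j\<in>first_gaps n. factor j) * N"
proof -
  define L where "L = {j \<in> first_gaps n. \<beta> j \<le> \<alpha> k}"
  define R where "R = {j \<in> first_gaps n. \<beta> k \<le> \<alpha> j}"
  have LR: "first_gaps n = L \<union> R"
    using gap_order[OF _ k] first_gaps(2,3)[of n] unfolding L_def R_def by blast
  have disj: "L \<inter> R = {}" using order_k gap_less first_gaps(2)[of n] unfolding L_def R_def by force
  have fin: "finite L" "finite R" using first_gaps(1)[of n] unfolding L_def R_def by auto
  have sub: "L \<subseteq> J" "R \<subseteq> J" "k \<notin> L" "k \<notin> R" using first_gaps(2,3)[of n] unfolding L_def R_def by auto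
  have farL: "far j = \<alpha> j \<and> near j = \<beta> j" if "j \<in> L" for j using that far_left[of j] sub by (auto simp: L_def)
  have farR: "far j = \<beta> j \<and> near j = \<alpha> j" if "j \<in> R" for j using that far_right[of j] sub by (auto simp: R_def)
  define wL where "wL t = (\<Prod>j\<in>L. fill_weight (far j) (near j) t)" for t
  define wR where "wR t = (\<Prod>j\<in>R. fill_weight (far j) (near j) t)" for t
  define fL where "fL = (\<Prod>j\<in>L. factor j)"
  define fR where "fR = (\<Prod>j\<in>R. factor j)"
  have wf: "wL x * fL = 1" "wR x * fR = 1" unfolding wL_def fL_def wR_def fR_def using weights_factors sub by auto
  have f0: "fL > 0" "fR > 0" unfolding fL_def fR_def using factor_ge_1 sub by (force intro!: prod_pos)+
  have w0: "wL x > 0" "wR x > 0" using wf f0 by (metis zero_less_mult_pos2 zero_less_one)+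
  have fac: "(\<Prod>j\<in>first_gaps n. factor j) = fL * fR"
    unfolding LR fL_def fR_def by (rule prod.union_disjoint[OF fin disj])
  \<comment> \<open>This increases the mass to the right of x, since there the weight (t - c)/(t - g) is at least 1.\<close>
  have \<rho>0: "\<rho> \<in> reflectionless_measures (filled {})" using \<rho> by simp
  obtain \<sigma>1 where \<sigma>1: "\<sigma>1 \<in> reflectionless_measures E" "\<And>j. j \<in> insert k L \<Longrightarrow> zero_at \<sigma>1 (\<alpha> j) (\<beta> j) (\<alpha> j)"
    and r1: "(\<integral>\<^sup>+t. right_kernel t \<partial>\<rho>) \<le> (\<integral>\<^sup>+t. right_kernel t \<partial>\<sigma>1)"
  proof (rule move_set[of "{}" "insert k L" \<alpha> \<beta> \<rho>])
    fix \<sigma> assume *: "\<sigma> \<in> reflectionless_measures (filled {})" "\<And>j. j \<in> insert k L \<Longrightarrow> zero_at \<sigma> (\<alpha> j) (\<beta> j) (\<alpha> j)"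
      "\<And>g. g \<in> borel_measurable borel \<Longrightarrow> (\<And>t j. g t \<noteq> 0 \<Longrightarrow> j \<in> insert k L \<Longrightarrow> 0 \<le> (t - \<beta> j) * (\<beta> j - \<alpha> j)) \<Longrightarrow> (\<integral>\<^sup>+t. g t \<partial>\<rho>) \<le> (\<integral>\<^sup>+t. g t \<partial>\<sigma>)"
    show thesis
    proof (rule that)
      show "(\<integral>\<^sup>+t. right_kernel t \<partial>\<rho>) \<le> (\<integral>\<^sup>+t. right_kernel t \<partial>\<sigma>)"
      proof (rule *(3))
        fix t j assume "right_kernel t \<noteq> 0" "j \<in> insert k L"
        then have "\<beta> j \<le> t" "\<alpha> j < \<beta> j" using right_kernel_support[of t] gap_less[of j] k sub order_k by (auto simp: L_def)
        then show "0 \<le> (t - \<beta> j) * (\<beta> j - \<alpha> j)" by simp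
      qed measurable
    qed (use * in auto)
  qed (use fin sub k \<rho>0 in auto)
  have rc1: "\<bar>rcauchy \<sigma>1 x\<bar> \<le> extremal_value J \<alpha> \<beta> x" by (rule rcauchy_le_extremal[OF \<sigma>1(1)])
  \<comment> \<open>To the right of x the weights are at least their values at x, the reciprocals of the factors.\<close>
  have \<sigma>10: "\<sigma>1 \<in> reflectionless_measures (filled {})" using \<sigma>1 by simp
  have gL: "filled L \<inter> gap k = {}" using filled_gap[OF sub(1) k sub(3)] .
  obtain \<tau>1 where \<tau>1: "\<tau>1 \<in> reflectionless_measures (filled L)" "zero_at \<tau>1 (\<alpha> k) (\<beta> k) (\<alpha> k)"
    and rc2: "rcauchy \<tau>1 x = rcauchy \<sigma>1 x * wL x"
    and r2: "ennreal (wL x) * (\<integral>\<^sup>+t. right_kernel t \<partial>\<sigma>1) \<le> (\<integral>\<^sup>+t. right_kernel t \<partial>\<tau>1)"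
  proof (rule fill_set[of "{}" L far near \<sigma>1])
    fix \<tau> assume *: "\<tau> \<in> reflectionless_measures (filled ({} \<union> L))"
      "\<And>i e. i \<in> J - L - {} \<Longrightarrow> zero_at \<sigma>1 (\<alpha> i) (\<beta> i) e \<Longrightarrow> zero_at \<tau> (\<alpha> i) (\<beta> i) e"
      "\<And>s. apart (filled ({} \<union> L)) (of_real s) \<Longrightarrow> rcauchy \<tau> s = rcauchy \<sigma>1 s * (\<Prod>j\<in>L. fill_weight (far j) (near j) s)"
      "\<And>g. g \<in> borel_measurable borel \<Longrightarrow> (\<And>j t. j \<in> L \<Longrightarrow> t \<in> gap j \<Longrightarrow> g t = 0) \<Longrightarrow>
        (\<integral>\<^sup>+t. g t \<partial>\<tau>) = (\<integral>\<^sup>+t. g t * ennreal (\<Prod>j\<in>L. fill_weight (far j) (near j) t) \<partial>\<sigma>1)"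
    show thesis
    proof (rule that)
      show "zero_at \<tau> (\<alpha> k) (\<beta> k) (\<alpha> k)" using *(2) \<sigma>1(2)[of k] k sub by auto
      show "rcauchy \<tau> x = rcauchy \<sigma>1 x * wL x" using *(3) apart_gap[OF x gL] by (simp add: wL_def)
      show "ennreal (wL x) * (\<integral>\<^sup>+t. right_kernel t \<partial>\<sigma>1) \<le> (\<integral>\<^sup>+t. right_kernel t \<partial>\<tau>)"
      proof (rule weighted_integral_ge[where w = wL])
        show "sets \<sigma>1 = sets borel" using prob_measure_onD(1)[OF prob_of[OF \<sigma>1(1)]] .
        show "wL x \<le> wL t" if "right_kernel t \<noteq> 0" for t
          unfolding wL_def using right_kernel_support[OF that] order_k sub fin by (intro weights_mono) (auto simp: L_def)
        show "(\<integral>\<^sup>+t. right_kernel t \<partial>\<tau>) = (\<integral>\<^sup>+t. right_kernel t * ennreal (wL t) \<partial>\<sigma>1)"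
          unfolding wL_def
        proof (rule *(4))
          fix j t assume "j \<in> L" "t \<in> gap j"
          then have "\<not> \<beta> k \<le> t" using order_k by (auto simp: L_def)
          then show "right_kernel t = 0" using right_kernel_support by blast
        qed measurable
      qed measurable
    qed (use * in simp)
  qed (use fin sub \<sigma>10 \<sigma>1(2) farL in auto)
  from gap_split[OF prob_of[OF \<tau>1(1)] gL x] obtain P1 N1 where PN1: "P1 \<ge> 0" "N1 \<ge> 0"
    "(\<integral>\<^sup>+t. right_kernel t \<partial>\<tau>1) = ennreal P1" "(\<integral>\<^sup>+t. left_kernel t \<partial>\<tau>1) = ennreal N1" "rcauchy \<tau>1 x = P1 - N1"
    unfolding right_kernel_def left_kernel_def .
  have "ennreal (wL x) * ennreal P \<le> ennreal P1"
    using mult_left_mono[OF r1, of "ennreal (wL x)"] r2 unfolding P(1) PN1(3) by (rule order_trans) simp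
  then have PP1: "wL x * P \<le> P1" using w0 P(2) PN1(1) by (simp flip: ennreal_mult'')
  \<comment> \<open>Now the integral to the left of x is to grow, so the gaps on the right get their zeros on the right.\<close>
  obtain \<sigma>2 where \<sigma>2: "\<sigma>2 \<in> reflectionless_measures (filled L)" "\<And>j. j \<in> R \<Longrightarrow> zero_at \<sigma>2 (\<alpha> j) (\<beta> j) (\<beta> j)"
    "zero_at \<sigma>2 (\<alpha> k) (\<beta> k) (\<alpha> k)"
    and l1: "(\<integral>\<^sup>+t. left_kernel t \<partial>\<tau>1) \<le> (\<integral>\<^sup>+t. left_kernel t \<partial>\<sigma>2)"
  proof (rule move_set[of L R \<beta> \<alpha> \<tau>1])
    fix \<sigma> assume *: "\<sigma> \<in> reflectionless_measures (filled L)" "\<And>j. j \<in> R \<Longrightarrow> zero_at \<sigma> (\<alpha> j) (\<beta> j) (\<beta> j)"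
      "\<And>i e. i \<in> J - R - L \<Longrightarrow> zero_at \<tau>1 (\<alpha> i) (\<beta> i) e \<Longrightarrow> zero_at \<sigma> (\<alpha> i) (\<beta> i) e"
      "\<And>g. g \<in> borel_measurable borel \<Longrightarrow> (\<And>t j. g t \<noteq> 0 \<Longrightarrow> j \<in> R \<Longrightarrow> 0 \<le> (t - \<alpha> j) * (\<alpha> j - \<beta> j)) \<Longrightarrow> (\<integral>\<^sup>+t. g t \<partial>\<tau>1) \<le> (\<integral>\<^sup>+t. g t \<partial>\<sigma>)"
    show thesis
    proof (rule that)
      show "zero_at \<sigma> (\<alpha> k) (\<beta> k) (\<alpha> k)" using *(3) \<tau>1(2) k sub by auto
      show "(\<integral>\<^sup>+t. left_kernel t \<partial>\<tau>1) \<le> (\<integral>\<^sup>+t. left_kernel t \<partial>\<sigma>)"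
      proof (rule *(4))
        fix t j assume "left_kernel t \<noteq> 0" "j \<in> R"
        then have "t \<le> \<alpha> j" "\<alpha> j < \<beta> j" using left_kernel_support[of t] gap_less[of j] sub order_k by (auto simp: R_def)
        then show "0 \<le> (t - \<alpha> j) * (\<alpha> j - \<beta> j)" by (simp add: mult_nonpos_nonpos)
      qed measurable
    qed (use * in auto)
  qed (use fin sub disj \<tau>1 in auto)
  \<comment> \<open>To the left of x, too, the weights are at least their values at x.\<close>
  obtain \<tau>2 where \<tau>2: "\<tau>2 \<in> reflectionless_measures (filled (first_gaps n))" "zero_at \<tau>2 (\<alpha> k) (\<beta> k) (\<alpha> k)"
    and l2: "ennreal (wR x) * (\<integral>\<^sup>+t. left_kernel t \<partial>\<sigma>2) \<le> (\<integral>\<^sup>+t. left_kernel t \<partial>\<tau>2)"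
  proof (rule fill_set[of L R far near \<sigma>2])
    fix \<tau> assume *: "\<tau> \<in> reflectionless_measures (filled (L \<union> R))"
      "\<And>i e. i \<in> J - R - L \<Longrightarrow> zero_at \<sigma>2 (\<alpha> i) (\<beta> i) e \<Longrightarrow> zero_at \<tau> (\<alpha> i) (\<beta> i) e"
      "\<And>g. g \<in> borel_measurable borel \<Longrightarrow> (\<And>j t. j \<in> R \<Longrightarrow> t \<in> gap j \<Longrightarrow> g t = 0) \<Longrightarrow>
        (\<integral>\<^sup>+t. g t \<partial>\<tau>) = (\<integral>\<^sup>+t. g t * ennreal (\<Prod>j\<in>R. fill_weight (far j) (near j) t) \<partial>\<sigma>2)"
    show thesis
    proof (rule that)
      show "\<tau> \<in> reflectionless_measures (filled (first_gaps n))" using *(1) LR by simp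
      show "zero_at \<tau> (\<alpha> k) (\<beta> k) (\<alpha> k)" using *(2) \<sigma>2(3) k sub by auto
      show "ennreal (wR x) * (\<integral>\<^sup>+t. left_kernel t \<partial>\<sigma>2) \<le> (\<integral>\<^sup>+t. left_kernel t \<partial>\<tau>)"
      proof (rule weighted_integral_ge[where w = wR])
        show "sets \<sigma>2 = sets borel" using prob_measure_onD(1)[OF prob_of[OF \<sigma>2(1)]] .
        show "wR x \<le> wR t" if "left_kernel t \<noteq> 0" for t
          unfolding wR_def using left_kernel_support[OF that] order_k sub fin by (intro weights_mono) (auto simp: R_def)
        show "(\<integral>\<^sup>+t. left_kernel t \<partial>\<tau>) = (\<integral>\<^sup>+t. left_kernel t * ennreal (wR t) \<partial>\<sigma>2)"
          unfolding wR_def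
        proof (rule *(3))
          fix j t assume "j \<in> R" "t \<in> gap j"
          then have "\<not> t \<le> \<alpha> k" using order_k by (auto simp: R_def)
          then show "left_kernel t = 0" using left_kernel_support by blast
        qed measurable
      qed measurable
    qed
  qed (use fin sub disj \<sigma>2 farR in auto)
  have g2: "filled (first_gaps n) \<inter> gap k = {}" using filled_gap[OF first_gaps(2) k first_gaps(3)] .
  from gap_split[OF prob_of[OF \<tau>2(1)] g2 x] obtain N2 where N2: "N2 \<ge> 0" "(\<integral>\<^sup>+t. left_kernel t \<partial>\<tau>2) = ennreal N2"
    unfolding right_kernel_def left_kernel_def .
  have "ennreal (wR x) * ennreal N1 \<le> ennreal N2"
    using mult_left_mono[OF l1, of "ennreal (wR x)"] l2 unfolding N2(2) PN1(4) by (rule order_trans) simp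
  then have "wR x * N1 \<le> N2" using w0 PN1(2) N2(1) by (simp flip: ennreal_mult'')
  then have "(wR x * fR) * N1 \<le> fR * N2" using f0(2) by (metis mult.assoc mult.left_commute mult_left_mono less_imp_le)
  then have NN: "N1 \<le> fR * N2" by (simp add: wf)
  have "wL x * P \<le> rcauchy \<sigma>1 x * wL x + N1" using PP1 PN1(5) rc2 by linarith
  then have "fL * (wL x * P) \<le> fL * (rcauchy \<sigma>1 x * wL x + N1)" using f0(1) by (intro mult_left_mono) auto
  then have "(wL x * fL) * P \<le> (wL x * fL) * rcauchy \<sigma>1 x + fL * N1" by (simp add: algebra_simps)
  then have "P \<le> rcauchy \<sigma>1 x + fL * N1" by (simp add: wf)
  also have "fL * N1 \<le> fL * (fR * N2)" using NN f0(1) by (intro mult_left_mono) auto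
  finally have "P \<le> extremal_value J \<alpha> \<beta> x + (fL * fR) * N2" using rc1 by (simp add: mult.assoc)
  with \<tau>2 N2 show ?thesis unfolding fac by blast
qed

text \<open>In the limit the integral to the left of x is an integral over the arcsine distribution.  The factor of
gap k is at least 1 and is simply inserted.\<close>
lemma right_mass:
  assumes \<rho>: "\<rho> \<in> reflectionless_measures E" and P: "(\<integral>\<^sup>+t. right_kernel t \<partial>\<rho>) = ennreal P" "P \<ge> 0"
  shows "P \<le> extremal_value J \<alpha> \<beta> x * (4 + ln ((\<beta> k - \<beta> 0) / (\<beta> k - \<alpha> k)))"
proof -
  have "\<exists>f. \<forall>n. (case f n of (\<tau>, N) \<Rightarrow> \<tau> \<in> reflectionless_measures (filled (first_gaps n)) \<and> zero_at \<tau> (\<alpha> k) (\<beta> k) (\<alpha> k) \<and>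
     N \<ge> 0 \<and> (\<integral>\<^sup>+t. left_kernel t \<partial>\<tau>) = ennreal N \<and>
     P \<le> extremal_value J \<alpha> \<beta> x + (\<Prod>j\<in>first_gaps n. factor j) * N)"
    by (rule choice) (use right_mass_step[OF \<rho> P] in auto)
  then obtain f where f: "\<And>n. (case f n of (\<tau>, N) \<Rightarrow> \<tau> \<in> reflectionless_measures (filled (first_gaps n)) \<and> zero_at \<tau> (\<alpha> k) (\<beta> k) (\<alpha> k) \<and>
     N \<ge> 0 \<and> (\<integral>\<^sup>+t. left_kernel t \<partial>\<tau>) = ennreal N \<and>
     P \<le> extremal_value J \<alpha> \<beta> x + (\<Prod>j\<in>first_gaps n. factor j) * N)" by blast
  define \<tau> N where "\<tau> n = fst (f n)" and "N n = snd (f n)" for n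
  have \<tau>: "\<tau> n \<in> reflectionless_measures (filled (first_gaps n))" "zero_at (\<tau> n) (\<alpha> k) (\<beta> k) (\<alpha> k)"
    "N n \<ge> 0" "(\<integral>\<^sup>+t. left_kernel t \<partial>\<tau> n) = ennreal (N n)"
    "P \<le> extremal_value J \<alpha> \<beta> x + (\<Prod>j\<in>first_gaps n. factor j) * N n" for n
    using f[of n] unfolding \<tau>_def N_def by (auto split: prod.splits)
  define V where "V = (\<integral>t. tail_kernel (\<alpha> k) (\<beta> k) x t \<partial>arcsine (\<beta> 0) (\<alpha> 0))"
  have V0: "V \<ge> 0" unfolding V_def using tail_kernel_bound(1)[OF order_k(4,5)] by (intro Bochner_Integration.integral_nonneg)
  have "(\<lambda>n. \<integral>\<^sup>+t. left_kernel t \<partial>\<tau> n) \<longlonglongrightarrow> ennreal V"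
    unfolding left_kernel_def V_def
    by (rule one_gap_limit(2)[where c = "\<alpha> k" and d = "\<beta> k", OF order_k(1,2,3) x _ \<tau>(1,2) filled_borel[OF first_gaps(1)] filled_sub[OF first_gaps(2,3)] unfilled_measure_lim]) auto
  then have Nlim: "N \<longlonglongrightarrow> V" unfolding \<tau>(4) using \<tau>(3) V0 by (subst (asm) tendsto_ennreal_iff) auto
  have fk: "factor k \<ge> 1" by (rule factor_ge_1[OF k])
  define T where "T = (\<Prod>j. if j \<in> J then factor j else 1)"
  have "(\<lambda>n. extremal_value J \<alpha> \<beta> x + (\<Prod>j\<in>first_gaps n. factor j) * N n) \<longlonglongrightarrow> extremal_value J \<alpha> \<beta> x + T / factor k * V"
    unfolding T_def by (intro tendsto_intros first_factors_lim Nlim)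
  then have 1: "P \<le> extremal_value J \<alpha> \<beta> x + T / factor k * V"
    by (rule LIMSEQ_le_const) (use \<tau>(5) in auto)
  have T0: "T / factor k \<ge> 0"
  proof (rule LIMSEQ_le_const[OF first_factors_lim[folded T_def]], intro exI allI impI prod_nonneg)
    fix n j assume "j \<in> first_gaps n"
    then have "j \<in> J" using first_gaps(2) by auto
    from factor_ge_1[OF this] show "0 \<le> factor j" by simp
  qed
  have T1: "0 \<le> T" using T0 fk by (simp add: zero_le_divide_iff)
  define l where "l = ln ((\<beta> k - \<beta> 0) / (\<beta> k - \<alpha> k))"
  have V: "V \<le> (3 + l) / sqrt ((x - \<beta> 0) * (\<alpha> 0 - x))"
    unfolding V_def l_def by (rule arcsine_tail_bound) (use order_k in auto)
  have "T / factor k * V \<le> T * V"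
  proof (rule mult_right_mono[OF _ V0])
    have "T / factor k \<le> T / 1" using fk T1 by (intro divide_left_mono) auto
    then show "T / factor k \<le> T" by simp
  qed
  also have "\<dots> \<le> T * ((3 + l) / sqrt ((x - \<beta> 0) * (\<alpha> 0 - x)))" using V T1 by (rule mult_left_mono)
  also have "\<dots> = extremal_value J \<alpha> \<beta> x * (3 + l)" by (simp add: extremal_value_def T_def)
  finally have "P \<le> extremal_value J \<alpha> \<beta> x + extremal_value J \<alpha> \<beta> x * (3 + l)" using 1 by linarith
  then show ?thesis unfolding l_def by (simp add: algebra_simps)
qed

text \<open>The sum of the integrals over the two sides is twice the right one minus their difference, and this
difference is the Cauchy transform at x.\<close>
lemma one_sided_bound:
  assumes \<rho>: "\<rho> \<in> reflectionless_measures E"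
  shows "(\<integral>t. 1 / \<bar>t - x\<bar> \<partial>\<rho>) \<le> (9 + 2 * ln ((\<beta> k - \<beta> 0) / (\<beta> k - \<alpha> k))) * extremal_value J \<alpha> \<beta> x"
proof -
  from gap_split[OF prob_of[OF \<rho>] apart_x(1) x] obtain P N where PN: "P \<ge> 0"
    "(\<integral>\<^sup>+t. right_kernel t \<partial>\<rho>) = ennreal P" "rcauchy \<rho> x = P - N" "(\<integral>t. 1 / \<bar>t - x\<bar> \<partial>\<rho>) = P + N"
    unfolding right_kernel_def .
  have "P + N = 2 * P - rcauchy \<rho> x" using PN(3) by simp
  also have "\<dots> \<le> 2 * (extremal_value J \<alpha> \<beta> x * (4 + ln ((\<beta> k - \<beta> 0) / (\<beta> k - \<alpha> k)))) + extremal_value J \<alpha> \<beta> x"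
    using right_mass[OF \<rho> PN(2,1)] rcauchy_le_extremal[OF \<rho>] by linarith
  finally show ?thesis unfolding PN(4) by (simp add: algebra_simps)
qed

end

section \<open>Reflection and conclusion\<close>

definition reflect :: "real measure \<Rightarrow> real measure" where "reflect \<mu> = distr \<mu> borel uminus"

lemma cauchy_reflect:
  assumes "sets \<mu> = sets borel"
  shows "cauchy (reflect \<mu>) (Complex (- t) y) = - cnj (cauchy \<mu> (Complex t y))"
proof -
  note [measurable_cong] = assms
  have "cauchy (reflect \<mu>) (Complex (- t) y) = (\<integral>s. 1 / (of_real (- s) - Complex (- t) y) \<partial>\<mu>)"
    unfolding cauchy_def reflect_def by (subst integral_distr) auto
  also have "\<dots> = (\<integral>s. - cnj (1 / (of_real s - Complex t y)) \<partial>\<mu>)"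
  proof (rule Bochner_Integration.integral_cong[OF refl])
    fix s
    have "of_real (- s) - Complex (- t) y = - cnj (of_real s - Complex t y)" by (simp add: complex_eq_iff)
    then show "1 / (of_real (- s) - Complex (- t) y) = - cnj (1 / (of_real s - Complex t y))"
      by (simp only: complex_cnj_divide complex_cnj_one divide_minus_right)
  qed
  also have "\<dots> = - cnj (cauchy \<mu> (Complex t y))"
    unfolding cauchy_def Bochner_Integration.integral_minus
    using Bochner_Integration.integral_cnj[of \<mu> "\<lambda>s. 1 / (of_real s - Complex t y)"] by (simp only:)
  finally show ?thesis .
qed

lemma reflect_reflectionless:
  assumes E: "E \<in> sets borel" and \<mu>: "\<mu> \<in> reflectionless_measures E"
  shows "reflect \<mu> \<in> reflectionless_measures (uminus ` E)"
proof -
  from \<mu> have m: "prob_measure_on E \<mu>" and bv: "AE x in lborel. x \<in> E \<longrightarrow> imaginary_boundary_value \<mu> x"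
    unfolding reflectionless_measures_iff[OF E] by auto
  note [measurable_cong] = prob_measure_onD(1)[OF m]
  note [measurable] = E
  interpret prob_space \<mu> using prob_measure_onD(2)[OF m] .
  have img: "uminus ` E = uminus -` E" by force
  have E': "uminus ` E \<in> sets borel"
  proof -
    have "uminus -` E \<inter> space borel \<in> sets borel" by (rule measurable_sets[OF _ E]) measurable
    then show ?thesis unfolding img by simp
  qed
  note [measurable] = E'
  have "prob_measure_on (uminus ` E) (reflect \<mu>)"
    unfolding prob_measure_on_def
  proof (intro conjI)
    show "sets (reflect \<mu>) = sets borel" by (simp add: reflect_def)
    show "prob_space (reflect \<mu>)" unfolding reflect_def by (rule prob_space_distr) measurable
    show "AE t in reflect \<mu>. t \<in> uminus ` E"
      unfolding reflect_def using prob_measure_onD(3)[OF m] by (subst AE_distr_iff) auto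
  qed
  moreover have "AE t in lborel. t \<in> uminus ` E \<longrightarrow> imaginary_boundary_value (reflect \<mu>) t"
  proof -
    have "AE t in lborel. - t \<in> E \<longrightarrow> imaginary_boundary_value \<mu> (- t)"
    proof -
      have "AE t in distr lborel borel uminus. t \<in> E \<longrightarrow> imaginary_boundary_value \<mu> t"
        unfolding lborel_distr_uminus by (rule bv)
      from AE_distrD[OF _ this] show ?thesis by simp
    qed
    then show ?thesis
    proof eventually_elim
      case (elim t)
      show ?case
      proof
        assume "t \<in> uminus ` E"
        then have "imaginary_boundary_value \<mu> (- t)" using elim by auto
        then obtain w where w: "((\<lambda>y. cauchy \<mu> (Complex (- t) y)) \<longlongrightarrow> w) (at_right 0)" "Re w = 0" by (auto simp: imaginary_boundary_value_def)
        have "((\<lambda>y. - cnj (cauchy \<mu> (Complex (- t) y))) \<longlongrightarrow> - cnj w) (at_right 0)" by (intro tendsto_intros w(1))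
        then have "((\<lambda>y. cauchy (reflect \<mu>) (Complex t y)) \<longlongrightarrow> - cnj w) (at_right 0)"
          using cauchy_reflect[OF prob_measure_onD(1)[OF m], of "- t"] by simp
        then show "imaginary_boundary_value (reflect \<mu>) t" unfolding imaginary_boundary_value_def using w(2) by (intro exI[of _ "- cnj w"]) simp
      qed
    qed
  qed
  ultimately show ?thesis unfolding reflectionless_measures_iff[OF E'] by simp
qed

context inner_gap
begin

lemma reflected: "inner_gap (uminus ` E) J (\<lambda>j. - \<beta> j) (\<lambda>j. - \<alpha> j) k (- x)"
proof
  show "compact (uminus ` E)" by (rule compact_continuous_image[OF _ compact_E]) (intro continuous_intros)
  show "uminus ` E \<noteq> {}" using E_ne by simp
  show "- x \<in> {- \<beta> k<..<- \<alpha> k}" using x by auto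
  have r: "uminus ` {a<..<b} = {- b<..<- a}" for a b :: real
    by (rule image_uminus_greaterThanLessThan)
  have inf: "Inf (uminus ` E) = - Sup E" and sup: "Sup (uminus ` E) = - Inf E"
    by (simp_all add: Inf_real_def Sup_real_def image_image)
  have "\<beta> 0 = Inf E" "\<alpha> 0 = Sup E" using enum by (auto simp: gap_enumeration_def)
  moreover have "{- \<alpha> 0..- \<beta> 0} - uminus ` E = (\<Union>j\<in>J. {- \<beta> j<..<- \<alpha> j})"
  proof -
    have "{- \<alpha> 0..- \<beta> 0} - uminus ` E = uminus ` ({\<beta> 0..\<alpha> 0} - E)"
      by (subst image_set_diff) (simp_all add: inj_def)
    then show ?thesis unfolding complement_E by (simp add: image_UN r)
  qed
  moreover have "disjoint_family_on (\<lambda>j. {- \<beta> j<..<- \<alpha> j}) J"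
    unfolding disjoint_family_on_def
  proof (intro ballI impI)
    fix i j assume "i \<in> J" "j \<in> J" "i \<noteq> j"
    then have "uminus ` (gap i \<inter> gap j) = {}" using gap_disjoint by simp
    then show "{- \<beta> i<..<- \<alpha> i} \<inter> {- \<beta> j<..<- \<alpha> j} = {}" unfolding r[symmetric] by (auto simp: image_iff)
  qed
  ultimately show "gap_enumeration (uminus ` E) J (\<lambda>j. - \<beta> j) (\<lambda>j. - \<alpha> j)"
    using enum gap_less inf sup unfolding gap_enumeration_def by simp
qed (rule k)

lemma extremal_reflected: "extremal_value J (\<lambda>j. - \<beta> j) (\<lambda>j. - \<alpha> j) (- x) = extremal_value J \<alpha> \<beta> x"
proof -
  have a: "\<bar>- x - - u\<bar> = \<bar>x - u\<bar>" for u by simp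
  have "(- x - - \<alpha> 0) * (- \<beta> 0 - - x) = (x - \<beta> 0) * (\<alpha> 0 - x)" by (simp add: algebra_simps)
  moreover have f: "gap_factor (\<lambda>j. - \<beta> j) (\<lambda>j. - \<alpha> j) (- x) j = gap_factor \<alpha> \<beta> x j" for j
    unfolding gap_factor_def a max.commute[of "\<bar>x - \<beta> j\<bar>"] min.commute[of "\<bar>x - \<beta> j\<bar>"] ..
  ultimately show ?thesis unfolding extremal_value_def f by (simp only:)
qed

lemma integral_bound:
  assumes \<rho>: "\<rho> \<in> reflectionless_measures E"
  shows "(\<integral>t. 1 / \<bar>t - x\<bar> \<partial>\<rho>) \<le> gap_const \<alpha> \<beta> k * extremal_value J \<alpha> \<beta> x"
proof -
  note [measurable_cong] = prob_measure_onD(1)[OF prob_of[OF \<rho>]]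
  have "(\<integral>t. 1 / \<bar>t - - x\<bar> \<partial>reflect \<rho>) = (\<integral>t. 1 / \<bar>- t - - x\<bar> \<partial>\<rho>)"
    unfolding reflect_def by (subst integral_distr) auto
  also have "\<dots> = (\<integral>t. 1 / \<bar>t - x\<bar> \<partial>\<rho>)" by (simp add: abs_minus_commute)
  finally have "(\<integral>t. 1 / \<bar>t - x\<bar> \<partial>\<rho>) \<le> (9 + 2 * ln ((\<alpha> 0 - \<alpha> k) / (\<beta> k - \<alpha> k))) * extremal_value J \<alpha> \<beta> x"
    using inner_gap.one_sided_bound[OF reflected reflect_reflectionless[OF E_borel \<rho>]]
    by (simp add: extremal_reflected add.commute)
  with one_sided_bound[OF \<rho>] show ?thesis unfolding gap_const_def by (auto simp: min_def)
qed

lemma gap_const_nonneg: "0 \<le> gap_const \<alpha> \<beta> k"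
proof -
  have "0 \<le> ln ((\<beta> k - \<beta> 0) / (\<beta> k - \<alpha> k))" "0 \<le> ln ((\<alpha> 0 - \<alpha> k) / (\<beta> k - \<alpha> k))"
    using order_k by (auto simp: le_divide_eq)
  then show ?thesis unfolding gap_const_def by (simp add: min_def)
qed

end

theorem theorem2p2:
  fixes E :: "real set" and J :: "nat set" and \<alpha> \<beta> :: "nat \<Rightarrow> real"
    and \<rho> :: "real measure" and k :: nat and x :: real
  assumes "compact E"
    and "essentially_closed E"
    and "gap_enumeration E J \<alpha> \<beta>"
    and "\<rho> \<in> reflectionless_measures E"
    and "absolutely_continuous lborel \<rho>"
    and "k \<in> J"
    and "x \<in> {\<alpha> k<..<\<beta> k}"
  shows "(LINT t:E|\<rho>. 1 / \<bar>t - x\<bar>)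
           \<le> gap_const \<alpha> \<beta> k * (SUP \<mu>\<in>reflectionless_measures E. \<bar>LINT t:E|\<mu>. 1 / (t - x)\<bar>)
       \<and> (\<forall>\<gamma> :: nat \<Rightarrow> real.
            (\<forall>j\<in>J. \<gamma> j \<in> {\<alpha> j, \<beta> j} \<and> \<bar>x - \<gamma> j\<bar> = max \<bar>x - \<alpha> j\<bar> \<bar>x - \<beta> j\<bar>) \<longrightarrow>
            (LINT t:E|\<rho>. 1 / \<bar>t - x\<bar>)
              \<le> gap_const \<alpha> \<beta> k / sqrt (\<bar>x - \<beta> 0\<bar> * \<bar>x - \<alpha> 0\<bar>)
                * (\<Prod>j. if j \<in> J then \<bar>x - \<gamma> j\<bar> / sqrt (\<bar>x - \<alpha> j\<bar> * \<bar>x - \<beta> j\<bar>) else 1))"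
proof -
  have "E \<noteq> {}"
  proof
    assume "E = {}"
    moreover have "prob_measure_on E \<rho>" using assms(4) by (simp add: reflectionless_measures_def)
    ultimately have "AE t in \<rho>. False" "prob_space \<rho>" by (auto simp: prob_measure_on_def)
    then show False by (simp add: prob_space.AE_False)
  qed
  then interpret inner_gap E J \<alpha> \<beta> k x using assms by unfold_locales
  have restrict: "(LINT t:E|\<mu>. f t) = (\<integral>t. f t \<partial>\<mu>)"
    if \<mu>: "\<mu> \<in> reflectionless_measures E" and [measurable]: "f \<in> borel_measurable borel" for \<mu> and f :: "real \<Rightarrow> real"
  proof -
    note [measurable_cong] = prob_measure_onD(1)[OF prob_of[OF \<mu>]]
    note [measurable] = E_borel
    show ?thesis unfolding set_lebesgue_integral_def
      by (rule integral_cong_AE) (use prob_measure_onD(3)[OF prob_of[OF \<mu>]] in \<open>auto elim!: eventually_mono\<close>)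
  qed
  have lhs: "(LINT t:E|\<rho>. 1 / \<bar>t - x\<bar>) \<le> gap_const \<alpha> \<beta> k * extremal_value J \<alpha> \<beta> x"
    using integral_bound[OF assms(4)] by (subst restrict[OF assms(4)]) auto
  have val: "\<bar>LINT t:E|\<mu>. 1 / (t - x)\<bar> = \<bar>rcauchy \<mu> x\<bar>" if "\<mu> \<in> reflectionless_measures E" for \<mu>
    by (subst restrict[OF that]) (auto simp: rcauchy_def)
  have "bdd_above ((\<lambda>\<mu>. \<bar>LINT t:E|\<mu>. 1 / (t - x)\<bar>) ` reflectionless_measures E)"
    by (rule bdd_aboveI2[where M = "extremal_value J \<alpha> \<beta> x"]) (simp add: val rcauchy_le_extremal)
  then have "\<bar>rcauchy \<mu> x\<bar> \<le> (SUP \<mu>\<in>reflectionless_measures E. \<bar>LINT t:E|\<mu>. 1 / (t - x)\<bar>)"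
    if "\<mu> \<in> reflectionless_measures E" for \<mu>
    using cSUP_upper[OF that] val[OF that] by metis
  then have "extremal_value J \<alpha> \<beta> x \<le> (SUP \<mu>\<in>reflectionless_measures E. \<bar>LINT t:E|\<mu>. 1 / (t - x)\<bar>)"
    by (rule extremal_le_bound[OF assms(4)])
  from order_trans[OF lhs mult_left_mono[OF this gap_const_nonneg]]
  have part1: "(LINT t:E|\<rho>. 1 / \<bar>t - x\<bar>) \<le> gap_const \<alpha> \<beta> k * (SUP \<mu>\<in>reflectionless_measures E. \<bar>LINT t:E|\<mu>. 1 / (t - x)\<bar>)" .
  have part2: "(LINT t:E|\<rho>. 1 / \<bar>t - x\<bar>)
      \<le> gap_const \<alpha> \<beta> k / sqrt (\<bar>x - \<beta> 0\<bar> * \<bar>x - \<alpha> 0\<bar>)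
        * (\<Prod>j. if j \<in> J then \<bar>x - \<gamma> j\<bar> / sqrt (\<bar>x - \<alpha> j\<bar> * \<bar>x - \<beta> j\<bar>) else 1)"
    if \<gamma>: "\<forall>j\<in>J. \<gamma> j \<in> {\<alpha> j, \<beta> j} \<and> \<bar>x - \<gamma> j\<bar> = max \<bar>x - \<alpha> j\<bar> \<bar>x - \<beta> j\<bar>" for \<gamma>
  proof -
    have factor: "gap_factor \<alpha> \<beta> x j = \<bar>x - \<gamma> j\<bar> / sqrt (\<bar>x - \<alpha> j\<bar> * \<bar>x - \<beta> j\<bar>)" if j: "j \<in> J" for j
    proof -
      define M m where "M = max \<bar>x - \<alpha> j\<bar> \<bar>x - \<beta> j\<bar>" and "m = min \<bar>x - \<alpha> j\<bar> \<bar>x - \<beta> j\<bar>"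
      have Mm: "\<bar>x - \<alpha> j\<bar> * \<bar>x - \<beta> j\<bar> = M * m" by (simp add: M_def m_def max_def min_def)
      have \<gamma>M: "\<bar>x - \<gamma> j\<bar> = M" using \<gamma> j by (simp add: M_def)
      have mpos: "m > 0" using near_pos[OF j] unfolding m_def near_def by (auto simp: min_def split: if_splits)
      have "m \<le> M" by (simp add: M_def m_def)
      then have Mpos: "M > 0" using mpos by simp
      have "sqrt (M / m) = M / sqrt (M * m)"
      proof -
        have "u / v = (u * u) / (u * v)" if "u > 0" for u v :: real using that by simp
        from this[of "sqrt M" "sqrt m"] show ?thesis using Mpos mpos by (simp add: real_sqrt_divide real_sqrt_mult)
      qed
      then show ?thesis unfolding gap_factor_def Mm \<gamma>M M_def[symmetric] m_def[symmetric] .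
    qed
    have "(\<lambda>j. if j \<in> J then gap_factor \<alpha> \<beta> x j else 1)
       = (\<lambda>j. if j \<in> J then \<bar>x - \<gamma> j\<bar> / sqrt (\<bar>x - \<alpha> j\<bar> * \<bar>x - \<beta> j\<bar>) else 1)"
      using factor by auto
    moreover have "(x - \<beta> 0) * (\<alpha> 0 - x) = \<bar>x - \<beta> 0\<bar> * \<bar>x - \<alpha> 0\<bar>" using order_k by simp
    ultimately show ?thesis using lhs by (simp add: extremal_value_def)
  qed
  show ?thesis using part1 part2 by blast
qed

end
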